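(* Let $x\in\mathbb R$, $\theta\in[0,2\pi)$ and $E\ge 0$. There exists $\delta>0$ such that for all $0<\eta\le\delta$, $$w^E_{\theta,x,\eta}:=\inf_{\hat\sigma\in\mathcal S_0^E}\operatorname{Tr}(\hat\sigma\,\hat W_{\theta,x,\eta})>0 .$$
   Context: Setting: $\mathcal H=L^2(\mathbb R)$ (one bosonic mode), with position and momentum operators $\hat x,\hat p$ satisfying $[\hat x,\hat p]=i$, annihilation operator $\hat a=(\hat x+i\hat p)/\sqrt2$, number operator $\hat n=\hat a^\dagger\hat a$, and Fock basis $\{|n\rangle\}_{n\ge0}$ of eigenvectors of $\hat n$. States are density operators on $\mathcal H$; a pure state is identified with its rank-one projector $|\psi\rangle\langle\psi|$. For $\theta\in[0,2\pi)$ the quadrature operator is $\hat q_\theta=e^{-i\theta\hat n}\hat x e^{i\theta\hat n}=\hat x\cos\theta+\hat p\sin\theta$, with generalized eigenvectors $|q\rangle_{\hat q_\theta}$, $q\in\mathbb R$. Witness: for $x\in\mathbb R$, $\eta>0$, $\hat W_{\theta,x,\eta}=\int_{x-\eta/2}^{x+\eta/2}|q\rangle\langle q|_{\hat q_\theta}\,dq$, i.e. the spectral projector of the self-adjoint operator $\hat q_\theta$ for the interval $[x-\eta/2,x+\eta/2]$. Stellar rank: for a pure state $|\psi\rangle=\sum_n\psi_n|n\rangle$, $r^\star(\psi)\in\mathbb N_0\cup\{\infty\}$ is the number of zeros in $\mathbb C$, counted with multiplicity, of the entire function $F^\star_\psi(\alpha)=\sum_n\psi_n\alpha^n/\sqrt{n!}$.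 A pure state has stellar rank $0$ if and only if it is Gaussian, i.e. of the form $\hat D(\alpha)\hat S(\chi)|0\rangle$ with $\alpha,\chi\in\mathbb C$, where $\hat D(\alpha)=e^{\alpha\hat a^\dagger-\alpha^*\hat a}$ and $\hat S(\chi)=e^{\frac12(\chi^*\hat a^2-\chi\hat a^{\dagger2})}$. Energy-bounded sets: for a set $S$ of states, $\mathrm{cch}(S)$ is its closed convex hull in trace norm. For $E\ge0$ and $r\in\mathbb N_0$, $\mathcal S_r^E=\mathrm{cch}\{|\psi\rangle\langle\psi| : \|\psi\|=1,\ \langle\psi|\hat n|\psi\rangle\le E,\ r^\star(\psi)\le r\}$. In particular $\mathcal S_0^E$ is the set of mixtures of pure Gaussian states of energy at most $E$. *)

theory Defs
  imports "HOL-Complex_Analysis.Complex_Analysis"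
begin

section \<open>The Hilbert space of square-integrable functions on the real line\<close>

definition sq_int :: "(real \<Rightarrow> complex) \<Rightarrow> bool" where
  "sq_int f \<longleftrightarrow> f \<in> borel_measurable lborel \<and> integrable lborel (\<lambda>t. (cmod (f t))\<^sup>2)"

lemma sq_int_measurable [measurable_dest]: "sq_int f \<Longrightarrow> f \<in> borel_measurable lborel"
  by (simp add: sq_int_def)

lemma sq_int_zero: "sq_int (\<lambda>t. 0)"
  by (simp add: sq_int_def)

lemma sq_int_add:
  assumes "sq_int f" "sq_int g"
  shows "sq_int (\<lambda>t. f t + g t)"
proof -
  have m [measurable]: "f \<in> borel_measurable lborel" "g \<in> borel_measurable lborel"
    using assms by (auto simp: sq_int_def)
  have "integrable lborel (\<lambda>t. 2 * (cmod (f t))\<^sup>2 + 2 * (cmod (g t))\<^sup>2)"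
    using assms by (auto simp: sq_int_def)
  moreover have "(cmod (f t + g t))\<^sup>2 \<le> 2 * (cmod (f t))\<^sup>2 + 2 * (cmod (g t))\<^sup>2" for t
  proof -
    have "(cmod (f t + g t))\<^sup>2 \<le> (cmod (f t) + cmod (g t))\<^sup>2"
      by (intro power_mono norm_triangle_ineq) auto
    also have "\<dots> \<le> 2 * (cmod (f t))\<^sup>2 + 2 * (cmod (g t))\<^sup>2"
      using sum_squares_bound [of "cmod (f t)" "cmod (g t)"] by (simp add: power2_sum)
    finally show ?thesis .
  qed
  ultimately have "integrable lborel (\<lambda>t. (cmod (f t + g t))\<^sup>2)"
    by (rule_tac Bochner_Integration.integrable_bound) auto
  then show ?thesis
    by (simp add: sq_int_def)
qed

lemma sq_int_cmult: "sq_int f \<Longrightarrow> sq_int (\<lambda>t. c * f t)"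
  by (auto simp: sq_int_def norm_mult power_mult_distrib)

lemma sq_int_diff: "sq_int f \<Longrightarrow> sq_int g \<Longrightarrow> sq_int (\<lambda>t. f t - g t)"
  using sq_int_add [of f "\<lambda>t. -1 * g t"] sq_int_cmult [of g "-1"] by simp

lemma sq_int_integrable_mult:
  assumes "sq_int f" "sq_int g"
  shows "integrable lborel (\<lambda>t. cnj (f t) * g t)"
proof -
  have m [measurable]: "f \<in> borel_measurable lborel" "g \<in> borel_measurable lborel"
    using assms by (auto simp: sq_int_def)
  have "integrable lborel (\<lambda>t. (cmod (f t))\<^sup>2 + (cmod (g t))\<^sup>2)"
    using assms by (auto simp: sq_int_def)
  moreover have "cmod (cnj (f t) * g t) \<le> (cmod (f t))\<^sup>2 + (cmod (g t))\<^sup>2" for t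
  proof -
    have "2 * cmod (f t) * cmod (g t) \<le> (cmod (f t))\<^sup>2 + (cmod (g t))\<^sup>2"
      by (rule sum_squares_bound)
    moreover have "0 \<le> cmod (f t) * cmod (g t)"
      by simp
    ultimately show ?thesis
      by (simp only: norm_mult complex_mod_cnj)
  qed
  moreover have "(\<lambda>t. cnj (f t) * g t) \<in> borel_measurable lborel"
    using m by (intro borel_measurable_times borel_measurable_continuous_on [where f = cnj])
      (auto intro!: continuous_intros)
  ultimately show ?thesis
    by (rule_tac Bochner_Integration.integrable_bound) auto
qed

quotient_type L2 = "real \<Rightarrow> complex" / partial:
  "\<lambda>f g. sq_int f \<and> sq_int g \<and> (AE t in lborel. f t = g t)"
proof (rule part_equivpI)
  show "\<exists>f. sq_int f \<and> sq_int f \<and> (AE t in lborel. f t = f t)"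
    using sq_int_zero by auto
  show "symp (\<lambda>f g. sq_int f \<and> sq_int g \<and> (AE t in lborel. f t = g t))"
    by (auto simp: symp_def elim: AE_mp)
  show "transp (\<lambda>f g. sq_int f \<and> sq_int g \<and> (AE t in lborel. f t = g t))"
  proof (rule transpI)
    fix f g h :: "real \<Rightarrow> complex"
    assume "sq_int f \<and> sq_int g \<and> (AE t in lborel. f t = g t)"
      and "sq_int g \<and> sq_int h \<and> (AE t in lborel. g t = h t)"
    then show "sq_int f \<and> sq_int h \<and> (AE t in lborel. f t = h t)"
      by (auto elim: AE_mp)
  qed
qed

lift_definition cinner :: "L2 \<Rightarrow> L2 \<Rightarrow> complex"
  is "\<lambda>f g. LINT t|lborel. cnj (f t) * g t"
proof -
  fix f f' g g' :: "real \<Rightarrow> complex"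
  assume f: "sq_int f \<and> sq_int f' \<and> (AE t in lborel. f t = f' t)"
    and g: "sq_int g \<and> sq_int g' \<and> (AE t in lborel. g t = g' t)"
  have "AE t in lborel. cnj (f t) * g t = cnj (f' t) * g' t"
    using f g by auto
  moreover have "integrable lborel (\<lambda>t. cnj (f t) * g t)"
    "integrable lborel (\<lambda>t. cnj (f' t) * g' t)"
    using f g sq_int_integrable_mult by blast+
  ultimately show "(LINT t|lborel. cnj (f t) * g t) = (LINT t|lborel. cnj (f' t) * g' t)"
    by (intro integral_cong_AE) auto
qed

lift_definition scaleC :: "complex \<Rightarrow> L2 \<Rightarrow> L2" (infixr "*\<^sub>C" 75)
  is "\<lambda>c f t. c * f t"
  using sq_int_cmult by (auto elim: AE_mp)

instantiation L2 :: real_inner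
begin

lift_definition zero_L2 :: L2 is "\<lambda>t. 0"
  using sq_int_zero by simp

lift_definition plus_L2 :: "L2 \<Rightarrow> L2 \<Rightarrow> L2" is "\<lambda>f g t. f t + g t"
  using sq_int_add by (auto elim: AE_mp)

lift_definition minus_L2 :: "L2 \<Rightarrow> L2 \<Rightarrow> L2" is "\<lambda>f g t. f t - g t"
  using sq_int_diff by (auto elim: AE_mp)

definition uminus_L2 :: "L2 \<Rightarrow> L2" where
  "- \<psi> = (-1) *\<^sub>C \<psi>"

definition scaleR_L2 :: "real \<Rightarrow> L2 \<Rightarrow> L2" where
  "r *\<^sub>R \<psi> = of_real r *\<^sub>C \<psi>"

definition inner_L2 :: "L2 \<Rightarrow> L2 \<Rightarrow> real" where
  "inner \<phi> \<psi> = Re (cinner \<phi> \<psi>)"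

definition norm_L2 :: "L2 \<Rightarrow> real" where
  "norm (\<psi> :: L2) = sqrt (inner \<psi> \<psi>)"

definition sgn_L2 :: "L2 \<Rightarrow> L2" where
  "sgn (\<psi> :: L2) = inverse (norm \<psi>) *\<^sub>R \<psi>"

definition dist_L2 :: "L2 \<Rightarrow> L2 \<Rightarrow> real" where
  "dist (\<phi> :: L2) \<psi> = norm (\<phi> - \<psi>)"

definition uniformity_L2 :: "(L2 \<times> L2) filter" where
  "uniformity_L2 = (INF e\<in>{0<..}. principal {(\<phi>, \<psi>). dist (\<phi> :: L2) \<psi> < e})"

definition open_L2 :: "L2 set \<Rightarrow> bool" where
  "open_L2 U \<longleftrightarrow> (\<forall>\<phi>\<in>U. eventually (\<lambda>(\<phi>', \<psi>). \<phi>' = \<phi> \<longrightarrow> \<psi> \<in> U) uniformity)"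

instance
proof
  fix a b c :: L2 and r s :: real and U :: "L2 set"
  show "a + b + c = a + (b + c)"
    by transfer (auto simp: add.assoc intro!: sq_int_add)
  show "a + b = b + a"
    by transfer (auto simp: add.commute intro!: sq_int_add)
  show "0 + a = a"
    by transfer simp
  show "- a + a = 0"
    unfolding uminus_L2_def by transfer (auto simp: sq_int_zero)
  show "a - b = a + - b"
    unfolding uminus_L2_def
    by transfer (use sq_int_diff in auto)
  show "r *\<^sub>R (a + b) = r *\<^sub>R a + r *\<^sub>R b"
    unfolding scaleR_L2_def
    by transfer (auto simp: distrib_left distrib_right sq_int_add sq_int_cmult)
  show "(r + s) *\<^sub>R a = r *\<^sub>R a + s *\<^sub>R a"
    unfolding scaleR_L2_def
    by transfer (auto simp: distrib_left distrib_right sq_int_add sq_int_cmult)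
  show "r *\<^sub>R s *\<^sub>R a = (r * s) *\<^sub>R a"
    unfolding scaleR_L2_def
    by transfer (auto simp: mult.assoc sq_int_cmult)
  show "1 *\<^sub>R a = a"
    unfolding scaleR_L2_def by transfer simp
  show "sgn a = inverse (norm a) *\<^sub>R a"
    by (simp add: sgn_L2_def)
  show "dist a b = norm (a - b)"
    by (rule dist_L2_def)
  show "(uniformity :: (L2 \<times> L2) filter) = (INF e\<in>{0<..}. principal {(x, y). dist x y < e})"
    by (rule uniformity_L2_def)
  show "open U \<longleftrightarrow> (\<forall>x\<in>U. \<forall>\<^sub>F (x', y) in uniformity. x' = x \<longrightarrow> y \<in> U)"
    by (rule open_L2_def)
  show "inner a b = inner b a"
    unfolding inner_L2_def
  proof transfer
    fix f g :: "real \<Rightarrow> complex"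
    have "(LINT t|lborel. cnj (f t) * g t) = cnj (LINT t|lborel. cnj (g t) * f t)"
      by (subst Bochner_Integration.integral_cnj [symmetric]) (simp add: mult.commute)
    then show "Re (LINT t|lborel. cnj (f t) * g t) = Re (LINT t|lborel. cnj (g t) * f t)"
      by simp
  qed
  show "inner (a + b) c = inner a c + inner b c"
    unfolding inner_L2_def
    by transfer (simp add: distrib_right sq_int_integrable_mult)
  show "inner (r *\<^sub>R a) b = r * inner a b"
    unfolding inner_L2_def scaleR_L2_def
    by transfer (simp add: mult.assoc)
  have sq: "Re (LINT t|lborel. cnj (f t) * f t) = (LINT t|lborel. (cmod (f t))\<^sup>2)" for f :: "real \<Rightarrow> complex"
  proof -
    have "(LINT t|lborel. cnj (f t) * f t) = (LINT t|lborel. complex_of_real ((cmod (f t))\<^sup>2))"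
      by (intro Bochner_Integration.integral_cong) (simp_all add: complex_norm_square mult.commute del: of_real_power)
    then show ?thesis
      by (simp del: of_real_power)
  qed
  show "0 \<le> inner a a"
    unfolding inner_L2_def by transfer (simp add: sq)
  show "inner a a = 0 \<longleftrightarrow> a = 0"
    unfolding inner_L2_def
  proof transfer
    fix f :: "real \<Rightarrow> complex"
    assume "sq_int f \<and> sq_int f \<and> (AE t in lborel. f t = f t)"
    then show "(Re (LINT t|lborel. cnj (f t) * f t) = 0) \<longleftrightarrow>
        (sq_int f \<and> sq_int (\<lambda>t. 0) \<and> (AE t in lborel. f t = 0))"
      by (simp add: sq sq_int_zero integral_nonneg_eq_0_iff_AE sq_int_def)
  qed
  show "norm a = sqrt (inner a a)"
    by (rule norm_L2_def)
qed

end

section \<open>Bounded operators\<close>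

text \<open>Bounded operators are elements of \<^typ>\<open>L2 \<Rightarrow>\<^sub>L L2\<close>, which are only real-linear;
  complex linearity is the predicate \<open>clinear_op\<close>.\<close>

definition clinear_op :: "(L2 \<Rightarrow>\<^sub>L L2) \<Rightarrow> bool" where
  "clinear_op T \<longleftrightarrow> (\<forall>c \<psi>. T (c *\<^sub>C \<psi>) = c *\<^sub>C T \<psi>)"

definition adj_op :: "(L2 \<Rightarrow>\<^sub>L L2) \<Rightarrow> (L2 \<Rightarrow>\<^sub>L L2)" where
  "adj_op T = (THE S :: L2 \<Rightarrow>\<^sub>L L2. \<forall>\<phi> \<psi>. cinner \<phi> (T \<psi>) = cinner (S \<phi>) \<psi>)"

definition positive_op :: "(L2 \<Rightarrow>\<^sub>L L2) \<Rightarrow> bool" where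
  "positive_op T \<longleftrightarrow> clinear_op T \<and> (\<forall>\<psi>. Im (cinner \<psi> (T \<psi>)) = 0 \<and> 0 \<le> Re (cinner \<psi> (T \<psi>)))"

definition abs_op :: "(L2 \<Rightarrow>\<^sub>L L2) \<Rightarrow> (L2 \<Rightarrow>\<^sub>L L2)" where
  "abs_op T = (THE B. positive_op B \<and> B o\<^sub>L B = adj_op T o\<^sub>L T)"

definition projector_op :: "(L2 \<Rightarrow>\<^sub>L L2) \<Rightarrow> bool" where
  "projector_op P \<longleftrightarrow> clinear_op P \<and> P o\<^sub>L P = P \<and>
    (\<forall>\<phi> \<psi>. cinner \<phi> (P \<psi>) = cinner (P \<phi>) \<psi>)"

definition ketbra :: "L2 \<Rightarrow> (L2 \<Rightarrow>\<^sub>L L2)" where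
  "ketbra \<psi> = Blinfun (\<lambda>\<phi>. cinner \<psi> \<phi> *\<^sub>C \<psi>)"

section \<open>Fock basis\<close>

text \<open>Wave functions of the Fock states, with \<open>p = -i d/dt\<close>: the vacuum solves \<open>a h = 0\<close>, and
  \<open>h\<^sub>n\<^sub>+\<^sub>1 = a\<^sup>\<dagger> h\<^sub>n / sqrt (n + 1)\<close> with \<open>a\<^sup>\<dagger> = (t - d/dt) / sqrt 2\<close>.\<close>

primrec fock_fun :: "nat \<Rightarrow> real \<Rightarrow> real" where
  "fock_fun 0 = (\<lambda>t. pi powr (-1/4) * exp (- t\<^sup>2 / 2))"
| "fock_fun (Suc n) =
    (\<lambda>t. (t * fock_fun n t - deriv (fock_fun n) t) / (sqrt 2 * sqrt (real n + 1)))"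

definition fock :: "nat \<Rightarrow> L2" where
  "fock n = abs_L2 (\<lambda>t. complex_of_real (fock_fun n t))"

text \<open>\<open>\<langle>\<psi>|n|\<psi>\<rangle>\<close> as the quadratic form of the number operator, with value \<open>\<infinity>\<close> outside its form domain.\<close>

definition energy :: "L2 \<Rightarrow> ennreal" where
  "energy \<psi> = (\<Sum>n. ennreal (real n * (cmod (cinner (fock n) \<psi>))\<^sup>2))"

text \<open>The unitary \<open>exp (i\<theta>n)\<close>.\<close>

definition exp_number :: "real \<Rightarrow> L2 \<Rightarrow> L2" where
  "exp_number \<theta> \<psi> = (\<Sum>n. (cis (\<theta> * real n) * cinner (fock n) \<psi>) *\<^sub>C fock n)"

section \<open>Trace and trace norm\<close>

definition op_trace :: "(L2 \<Rightarrow>\<^sub>L L2) \<Rightarrow> complex" where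
  "op_trace T = (\<Sum>n. cinner (fock n) (T (fock n)))"

definition trace_norm :: "(L2 \<Rightarrow>\<^sub>L L2) \<Rightarrow> ennreal" where
  "trace_norm T = (\<Sum>n. ennreal (Re (cinner (fock n) (abs_op T (fock n)))))"

definition trace_class :: "(L2 \<Rightarrow>\<^sub>L L2) \<Rightarrow> bool" where
  "trace_class T \<longleftrightarrow> clinear_op T \<and> trace_norm T < \<infinity>"

text \<open>Closed convex hull in trace norm of a set of trace-class operators.\<close>

definition cch :: "(L2 \<Rightarrow>\<^sub>L L2) set \<Rightarrow> (L2 \<Rightarrow>\<^sub>L L2) set" where
  "cch S = {T. trace_class T \<and> (\<forall>\<epsilon>>0. \<exists>C\<in>convex hull S. trace_norm (T - C) < ennreal \<epsilon>)}"

section \<open>Quadrature operators and their spectral projectors\<close>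

text \<open>An unbounded operator \<open>A\<close> is given by its graph: \<open>A \<psi> \<phi>\<close> says that \<open>\<psi>\<close> is in the domain and
  is mapped to \<open>\<phi>\<close>.\<close>

lift_definition position_op :: "L2 \<Rightarrow> L2 \<Rightarrow> bool"
  is "\<lambda>f g. AE t in lborel. g t = complex_of_real t * f t"
  by (intro iffI; elim conjE; erule AE_mp; erule AE_mp; erule AE_mp) (auto)

text \<open>\<open>q\<^sub>\<theta> = exp (-i\<theta>n) x exp (i\<theta>n)\<close>.  With \<open>[x, p] = i\<close> this operator equals
  \<open>x cos \<theta> - p sin \<theta>\<close>; the opposite sign convention amounts to \<open>\<theta> \<mapsto> 2\<pi> - \<theta>\<close>.\<close>

definition quadrature_op :: "real \<Rightarrow> L2 \<Rightarrow> L2 \<Rightarrow> bool" where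
  "quadrature_op \<theta> \<psi> \<phi> \<longleftrightarrow>
    (\<exists>\<xi>. position_op (exp_number \<theta> \<psi>) \<xi> \<and> \<phi> = exp_number (- \<theta>) \<xi>)"

definition projection_valued_measure :: "(real set \<Rightarrow> (L2 \<Rightarrow>\<^sub>L L2)) \<Rightarrow> bool" where
  "projection_valued_measure Q \<longleftrightarrow>
    (\<forall>B\<in>sets borel. projector_op (Q B)) \<and>
    Q UNIV = id_blinfun \<and>
    (\<forall>B\<in>sets borel. \<forall>C\<in>sets borel. Q (B \<inter> C) = Q B o\<^sub>L Q C) \<and>
    (\<forall>B :: nat \<Rightarrow> real set. range B \<subseteq> sets borel \<longrightarrow> disjoint_family B \<longrightarrow>
      (\<forall>\<psi>. (\<lambda>i. Q (B i) \<psi>) sums Q (\<Union>i. B i) \<psi>))"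

definition spectral_dist :: "(real set \<Rightarrow> (L2 \<Rightarrow>\<^sub>L L2)) \<Rightarrow> L2 \<Rightarrow> real measure" where
  "spectral_dist Q \<psi> = measure_of UNIV (sets borel) (\<lambda>B. ennreal (Re (cinner \<psi> (Q B \<psi>))))"

text \<open>\<open>Q\<close> is the spectral measure of \<open>A\<close>, i.e. \<open>A = \<integral> s dQ(s)\<close> including equality of domains.
  Since \<open>A\<close> is linear, its values are determined by the diagonal matrix elements.\<close>

definition spectral_measure_of :: "(L2 \<Rightarrow> L2 \<Rightarrow> bool) \<Rightarrow> (real set \<Rightarrow> (L2 \<Rightarrow>\<^sub>L L2)) \<Rightarrow> bool" where
  "spectral_measure_of A Q \<longleftrightarrow> projection_valued_measure Q \<and>
    (\<forall>\<psi>. (\<exists>\<phi>. A \<psi> \<phi>) \<longleftrightarrow> (\<integral>\<^sup>+s. ennreal (s\<^sup>2) \<partial>spectral_dist Q \<psi>) < \<infinity>) \<and>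
    (\<forall>\<psi> \<phi>. A \<psi> \<phi> \<longrightarrow> cinner \<psi> \<phi> = complex_of_real (LINT s|spectral_dist Q \<psi>. s))"

definition spectral_projector :: "(L2 \<Rightarrow> L2 \<Rightarrow> bool) \<Rightarrow> real set \<Rightarrow> (L2 \<Rightarrow>\<^sub>L L2)" where
  "spectral_projector A B = (THE P. \<exists>Q. spectral_measure_of A Q \<and> P = Q B)"

definition witness :: "real \<Rightarrow> real \<Rightarrow> real \<Rightarrow> (L2 \<Rightarrow>\<^sub>L L2)" where
  "witness \<theta> x \<eta> = spectral_projector (quadrature_op \<theta>) {x - \<eta>/2 .. x + \<eta>/2}"

section \<open>Stellar rank\<close>

definition stellar_fun :: "L2 \<Rightarrow> complex \<Rightarrow> complex" where
  "stellar_fun \<psi> \<alpha> = (\<Sum>n. cinner (fock n) \<psi> * \<alpha> ^ n / complex_of_real (sqrt (fact n)))"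

text \<open>\<^const>\<open>zorder\<close> is the multiplicity of a zero because \<open>stellar_fun \<psi>\<close> is entire and, for
  \<open>\<psi> \<noteq> 0\<close>, not identically zero.\<close>

definition stellar_rank :: "L2 \<Rightarrow> enat" where
  "stellar_rank \<psi> =
    (if finite {z. stellar_fun \<psi> z = 0}
     then enat (\<Sum>z | stellar_fun \<psi> z = 0. nat (zorder (stellar_fun \<psi>) z))
     else \<infinity>)"

definition stellar_set :: "nat \<Rightarrow> real \<Rightarrow> (L2 \<Rightarrow>\<^sub>L L2) set" where
  "stellar_set r E =
    cch {ketbra \<psi> | \<psi>. norm \<psi> = 1 \<and> energy \<psi> \<le> ennreal E \<and> stellar_rank \<psi> \<le> enat r}"

definition threshold :: "real \<Rightarrow> real \<Rightarrow> real \<Rightarrow> real \<Rightarrow> real" where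
  "threshold E \<theta> x \<eta> = (INF \<sigma>\<in>stellar_set 0 E. Re (op_trace (\<sigma> o\<^sub>L witness \<theta> x \<eta>)))"

end

theory Submission
  imports Defs "HOL-Probability.Probability"
begin

text \<open>A pure state of stellar rank \<open>0\<close> has a zero-free entire stellar function of order at most \<open>2\<close>, hence
  the exponential of a quadratic polynomial.  The recurrence that this imposes on the Fock coefficients
  is also satisfied by those of a Gaussian wave function, so by completeness of the Fock basis the state is
  a Gaussian, and it stays one under the phase rotation \<open>exp (i\<theta>n)\<close>.  As a Gaussian has no zeros, the
  witness never annihilates such a state.

  Bounded energy makes the tails of the Fock expansion uniformly small, so a sequence of admissible states
  has a norm-convergent subsequence, and by Hurwitz' theorem the limit is again zero-free.  This turns
  pointwise positivity into a uniform bound \<open>\<Sum>\<^sub>n\<^sub><\<^sub>N |\<langle>e\<^sub>n, W\<psi>\<rangle>|\<^sup>2 \<ge> c > 0\<close>, which is linear and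
  norm-continuous in \<open>|\<psi>\<rangle>\<langle>\<psi>|\<close> and so extends to the closed convex hull, where
  \<open>Tr (\<sigma>W) = \<Sum>\<^sub>n \<langle>W e\<^sub>n, \<sigma> W e\<^sub>n\<rangle>\<close> because \<open>\<sigma>\<close> is positive.

  That the witness is the rotated multiplication by an indicator function requires uniqueness of the spectral
  measure of the position operator \<open>X\<close>; for intervals this follows by comparing the growth of the norms of
  \<open>(X - m)\<^sup>k f\<close>.\<close>

section \<open>The Hilbert space\<close>

text \<open>Without an energy bound the infimum over Gaussians would be 0, since states displaced
  far along the quadrature leave the window; all uniformity has to come from E. Compactness is
  established for vectors, so the uniform estimate is made on pure states in a form that is linear
  in the projector.

  Adjoint, modulus and spectral projector are definite descriptions: nothing can be said about them
  before existence and uniqueness are known. This is why square roots of positive operators are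
  constructed, and why an arbitrary spectral measure of the position operator is analysed. Such a
  measure is tied to the operator only through its domain and its diagonal matrix elements, so
  invariance of the spectral subspaces has to be derived first.

  Trace and trace norm are sums over the Fock basis. The diagonal entries of
  \<open>\<sigma> o\<^sub>L W\<close> need be neither real nor nonnegative, so the trace is first
  rewritten as a series of nonnegative terms; only then do finitely many of them bound it from
  below.\<close>

lemma sq_int_rep: "sq_int (rep_L2 \<psi>)"
  using Quotient_rep_reflp[OF Quotient_L2, of \<psi>] by simp

lemma abs_rep_L2: "abs_L2 (rep_L2 \<psi>) = \<psi>"
  using Quotient_abs_rep[OF Quotient_L2] .

lemma rep_L2_measurable [measurable]: "rep_L2 \<psi> \<in> borel_measurable borel"
  using sq_int_rep[of \<psi>] by (simp add: sq_int_def)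

lemma abs_L2_eqI: "sq_int f \<Longrightarrow> sq_int g \<Longrightarrow> (AE t in lborel. f t = g t) \<Longrightarrow> abs_L2 f = abs_L2 g"
  using Quotient_rel_abs[OF Quotient_L2, of f g] by simp

lemma abs_L2_eq_iff:
  "sq_int f \<Longrightarrow> sq_int g \<Longrightarrow> abs_L2 f = abs_L2 g \<longleftrightarrow> (AE t in lborel. f t = g t)"
  using Quotient_rel[OF Quotient_L2, of f g] by auto

lemma L2_cases [case_names abs]:
  obtains f where "sq_int f" "\<psi> = abs_L2 f"
  using sq_int_rep abs_rep_L2 by metis

lemma cinner_abs: "sq_int f \<Longrightarrow> sq_int g \<Longrightarrow> cinner (abs_L2 f) (abs_L2 g) = (LINT t|lborel. cnj (f t) * g t)"
  by (rule cinner.abs_eq) auto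

lemma scaleC_abs: "sq_int f \<Longrightarrow> c *\<^sub>C abs_L2 f = abs_L2 (\<lambda>t. c * f t)"
  by (rule scaleC.abs_eq) auto

lemma plus_abs: "sq_int f \<Longrightarrow> sq_int g \<Longrightarrow> abs_L2 f + abs_L2 g = abs_L2 (\<lambda>t. f t + g t)"
  by (rule plus_L2.abs_eq) auto

lemma minus_abs: "sq_int f \<Longrightarrow> sq_int g \<Longrightarrow> abs_L2 f - abs_L2 g = abs_L2 (\<lambda>t. f t - g t)"
  by (rule minus_L2.abs_eq) auto

lemma position_op_abs: "sq_int f \<Longrightarrow> sq_int g \<Longrightarrow>
  position_op (abs_L2 f) (abs_L2 g) \<longleftrightarrow> (AE t in lborel. g t = complex_of_real t * f t)"
  by (rule position_op.abs_eq) auto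

section \<open>Complex inner product and complex scalars as bounded bilinear maps\<close>

lemma cinner_commute: "cinner a b = cnj (cinner b a)"
proof transfer
  fix f g :: "real \<Rightarrow> complex"
  show "(LINT t|lborel. cnj (f t) * g t) = cnj (LINT t|lborel. cnj (g t) * f t)"
    by (subst Bochner_Integration.integral_cnj [symmetric]) (simp add: mult.commute)
qed

lemma cinner_add_left: "cinner (a + b) c = cinner a c + cinner b c"
  by transfer (simp add: distrib_right sq_int_integrable_mult)

lemma cinner_scaleC_left: "cinner (r *\<^sub>C a) c = cnj r * cinner a c"
  by transfer (simp add: mult.assoc)

lemma cinner_add_right: "cinner c (a + b) = cinner c a + cinner c b"
  by (metis cinner_add_left cinner_commute complex_cnj_add)

lemma cinner_scaleC_right: "cinner c (r *\<^sub>C a) = r * cinner c a"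
  by (metis cinner_scaleC_left cinner_commute complex_cnj_mult complex_cnj_cnj)

lemma scaleC_scaleC: "a *\<^sub>C b *\<^sub>C \<psi> = (a * b) *\<^sub>C \<psi>"
  by transfer (auto simp: mult.assoc sq_int_cmult)

lemma scaleC_zero_left [simp]: "0 *\<^sub>C \<psi> = 0"
  by transfer (auto simp: sq_int_zero)

lemma scaleC_zero_right [simp]: "c *\<^sub>C 0 = 0"
  by transfer (auto simp: sq_int_zero)

lemma scaleC_add_right: "c *\<^sub>C (a + b) = c *\<^sub>C a + c *\<^sub>C b"
  by transfer (auto simp: distrib_left sq_int_add sq_int_cmult)

lemma scaleC_add_left: "(c + d) *\<^sub>C a = c *\<^sub>C a + d *\<^sub>C a"
  by transfer (auto simp: distrib_right sq_int_add sq_int_cmult)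

lemma cinner_scaleR_left: "cinner (r *\<^sub>R a) c = of_real r * cinner a c"
  by (simp add: scaleR_L2_def cinner_scaleC_left)

lemma cinner_scaleR_right: "cinner c (r *\<^sub>R a) = of_real r * cinner c a"
  by (simp add: scaleR_L2_def cinner_scaleC_right)

lemma minus_scaleC: "- a = (-1) *\<^sub>C a" by (rule uminus_L2_def)

lemma cinner_minus_left: "cinner (- a) b = - cinner a b"
  by (simp add: minus_scaleC cinner_scaleC_left)

lemma cinner_minus_right: "cinner b (- a) = - cinner b a"
  by (simp add: minus_scaleC cinner_scaleC_right)

lemma cinner_diff_left: "cinner (a - b) c = cinner a c - cinner b c"
  using cinner_add_left[of a "-b" c] by (simp add: cinner_minus_left)

lemma cinner_diff_right: "cinner c (a - b) = cinner c a - cinner c b"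
  using cinner_add_right[of c a "-b"] by (simp add: cinner_minus_right)

lemma cinner_zero [simp]: "cinner 0 a = 0" "cinner a 0 = 0"
  by (metis cinner_scaleC_left scaleC_zero_left complex_cnj_zero mult_zero_left)
    (metis cinner_scaleC_right scaleC_zero_left mult_zero_left)

lemma scaleC_diff_right: "c *\<^sub>C (a - b) = c *\<^sub>C a - c *\<^sub>C b"
  by transfer (auto simp: right_diff_distrib sq_int_diff sq_int_cmult)

lemma cinner_self: "cinner \<psi> \<psi> = complex_of_real ((norm \<psi>)\<^sup>2)"
proof -
  have "Im (cinner \<psi> \<psi>) = 0"
    using arg_cong[OF cinner_commute[of \<psi> \<psi>], of Im] by simp
  moreover have "Re (cinner \<psi> \<psi>) = (norm \<psi>)\<^sup>2"
    by (simp add: power2_norm_eq_inner inner_L2_def)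
  ultimately show ?thesis by (simp add: complex_eq_iff)
qed

lemma norm_abs: "sq_int f \<Longrightarrow> (norm (abs_L2 f))\<^sup>2 = (LINT t|lborel. (cmod (f t))\<^sup>2)"
proof -
  assume f: "sq_int f"
  have "(LINT t|lborel. cnj (f t) * f t) = (LINT t|lborel. complex_of_real ((cmod (f t))\<^sup>2))"
    by (intro Bochner_Integration.integral_cong) (simp_all add: complex_norm_square mult.commute del: of_real_power)
  then have "complex_of_real ((norm (abs_L2 f))\<^sup>2) = complex_of_real (LINT t|lborel. (cmod (f t))\<^sup>2)"
    using cinner_self[of "abs_L2 f"] cinner_abs[OF f f] by (simp del: of_real_power)
  then show ?thesis using of_real_eq_iff by blast
qed

lemma norm_scaleC: "norm (c *\<^sub>C \<psi>) = cmod c * norm \<psi>"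
proof -
  have "complex_of_real ((norm (c *\<^sub>C \<psi>))\<^sup>2) = complex_of_real ((cmod c * norm \<psi>)\<^sup>2)"
    by (simp only: cinner_self[symmetric] cinner_scaleC_left cinner_scaleC_right power_mult_distrib of_real_mult
       complex_norm_square) (simp add: cinner_self complex_norm_square mult_ac)
  then have "(norm (c *\<^sub>C \<psi>))\<^sup>2 = (cmod c * norm \<psi>)\<^sup>2" using of_real_eq_iff by blast
  then show ?thesis by simp
qed

lemma cinner_cauchy_schwarz: "cmod (cinner a b) \<le> norm a * norm b"
proof -
  \<comment> \<open>A phase that rotates \<open>cinner a b\<close> to its modulus, so that the
    Cauchy-Schwarz inequality of the real inner product bounds the complex one.\<close>
  define c where "c = (if cinner a b = 0 then 1 else cnj (cinner a b) / cmod (cinner a b))"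
  have c: "cmod c = 1" by (auto simp: c_def norm_divide)
  have "c * cinner a b = cmod (cinner a b)"
    using complex_norm_square[of "cinner a b"]
    by (auto simp: c_def field_simps power2_eq_square)
  then have "cmod (cinner a b) = Re (cinner a (c *\<^sub>C b))" by (simp add: cinner_scaleC_right)
  also have "\<dots> = inner a (c *\<^sub>C b)" by (simp add: inner_L2_def)
  also have "\<dots> \<le> norm a * norm (c *\<^sub>C b)" by (rule norm_cauchy_schwarz)
  finally show ?thesis by (simp add: norm_scaleC c)
qed

lemma bounded_bilinear_cinner: "bounded_bilinear cinner"
proof
  show "\<exists>K. \<forall>a b. cmod (cinner a b) \<le> norm a * norm b * K"
    using cinner_cauchy_schwarz by (metis mult.right_neutral)
qed (auto simp: cinner_add_left cinner_add_right cinner_scaleR_left cinner_scaleR_right scaleR_conv_of_real)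

lemma bounded_bilinear_scaleC: "bounded_bilinear scaleC"
proof
  show "\<exists>K. \<forall>a b. norm (a *\<^sub>C b) \<le> cmod a * norm b * K"
    by (rule exI[of _ 1]) (simp add: norm_scaleC)
qed (auto simp: scaleC_add_left scaleC_add_right scaleR_L2_def scaleC_scaleC scaleR_conv_of_real mult.commute)

lemmas tendsto_cinner [tendsto_intros] = bounded_bilinear.tendsto[OF bounded_bilinear_cinner]
lemmas tendsto_scaleC [tendsto_intros] = bounded_bilinear.tendsto[OF bounded_bilinear_scaleC]
lemmas cinner_sum_right = bounded_linear.linear[OF bounded_bilinear.bounded_linear_right[OF bounded_bilinear_cinner], THEN linear_sum]
lemmas cinner_sum_left = bounded_linear.linear[OF bounded_bilinear.bounded_linear_left[OF bounded_bilinear_cinner], THEN linear_sum]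
lemmas cinner_sums_right = bounded_linear.sums[OF bounded_bilinear.bounded_linear_right[OF bounded_bilinear_cinner]]
lemmas cinner_sums_left = bounded_linear.sums[OF bounded_bilinear.bounded_linear_left[OF bounded_bilinear_cinner]]

lemma cinner_self_zero [simp]: "cinner a a = 0 \<longleftrightarrow> a = 0"
  by (simp add: cinner_self)

lemma cinner_ext: "(\<And>\<phi>. cinner \<phi> a = cinner \<phi> b) \<Longrightarrow> a = b"
  by (metis cinner_diff_right cinner_self_zero eq_iff_diff_eq_0)

lemma cinner_ext_left: "(\<And>\<phi>. cinner a \<phi> = cinner b \<phi>) \<Longrightarrow> a = b"
  by (metis cinner_commute cinner_ext)

section \<open>Completeness of the Hilbert space\<close>

lemma norm_diff_abs_nn:
  assumes "sq_int f" "sq_int g"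
  shows "(\<integral>\<^sup>+t. ennreal ((cmod (f t - g t))\<^sup>2) \<partial>lborel) = ennreal ((norm (abs_L2 f - abs_L2 g))\<^sup>2)"
proof -
  have d: "sq_int (\<lambda>t. f t - g t)" using assms by (rule sq_int_diff)
  then show ?thesis
    unfolding minus_abs[OF assms] norm_abs[OF d]
    by (intro nn_integral_eq_integral) (auto simp: sq_int_def)
qed

text \<open>The terms of a convergent series are bounded, so |d n| is at most sqrt K times the n-th
  power of sqrt (1/2). The weight 2^n is what lets control of squares become absolute
  summability.\<close>

lemma summable_pow2_bound:
  fixes d :: "nat \<Rightarrow> complex"
  assumes "(\<Sum>n. ennreal (2 ^ n * (cmod (d n))\<^sup>2)) \<noteq> \<infinity>"
  shows "summable d"
proof -
  have "summable (\<lambda>n. 2 ^ n * (cmod (d n))\<^sup>2)"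
    using assms by (intro summable_suminf_not_top) auto
  then have "Bseq (\<lambda>n. 2 ^ n * (cmod (d n))\<^sup>2)"
    by (intro convergent_imp_Bseq) (auto intro: summable_LIMSEQ_zero simp: convergent_def)
  then obtain K where K: "K > 0" "\<And>n. norm (2 ^ n * (cmod (d n))\<^sup>2) \<le> K" by (auto elim: BseqE)
  have b: "cmod (d n) \<le> sqrt K * (sqrt (1/2)) ^ n" for n
  proof -
    have "(cmod (d n))\<^sup>2 \<le> K * (1/2) ^ n"
      using K(2)[of n] by (simp add: field_simps power_divide)
    then have "sqrt ((cmod (d n))\<^sup>2) \<le> sqrt (K * (1/2) ^ n)" by (rule real_sqrt_le_mono)
    then show ?thesis by (simp add: real_sqrt_mult real_sqrt_power)
  qed
  have "summable (\<lambda>n. sqrt K * (sqrt (1/2)) ^ n)"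
    by (intro summable_mult summable_geometric) auto
  then show ?thesis by (rule summable_comparison_test'[where N = 0]) (rule b)
qed

lemma Cauchy_fast_subseq:
  fixes X :: "nat \<Rightarrow> 'a::metric_space" and e :: "nat \<Rightarrow> real"
  assumes "Cauchy X" and "\<And>n. 0 < e n"
  obtains r where "strict_mono r" "\<And>n m. n \<le> m \<Longrightarrow> dist (X (r m)) (X (r n)) < e n"
proof -
  have "\<forall>n. \<exists>N. \<forall>k\<ge>N. \<forall>l\<ge>N. dist (X k) (X l) < e n"
    using assms by (auto simp: Cauchy_def)
  then obtain N where N: "\<And>n k l. k \<ge> N n \<Longrightarrow> l \<ge> N n \<Longrightarrow> dist (X k) (X l) < e n" by metis
  \<comment> \<open>The sum of all earlier thresholds makes \<open>r n\<close> at least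
    \<open>N n\<close>, and the summand n makes r strictly increasing.\<close>
  define r where "r n = n + (\<Sum>i\<le>n. N i)" for n
  have r: "strict_mono r" by (auto simp: strict_mono_Suc_iff r_def)
  have "N n \<le> r n" for n
    unfolding r_def by (rule trans_le_add2, rule member_le_sum) auto
  then show ?thesis
    using that[OF r] N r by (meson le_trans strict_mono_less_eq)
qed

lemma half_power_square: "((1/2) ^ n)\<^sup>2 = (1/4 :: real) ^ n"
  by (simp add: power2_eq_square power_mult_distrib [symmetric])

text \<open>Riesz--Fischer.  Along a subsequence the increments \<open>d\<^sub>n\<close> satisfy \<open>\<integral> \<Sum>\<^sub>n 2\<^sup>n |d\<^sub>n|\<^sup>2 < \<infinity>\<close>, which forces
  convergence almost everywhere; Fatou's lemma then gives convergence in norm.\<close>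

instance L2 :: banach
proof
  fix X :: "nat \<Rightarrow> L2"
  assume X: "Cauchy X"
  obtain r where r: "strict_mono r" and d: "\<And>n m. n \<le> m \<Longrightarrow> dist (X (r m)) (X (r n)) < (1/2) ^ n"
    using Cauchy_fast_subseq[OF X, of "\<lambda>n. (1/2) ^ n"] by auto
  define f where "f n = rep_L2 (X (r n))" for n
  have sq: "sq_int (f n)" for n by (simp add: f_def sq_int_rep)
  have ab: "abs_L2 (f n) = X (r n)" for n by (simp add: f_def abs_rep_L2)
  have [measurable]: "f n \<in> borel_measurable borel" for n by (simp add: f_def)
  have nn: "(\<integral>\<^sup>+t. ennreal ((cmod (f m t - f n t))\<^sup>2) \<partial>lborel) \<le> ennreal ((1/4) ^ n)" if "n \<le> m" for n m
  proof -
    have "(norm (X (r m) - X (r n)))\<^sup>2 \<le> ((1/2) ^ n)\<^sup>2"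
      using d[OF that] by (intro power_mono) (auto simp: dist_norm)
    also have "\<dots> = (1/4) ^ n" by (simp add: half_power_square)
    finally show ?thesis
      using norm_diff_abs_nn[OF sq sq, of m n] by (simp add: ab ennreal_leI)
  qed
  have "(\<integral>\<^sup>+t. (\<Sum>n. ennreal (2 ^ n * (cmod (f (Suc n) t - f n t))\<^sup>2)) \<partial>lborel)
      = (\<Sum>n. \<integral>\<^sup>+t. ennreal (2 ^ n * (cmod (f (Suc n) t - f n t))\<^sup>2) \<partial>lborel)"
    by (intro nn_integral_suminf) auto
  also have "\<dots> \<le> (\<Sum>n. ennreal ((1/2) ^ n))"
  proof (intro suminf_le)
    fix n
    have "(\<integral>\<^sup>+t. ennreal (2 ^ n * (cmod (f (Suc n) t - f n t))\<^sup>2) \<partial>lborel)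
       = ennreal (2 ^ n) * (\<integral>\<^sup>+t. ennreal ((cmod (f (Suc n) t - f n t))\<^sup>2) \<partial>lborel)"
      by (subst nn_integral_cmult [symmetric]) (auto simp: ennreal_mult)
    also have "\<dots> \<le> ennreal (2 ^ n) * ennreal ((1/4) ^ n)"
      by (intro mult_left_mono nn) auto
    also have "\<dots> = ennreal ((1/2) ^ n)"
      by (subst ennreal_mult [symmetric]) (auto simp: power_mult_distrib [symmetric])
    finally show "(\<integral>\<^sup>+t. ennreal (2 ^ n * (cmod (f (Suc n) t - f n t))\<^sup>2) \<partial>lborel) \<le> ennreal ((1/2) ^ n)" .
  qed auto
  also have "\<dots> < \<infinity>"
    by (subst suminf_ennreal_eq[OF _ geometric_sums]) auto
  finally have "AE t in lborel. (\<Sum>n. ennreal (2 ^ n * (cmod (f (Suc n) t - f n t))\<^sup>2)) \<noteq> \<infinity>"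
    by (intro nn_integral_noteq_infinite) auto
  then have conv: "AE t in lborel. (\<lambda>n. f n t) \<longlonglongrightarrow> lim (\<lambda>n. f n t)"
  proof (rule AE_mp, intro AE_I2 impI)
    fix t assume "(\<Sum>n. ennreal (2 ^ n * (cmod (f (Suc n) t - f n t))\<^sup>2)) \<noteq> \<infinity>"
    then have "summable (\<lambda>n. f (Suc n) t - f n t)" by (rule summable_pow2_bound)
    then have "convergent (\<lambda>n. \<Sum>i<n. f (Suc i) t - f i t)" by (simp add: summable_iff_convergent)
    then have "convergent (\<lambda>n. f n t - f 0 t)"
      by (simp only: sum_lessThan_telescope[of "\<lambda>n. f n t"])
    then have "convergent (\<lambda>n. f n t)" by (simp add: convergent_diff_const_right_iff)
    then show "(\<lambda>n. f n t) \<longlonglongrightarrow> lim (\<lambda>n. f n t)" by (simp add: convergent_LIMSEQ_iff)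
  qed
  define g where "g t = lim (\<lambda>n. f n t)" for t
  have [measurable]: "g \<in> borel_measurable borel"
    unfolding g_def by (rule borel_measurable_lim_metric) simp
  have fg: "(\<integral>\<^sup>+t. ennreal ((cmod (g t - f n t))\<^sup>2) \<partial>lborel) \<le> ennreal ((1/4) ^ n)" for n
  proof -
    have "(\<integral>\<^sup>+t. ennreal ((cmod (g t - f n t))\<^sup>2) \<partial>lborel)
        = (\<integral>\<^sup>+t. liminf (\<lambda>m. ennreal ((cmod (f m t - f n t))\<^sup>2)) \<partial>lborel)"
    proof (rule nn_integral_cong_AE, rule AE_mp[OF conv], intro AE_I2 impI)
      fix t assume "(\<lambda>n. f n t) \<longlonglongrightarrow> lim (\<lambda>n. f n t)"
      then have "(\<lambda>m. ennreal ((cmod (f m t - f n t))\<^sup>2)) \<longlonglongrightarrow> ennreal ((cmod (g t - f n t))\<^sup>2)"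
        unfolding g_def by (intro tendsto_intros)
      then show "ennreal ((cmod (g t - f n t))\<^sup>2) = liminf (\<lambda>m. ennreal ((cmod (f m t - f n t))\<^sup>2))"
        by (intro lim_imp_Liminf[OF trivial_limit_sequentially, symmetric])
    qed
    also have "\<dots> \<le> liminf (\<lambda>m. \<integral>\<^sup>+t. ennreal ((cmod (f m t - f n t))\<^sup>2) \<partial>lborel)"
      by (intro nn_integral_liminf) auto
    also have "\<dots> \<le> limsup (\<lambda>m. \<integral>\<^sup>+t. ennreal ((cmod (f m t - f n t))\<^sup>2) \<partial>lborel)"
      by (intro Liminf_le_Limsup) simp
    also have "\<dots> \<le> ennreal ((1/4) ^ n)"
      using nn[of n] by (intro Limsup_bounded eventually_sequentiallyI[of n])
    finally show ?thesis .
  qed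
  have sgf: "sq_int (\<lambda>t. g t - f n t)" for n
    unfolding sq_int_def
    using le_less_trans[OF fg[of n] ennreal_less_top] by (auto intro!: integrableI_bounded)
  \<comment> \<open>Fatou's lemma only controls the differences g - f n, so g is recovered as (g - f
    0) + f 0.\<close>
  have sg: "sq_int g"
    using sq_int_add[OF sgf sq, of 0 0] by simp
  have "norm (abs_L2 g - X (r n)) \<le> (1/2) ^ n" for n
  proof -
    have "ennreal ((norm (abs_L2 g - X (r n)))\<^sup>2) \<le> ennreal ((1/4) ^ n)"
      using fg[of n] norm_diff_abs_nn[OF sg sq, of n] by (simp add: ab)
    then have "(norm (abs_L2 g - X (r n)))\<^sup>2 \<le> (1/4) ^ n" by simp
    also have "\<dots> = ((1/2) ^ n)\<^sup>2" by (simp add: half_power_square)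
    finally show ?thesis by (rule power2_le_imp_le) simp
  qed
  then have le: "norm (X (r n) - abs_L2 g) \<le> (1/2) ^ n" for n
    by (subst norm_minus_commute)
  have "(\<lambda>n. X (r n) - abs_L2 g) \<longlonglongrightarrow> 0"
    by (rule Lim_null_comparison[OF always_eventually LIMSEQ_power_zero[of "1/2::real"]]) (auto simp: le)
  then have "(X \<circ> r) \<longlonglongrightarrow> abs_L2 g"
    unfolding comp_def by (rule LIM_zero_cancel)
  then show "convergent X"
    using Cauchy_converges_subseq[OF X r] by (auto simp: convergent_def)
qed

section \<open>Functions dominated by Gaussians\<close>

text \<open>The linear term in the exponent absorbs polynomials and displacements, so that rates add
  under products without loss; rate 0 covers polynomials and constants.\<close>

definition gauss_dom :: "real \<Rightarrow> (real \<Rightarrow> 'a::real_normed_field) \<Rightarrow> bool" where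
  "gauss_dom c F \<longleftrightarrow> (\<exists>C k. \<forall>t. norm (F t) \<le> C * exp (k * \<bar>t\<bar> - c * t\<^sup>2))"

lemma gauss_domI: "(\<And>t. norm (F t) \<le> C * exp (k * \<bar>t\<bar> - c * t\<^sup>2)) \<Longrightarrow> gauss_dom c F"
  unfolding gauss_dom_def by blast

lemma gauss_dom_mult:
  assumes "gauss_dom c F" "gauss_dom d G"
  shows "gauss_dom (c + d) (\<lambda>t. F t * G t)"
proof -
  obtain C k D l where F: "\<And>t. norm (F t) \<le> C * exp (k * \<bar>t\<bar> - c * t\<^sup>2)"
    and G: "\<And>t. norm (G t) \<le> D * exp (l * \<bar>t\<bar> - d * t\<^sup>2)"
    using assms unfolding gauss_dom_def by blast
  have "norm (F t * G t) \<le> (C * D) * exp ((k + l) * \<bar>t\<bar> - (c + d) * t\<^sup>2)" for t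
  proof -
    have "norm (F t * G t) \<le> (C * exp (k * \<bar>t\<bar> - c * t\<^sup>2)) * (D * exp (l * \<bar>t\<bar> - d * t\<^sup>2))"
      unfolding norm_mult using norm_ge_zero order_trans[OF norm_ge_zero F[of t]]
      by (intro mult_mono F G) auto
    also have "\<dots> = (C * D) * (exp (k * \<bar>t\<bar> - c * t\<^sup>2) * exp (l * \<bar>t\<bar> - d * t\<^sup>2))" by simp
    also have "\<dots> = (C * D) * exp ((k + l) * \<bar>t\<bar> - (c + d) * t\<^sup>2)"
      by (subst exp_add [symmetric]) (simp add: algebra_simps)
    finally show ?thesis .
  qed
  then show ?thesis by (rule gauss_domI)
qed

lemma gauss_dom_add:
  assumes "gauss_dom c F" "gauss_dom c G"
  shows "gauss_dom c (\<lambda>t. F t + G t)"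
proof -
  obtain C k D l where F: "\<And>t. norm (F t) \<le> C * exp (k * \<bar>t\<bar> - c * t\<^sup>2)"
    and G: "\<And>t. norm (G t) \<le> D * exp (l * \<bar>t\<bar> - c * t\<^sup>2)"
    using assms unfolding gauss_dom_def by blast
  have C: "0 \<le> C" "0 \<le> D"
    using order_trans[OF norm_ge_zero F[of 0]] order_trans[OF norm_ge_zero G[of 0]] by auto
  have "norm (F t + G t) \<le> (C + D) * exp (max k l * \<bar>t\<bar> - c * t\<^sup>2)" for t
  proof -
    have "C * exp (k * \<bar>t\<bar> - c * t\<^sup>2) \<le> C * exp (max k l * \<bar>t\<bar> - c * t\<^sup>2)"
      "D * exp (l * \<bar>t\<bar> - c * t\<^sup>2) \<le> D * exp (max k l * \<bar>t\<bar> - c * t\<^sup>2)"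
      using C by (auto intro!: mult_left_mono mult_right_mono)
    then show ?thesis
      using F[of t] G[of t] norm_triangle_ineq[of "F t" "G t"] by (simp add: distrib_right)
  qed
  then show ?thesis by (rule gauss_domI)
qed

lemma gauss_dom_const: "gauss_dom 0 (\<lambda>t. a)"
  by (rule gauss_domI[where C = "norm a" and k = 0]) simp

lemma gauss_dom_cmult: "gauss_dom c F \<Longrightarrow> gauss_dom c (\<lambda>t. a * F t)"
  using gauss_dom_mult[OF gauss_dom_const] by force

lemma gauss_dom_minus: "gauss_dom c F \<Longrightarrow> gauss_dom c (\<lambda>t. - F t)"
  using gauss_dom_cmult[of c F "-1"] by simp

lemma gauss_dom_diff: "gauss_dom c F \<Longrightarrow> gauss_dom c G \<Longrightarrow> gauss_dom c (\<lambda>t. F t - G t)"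
  using gauss_dom_add[OF _ gauss_dom_minus] by force

lemma gauss_dom_of_real:
  "gauss_dom c (\<lambda>t. of_real (f t) :: 'a :: real_normed_field) \<longleftrightarrow> gauss_dom c f"
  by (simp add: gauss_dom_def)

lemma gauss_dom_ident: "gauss_dom 0 (\<lambda>t. t)"
proof (rule gauss_domI[where C = 1 and k = 1])
  show "norm t \<le> 1 * exp (1 * \<bar>t\<bar> - 0 * t\<^sup>2)" for t :: real
    using order_trans[OF less_imp_le[OF less_add_one] exp_ge_add_one_self[of "\<bar>t\<bar>", unfolded add.commute[of 1]]]
    by simp
qed

lemma gauss_dom_poly: "gauss_dom 0 (poly (p :: real poly))"
proof (induction p)
  case 0
  show ?case using gauss_dom_const[of 0] by simp
next
  case (pCons a p)
  have "gauss_dom 0 (\<lambda>t. a + t * poly p t)"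
    using gauss_dom_add[OF gauss_dom_const gauss_dom_mult[OF gauss_dom_ident pCons(2), simplified]] by simp
  then show ?case by (simp add: poly_pCons[abs_def])
qed

lemma gauss_dom_exp: "gauss_dom c (\<lambda>t. exp (- c * t\<^sup>2) :: real)"
  by (rule gauss_domI[where C = 1 and k = 0]) simp

section \<open>Integrability and decay of Gaussian-dominated functions\<close>

lemma integral_exp_square: "c > 0 \<Longrightarrow> (LINT t|lborel. exp (- c * t\<^sup>2)) = sqrt (pi / c)"
  and integrable_exp_square: "c > 0 \<Longrightarrow> integrable lborel (\<lambda>t :: real. exp (- c * t\<^sup>2))"
proof -
  assume c: "c > 0"
  have eq: "exp (- c * t\<^sup>2) = sqrt (pi / c) * normal_density 0 (1 / sqrt (2 * c)) t" for t
    using c by (simp add: normal_density_def power_divide real_sqrt_divide)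
  have i: "integral\<^sup>L lborel (normal_density 0 (1 / sqrt (2 * c))) = 1"
    using c by (intro integral_normal_density) auto
  show "(LINT t|lborel. exp (- c * t\<^sup>2)) = sqrt (pi / c)"
    unfolding eq by (simp add: i)
  show "integrable lborel (\<lambda>t :: real. exp (- c * t\<^sup>2))"
    unfolding eq using c by (intro integrable_mult_right integrable_normal_density) auto
qed

text \<open>Completing the square: half of the quadratic rate pays for the linear term, leaving the
  constant exp (k^2 / (2 c)).\<close>

lemma gauss_dom_bound:
  assumes "gauss_dom c F" "0 < c"
  obtains C where "\<And>t. norm (F t) \<le> C * exp (- (c / 2) * t\<^sup>2)" "0 \<le> C"
proof -
  obtain C k where F: "\<And>t. norm (F t) \<le> C * exp (k * \<bar>t\<bar> - c * t\<^sup>2)"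
    using assms unfolding gauss_dom_def by blast
  have C: "0 \<le> C" using order_trans[OF norm_ge_zero F[of 0]] by auto
  have "norm (F t) \<le> (C * exp (k\<^sup>2 / (2 * c))) * exp (- (c / 2) * t\<^sup>2)" for t
  proof -
    have "0 \<le> (k - c * \<bar>t\<bar>)\<^sup>2 / (2 * c)" using assms by simp
    also have "\<dots> = k\<^sup>2 / (2 * c) - k * \<bar>t\<bar> + (c / 2) * t\<^sup>2"
      using assms by (simp add: power2_diff field_simps power2_eq_square) 
    finally have "k * \<bar>t\<bar> - c * t\<^sup>2 \<le> k\<^sup>2 / (2 * c) - (c / 2) * t\<^sup>2" by simp
    then have "exp (k * \<bar>t\<bar> - c * t\<^sup>2) \<le> exp (k\<^sup>2 / (2 * c)) * exp (- (c / 2) * t\<^sup>2)"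
      by (simp add: exp_add [symmetric])
    then have "C * exp (k * \<bar>t\<bar> - c * t\<^sup>2) \<le> C * (exp (k\<^sup>2 / (2 * c)) * exp (- (c / 2) * t\<^sup>2))"
      using C by (rule mult_left_mono)
    then show ?thesis using F[of t] by simp
  qed
  then show ?thesis using that[of "C * exp (k\<^sup>2 / (2 * c))"] C by auto
qed

lemma gauss_dom_integrable:
  fixes F :: "real \<Rightarrow> 'a::{real_normed_field, second_countable_topology, banach}"
  assumes "gauss_dom c F" "0 < c" "F \<in> borel_measurable borel"
  shows "integrable lborel F"
proof -
  obtain C where C: "\<And>t. norm (F t) \<le> C * exp (- (c / 2) * t\<^sup>2)"
    using gauss_dom_bound[OF assms(1,2)] by metis
  have "integrable lborel (\<lambda>t. C * exp (- (c / 2) * t\<^sup>2))"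
    using assms by (intro integrable_mult_right integrable_exp_square) auto
  then show ?thesis
    by (rule Bochner_Integration.integrable_bound) (use assms C in \<open>auto intro: order_trans[OF _ abs_ge_self]\<close>)
qed

lemma gauss_dom_tendsto_zero:
  assumes "gauss_dom c F" "0 < c"
  shows "(F \<longlongrightarrow> 0) at_top" "(F \<longlongrightarrow> 0) at_bot"
proof -
  obtain C where C: "\<And>t. norm (F t) \<le> C * exp (- (c / 2) * t\<^sup>2)"
    using gauss_dom_bound[OF assms(1,2)] by metis
  have lim: "(F \<longlongrightarrow> 0) G" if "((\<lambda>t. C * exp (- (c / 2) * t\<^sup>2)) \<longlongrightarrow> 0) G" for G
    using that by (rule Lim_null_comparison[OF always_eventually, rotated]) (use C in blast)
  show "(F \<longlongrightarrow> 0) at_top" by (rule lim) (use assms(2) in real_asymp)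
  show "(F \<longlongrightarrow> 0) at_bot" by (rule lim) (use assms(2) in real_asymp)
qed

lemma gauss_dom_sq_int:
  assumes "gauss_dom c F" "0 < c" "F \<in> borel_measurable borel"
  shows "sq_int F"
proof -
  have "gauss_dom c (\<lambda>t. cmod (F t))" using assms(1) by (simp add: gauss_dom_def)
  from gauss_dom_mult[OF this this] show ?thesis
    unfolding sq_int_def power2_eq_square using assms
    by (auto intro!: gauss_dom_integrable[of "c + c"])
qed

text \<open>The form of integration by parts behind both the Hermite orthogonality and the Gaussian
  moments: the primitive vanishes at both infinities.\<close>

lemma integral_derivative_zero:
  fixes F f :: "real \<Rightarrow> 'a::{real_normed_field, euclidean_space}"
  assumes "\<And>t. (F has_vector_derivative f t) (at t)" "continuous_on UNIV f"
    and "gauss_dom c F" "gauss_dom c f" "0 < c"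
  shows "(LINT t|lborel. f t) = 0"
proof -
  have i: "integrable lborel f"
    using assms by (intro gauss_dom_integrable borel_measurable_continuous_onI) auto
  have "(LBINT t=-\<infinity>..\<infinity>. f t) = 0 - 0"
  proof (rule interval_integral_FTC_integrable)
    show "set_integrable lborel (einterval (- \<infinity>) \<infinity>) f"
      using i by (simp add: set_integrable_def einterval_def)
    show "((F \<circ> real_of_ereal) \<longlongrightarrow> 0) (at_right (- \<infinity>))" "((F \<circ> real_of_ereal) \<longlongrightarrow> 0) (at_left \<infinity>)"
      using gauss_dom_tendsto_zero[OF assms(3,5)]
      by (simp_all add: ereal_tendsto_simps1)
  qed (use assms in \<open>auto simp: continuous_on_eq_continuous_at\<close>)
  then show ?thesis
    by (simp add: interval_lebesgue_integral_def einterval_def set_lebesgue_integral_def)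
qed

section \<open>Uniqueness of the Fourier transform\<close>

text \<open>Levy's uniqueness theorem speaks of probability distributions, so h is split into its
  positive and negative parts. Frequency 0 shows that they have the same mass m; if m > 0, division
  by m gives two densities with equal characteristic functions, and if m = 0 both parts
  vanish.\<close>

lemma fourier_unique_real:
  fixes h :: "real \<Rightarrow> real"
  assumes h: "integrable lborel h" and F: "\<And>k. (CLINT t|lborel. of_real (h t) * iexp (k * t)) = 0"
  shows "AE t in lborel. h t = 0"
proof -
  have [measurable]: "h \<in> borel_measurable borel" using h by auto
  define P where "P t = max (h t) 0" for t
  define N where "N t = max (- h t) 0" for t
  have [measurable]: "P \<in> borel_measurable borel" "N \<in> borel_measurable borel"
    by (auto simp: P_def[abs_def] N_def[abs_def])
  have iP: "integrable lborel P" and iN: "integrable lborel N"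
    using h by (auto simp: P_def[abs_def] N_def[abs_def])
  have hPN: "h t = P t - N t" for t by (auto simp: P_def N_def)
  have pos: "0 \<le> P t" "0 \<le> N t" for t by (auto simp: P_def N_def)
  have ic: "integrable lborel (\<lambda>t. complex_of_real (Q t) * iexp (k * t))" if "integrable lborel Q" for Q k
  proof (rule Bochner_Integration.integrable_bound[OF that])
    have [measurable]: "Q \<in> borel_measurable borel" using that by auto
    show "(\<lambda>t. complex_of_real (Q t) * iexp (k * t)) \<in> borel_measurable lborel" by measurable
  qed (simp add: norm_mult)
  have PN: "(CLINT t|lborel. of_real (P t) * iexp (k * t)) = (CLINT t|lborel. of_real (N t) * iexp (k * t))" for k
  proof -
    have "(CLINT t|lborel. of_real (P t) * iexp (k * t) - of_real (N t) * iexp (k * t)) = 0"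
      using F[of k] by (simp add: hPN left_diff_distrib)
    then show ?thesis
      using ic[OF iP] ic[OF iN] by (simp add: Bochner_Integration.integral_diff)
  qed
  define m where "m = (LINT t|lborel. P t)"
  have mN: "m = (LINT t|lborel. N t)"
    using PN[of 0] by (simp add: m_def)
  have AEPN: "AE t in lborel. P t = N t"
  proof (cases "m = 0")
    case True
    then have "AE t in lborel. P t = 0" "AE t in lborel. N t = 0"
      using integral_nonneg_eq_0_iff_AE[OF iP] integral_nonneg_eq_0_iff_AE[OF iN] pos mN
      by (auto simp: m_def)
    then show ?thesis by eventually_elim simp
  next
    case False
    then have m: "m > 0"
      using Bochner_Integration.integral_nonneg[of lborel P] pos by (simp add: m_def less_le)
    define D where "D Q = density lborel (\<lambda>t. ennreal (Q t / m))" for Q :: "real \<Rightarrow> real"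
    have rd: "real_distribution (D Q)" if "integrable lborel Q" "\<And>t. 0 \<le> Q t" "m = (LINT t|lborel. Q t)"
      for Q
    proof -
      have [measurable]: "Q \<in> borel_measurable borel" using that by auto
      have "(\<integral>\<^sup>+t. ennreal (Q t / m) \<partial>lborel) = ennreal (LINT t|lborel. Q t / m)"
        using that m by (intro nn_integral_eq_integral) auto
      also have "\<dots> = 1" using that(3)[symmetric] m by simp
      finally have "prob_space (D Q)"
        by (intro prob_spaceI) (simp add: D_def emeasure_density)
      then show ?thesis
        by (simp add: real_distribution_def real_distribution_axioms_def D_def)
    qed
    have ch: "char (D Q) k = (CLINT t|lborel. of_real (Q t) * iexp (k * t)) / m"
      if "integrable lborel Q" "\<And>t. 0 \<le> Q t" for Q k
    proof -
      have [measurable]: "Q \<in> borel_measurable borel" using that by auto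
      have "char (D Q) k = (CLINT t|lborel. (Q t / m) *\<^sub>R iexp (k * t))"
        unfolding char_def D_def using that m by (subst integral_density) auto
      also have "\<dots> = (CLINT t|lborel. (of_real (Q t) * iexp (k * t)) / m)"
        by (simp add: scaleR_conv_of_real)
      finally show ?thesis by simp
    qed
    have "D P = D N"
      using iP iN pos mN PN by (intro Levy_uniqueness rd ext) (auto simp: ch m_def)
    then have "AE t in lborel. ennreal (P t / m) = ennreal (N t / m)"
      unfolding D_def by (subst (asm) sigma_finite_measure.density_unique_iff[OF sigma_finite_lborel]) auto
    then show ?thesis
      by eventually_elim (use pos m in auto)
  qed
  then show ?thesis by eventually_elim (simp add: hPN)
qed

text \<open>Conjugation turns frequency k into -k, so the conjugate of h has vanishing transform
  too, and with it the real and imaginary parts.\<close>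

lemma fourier_unique:
  fixes h :: "real \<Rightarrow> complex"
  assumes h: "integrable lborel h" and F: "\<And>k. (CLINT t|lborel. h t * iexp (k * t)) = 0"
  shows "AE t in lborel. h t = 0"
proof -
  have [measurable]: "h \<in> borel_measurable borel" using h by auto
  have ic: "integrable lborel (\<lambda>t. g t * iexp (k * t))" if "integrable lborel g" for g :: "real \<Rightarrow> complex" and k
  proof (rule Bochner_Integration.integrable_bound[OF that])
    have [measurable]: "g \<in> borel_measurable borel" using that by auto
    show "(\<lambda>t. g t * iexp (k * t)) \<in> borel_measurable lborel" by measurable
  qed (simp add: norm_mult)
  have F': "(CLINT t|lborel. cnj (h t) * iexp (k * t)) = 0" for k
  proof -
    have "(CLINT t|lborel. cnj (h t) * iexp (k * t)) = (CLINT t|lborel. cnj (h t * iexp (- k * t)))"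
      by (intro Bochner_Integration.integral_cong) (simp_all add: exp_cnj)
    also have "\<dots> = cnj (CLINT t|lborel. h t * iexp (- k * t))" by (rule Bochner_Integration.integral_cnj)
    also have "\<dots> = 0" by (subst F) simp
    finally show ?thesis .
  qed
  have hc: "integrable lborel (\<lambda>t. cnj (h t))" using h by (simp add: integrable_cnj)
  have "AE t in lborel. Re (h t) = 0"
  proof (rule fourier_unique_real)
    fix k
    have "(CLINT t|lborel. of_real (Re (h t)) * iexp (k * t))
      = (CLINT t|lborel. (h t * iexp (k * t) + cnj (h t) * iexp (k * t)) / 2)"
      by (intro Bochner_Integration.integral_cong)
        (simp_all add: complex_add_cnj distrib_right[symmetric] del: distrib_right)
    also have "\<dots> = 0"
      using ic[OF h, of k] ic[OF hc, of k] F[of k] F'[of k] by simp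
    finally show "(CLINT t|lborel. of_real (Re (h t)) * iexp (k * t)) = 0" .
  qed (use h in auto)
  moreover have "AE t in lborel. Im (h t) = 0"
  proof (rule fourier_unique_real)
    fix k
    have "(CLINT t|lborel. of_real (Im (h t)) * iexp (k * t))
      = (CLINT t|lborel. (h t * iexp (k * t) - cnj (h t) * iexp (k * t)) / (2 * \<i>))"
    proof (intro Bochner_Integration.integral_cong refl)
      fix t
      have "complex_of_real (Im (h t)) = (h t - cnj (h t)) / (2 * \<i>)" by (simp add: complex_eq_iff)
      then show "of_real (Im (h t)) * iexp (k * t) = (h t * iexp (k * t) - cnj (h t) * iexp (k * t)) / (2 * \<i>)"
        by (simp only: left_diff_distrib times_divide_eq_left)
    qed
    also have "\<dots> = 0"
      using ic[OF h, of k] ic[OF hc, of k] F[of k] F'[of k] by simp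
    finally show "(CLINT t|lborel. of_real (Im (h t)) * iexp (k * t)) = 0" .
  qed (use h in auto)
  ultimately show ?thesis by eventually_elim (simp add: complex_eq_iff)
qed

section \<open>The Fock basis\<close>

text \<open>The normalised Hermite polynomials. The factor 2 t arises because differentiating the
  Gaussian factor contributes a second copy of t.\<close>

primrec fock_poly :: "nat \<Rightarrow> real poly" where
  "fock_poly 0 = [:pi powr (-1/4):]"
| "fock_poly (Suc n) =
    smult (1 / (sqrt 2 * sqrt (real n + 1))) ([:0, 2:] * fock_poly n - pderiv (fock_poly n))"

lemma DERIV_poly_exp_square:
  "((\<lambda>t. poly p t * exp (- t\<^sup>2 / 2)) has_real_derivative (poly (pderiv p) t - t * poly p t) * exp (- t\<^sup>2 / 2)) (at t)"
  by (auto intro!: derivative_eq_intros poly_DERIV[THEN DERIV_cong] simp: algebra_simps)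

lemma fock_fun_eq: "fock_fun n = (\<lambda>t. poly (fock_poly n) t * exp (- t\<^sup>2 / 2))"
proof (induction n)
  case (Suc n)
  have "deriv (fock_fun n) t = (poly (pderiv (fock_poly n)) t - t * poly (fock_poly n) t) * exp (- t\<^sup>2 / 2)" for t
    unfolding Suc by (rule DERIV_imp_deriv[OF DERIV_poly_exp_square])
  then show ?case by (simp add: fun_eq_iff Suc field_simps)
qed simp

declare fock_fun.simps [simp del]

text \<open>The lowering relation of the annihilation operator. Differentiating the recurrence for q
  gives 2 q plus the derivative of q inserted in the recurrence; by the induction hypothesis the
  latter is a multiple of the recurrence one level down, that is 2 (n + 1) q.\<close>

lemma pderiv_fock_poly: "pderiv (fock_poly (Suc n)) = smult (sqrt (2 * (real n + 1))) (fock_poly n)"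
proof (induction n)
  case 0
  have "sqrt 2 * sqrt 2 = (2 :: real)" by simp
  then show ?case
    by (simp add: pderiv_smult pderiv_diff pderiv_mult pderiv_pCons field_simps del: real_sqrt_mult_self)
next
  case (Suc n)
  define q where "q = fock_poly (Suc n)"
  define a where "a = sqrt (2 * (real n + 1))"
  have a: "a * a = 2 * (real n + 1)" "a > 0" by (auto simp: a_def)
  have q': "pderiv q = smult a (fock_poly n)" using Suc by (simp add: q_def a_def)
  have "q = smult (1 / a) ([:0, 2:] * fock_poly n - pderiv (fock_poly n))"
    by (simp only: q_def a_def real_sqrt_mult fock_poly.simps)
  then have aq: "smult a q = [:0, 2:] * fock_poly n - pderiv (fock_poly n)"
    using a by simp
  have "pderiv ([:0, 2:] * q - pderiv q) = smult 2 q + ([:0, 2:] * pderiv q - pderiv (pderiv q))"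
    by (simp add: pderiv_diff pderiv_mult pderiv_pCons pderiv_smult)
  also have "[:0, 2:] * pderiv q - pderiv (pderiv q) = smult a ([:0, 2:] * fock_poly n - pderiv (fock_poly n))"
    by (simp add: q' pderiv_smult smult_diff_right)
  also have "\<dots> = smult (2 * (real n + 1)) q"
    by (simp only: aq[symmetric] smult_smult a)
  finally have "pderiv ([:0, 2:] * q - pderiv q) = smult (2 * (real (Suc n) + 1)) q"
    by (simp only: smult_add_left[symmetric]) (simp add: algebra_simps)
  moreover have "(1 / (sqrt 2 * sqrt (real (Suc n) + 1))) * (2 * (real (Suc n) + 1)) = sqrt (2 * (real (Suc n) + 1))"
    using real_div_sqrt[of "2 * (real (Suc n) + 1)"] by (simp only: real_sqrt_mult) simp
  ultimately show ?case
    unfolding fock_poly.simps(2)[of "Suc n"] q_def[symmetric] pderiv_smult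
    by (simp only: smult_smult)
qed

section \<open>Orthonormality of the Fock states\<close>

definition gauss_int :: "real poly \<Rightarrow> real" where
  "gauss_int p = (LINT t|lborel. poly p t * exp (- t\<^sup>2))"

lemma continuous_poly_exp: "continuous_on A (\<lambda>t. poly p t * exp (- t\<^sup>2) :: real)"
  by (intro continuous_intros)

lemma gauss_dom_poly_exp: "gauss_dom 1 (\<lambda>t. poly p t * exp (- t\<^sup>2) :: real)"
  using gauss_dom_mult[OF gauss_dom_poly[of p] gauss_dom_exp[of 1]] by simp

lemma integrable_poly_exp: "integrable lborel (\<lambda>t. poly p t * exp (- t\<^sup>2) :: real)"
  by (rule gauss_dom_integrable[OF gauss_dom_poly_exp])
    (auto intro!: borel_measurable_continuous_onI continuous_poly_exp)

lemma gauss_int_add: "gauss_int (p + q) = gauss_int p + gauss_int q"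
  using integrable_poly_exp by (simp add: gauss_int_def distrib_right)

lemma gauss_int_diff: "gauss_int (p - q) = gauss_int p - gauss_int q"
  using integrable_poly_exp by (simp add: gauss_int_def left_diff_distrib)

lemma gauss_int_smult: "gauss_int (smult c p) = c * gauss_int p"
  by (simp add: gauss_int_def mult.assoc)

lemma gauss_int_parts: "gauss_int (pderiv p) = gauss_int ([:0, 2:] * p)"
proof -
  have "(LINT t|lborel. poly (pderiv p - [:0, 2:] * p) t * exp (- t\<^sup>2)) = 0"
  proof (rule integral_derivative_zero[OF _ continuous_poly_exp gauss_dom_poly_exp gauss_dom_poly_exp])
    fix t :: real
    show "((\<lambda>t. poly p t * exp (- t\<^sup>2)) has_vector_derivative poly (pderiv p - [:0, 2:] * p) t * exp (- t\<^sup>2)) (at t)"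
      unfolding has_real_derivative_iff_has_vector_derivative [symmetric]
      by (auto intro!: derivative_eq_intros poly_DERIV[THEN DERIV_cong] simp: algebra_simps)
  qed simp
  then have "gauss_int (pderiv p - [:0, 2:] * p) = 0" by (simp add: gauss_int_def)
  then show ?thesis by (simp add: gauss_int_diff)
qed

text \<open>Creation is adjoint to annihilation: integration by parts converts a raising step on one
  factor into a derivative of the other. Together with the lowering relation it reduces both indices
  of an inner product at once.\<close>

lemma gauss_int_fock_poly_Suc:
  "gauss_int (fock_poly (Suc n) * p) = gauss_int (fock_poly n * pderiv p) / sqrt (2 * (real n + 1))"
proof -
  have "gauss_int (fock_poly (Suc n) * p) =
     (gauss_int ([:0, 2:] * (fock_poly n * p)) - gauss_int (pderiv (fock_poly n) * p)) / sqrt (2 * (real n + 1))"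
    by (simp only: fock_poly.simps mult_smult_left gauss_int_smult left_diff_distrib gauss_int_diff
        real_sqrt_mult mult.assoc) simp
  also have "gauss_int ([:0, 2:] * (fock_poly n * p)) - gauss_int (pderiv (fock_poly n) * p)
     = gauss_int (fock_poly n * pderiv p)"
    by (simp only: gauss_int_parts[symmetric] pderiv_mult gauss_int_add) (simp add: mult.commute)
  finally show ?thesis .
qed

lemma gauss_int_fock_poly: "gauss_int (fock_poly n * fock_poly m) = (if n = m then 1 else 0)"
proof (induction n arbitrary: m)
  case 0
  have z: "gauss_int (fock_poly (Suc k) * fock_poly 0) = 0" for k
    unfolding gauss_int_fock_poly_Suc by (simp add: gauss_int_def)
  have "gauss_int (fock_poly 0 * fock_poly 0) = (pi powr (-1/4) * pi powr (-1/4)) * (LINT t|lborel. exp (- (1::real) * t\<^sup>2))"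
    by (simp add: gauss_int_def mult.assoc)
  also have "\<dots> = pi powr (-1/2) * pi powr (1/2)"
    by (subst integral_exp_square) (simp_all add: powr_add[symmetric] powr_half_sqrt)
  also have "\<dots> = 1"
    by (simp add: powr_add[symmetric])
  finally show ?case
    using z by (cases m) (simp_all add: mult.commute del: fock_poly.simps)
next
  case (Suc n)
  show ?case
  proof (cases m)
    case 0
    then show ?thesis unfolding gauss_int_fock_poly_Suc by (simp add: gauss_int_def)
  next
    case (Suc k)
    show ?thesis
      unfolding Suc gauss_int_fock_poly_Suc pderiv_fock_poly mult_smult_right gauss_int_smult Suc.IH
      by auto
  qed
qed

definition fock_fn :: "nat \<Rightarrow> real \<Rightarrow> complex" where
  "fock_fn n t = complex_of_real (poly (fock_poly n) t * exp (- t\<^sup>2 / 2))"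

lemma fock_eq: "fock n = abs_L2 (fock_fn n)"
  by (simp add: fock_def fock_fun_eq fock_fn_def[abs_def])

lemma fock_fn_continuous: "continuous_on A (fock_fn n)"
  unfolding fock_fn_def by (intro continuous_intros) auto

lemma fock_fn_measurable [measurable]: "fock_fn n \<in> borel_measurable borel"
  by (intro borel_measurable_continuous_onI fock_fn_continuous)

lemma gauss_dom_exp_half: "gauss_dom (1/2) (\<lambda>t. exp (- t\<^sup>2 / 2) :: real)"
  using gauss_dom_exp[of "1/2"] by simp

lemma gauss_dom_fock_fn: "gauss_dom (1/2) (fock_fn n)"
  using gauss_dom_mult[OF gauss_dom_poly[of "fock_poly n"] gauss_dom_exp_half]
  unfolding fock_fn_def[abs_def] gauss_dom_of_real by simp

lemma sq_int_fock_fn: "sq_int (fock_fn n)"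
  by (rule gauss_dom_sq_int[OF gauss_dom_fock_fn]) auto

lemma cinner_fock_abs: "sq_int f \<Longrightarrow> cinner (fock n) (abs_L2 f) = (CLINT t|lborel. fock_fn n t * f t)"
  unfolding fock_eq by (subst cinner_abs[OF sq_int_fock_fn]) (simp_all add: fock_fn_def)

lemma cinner_fock_fock [simp]: "cinner (fock n) (fock m) = (if n = m then 1 else 0)"
proof -
  have "cinner (fock n) (fock m) = (CLINT t|lborel. complex_of_real (poly (fock_poly n * fock_poly m) t * exp (- t\<^sup>2)))"
    unfolding fock_eq[of m] cinner_fock_abs[OF sq_int_fock_fn]
    by (intro Bochner_Integration.integral_cong)
      (simp_all add: fock_fn_def mult_exp_exp algebra_simps flip: of_real_mult of_real_exp)
  also have "\<dots> = complex_of_real (gauss_int (fock_poly n * fock_poly m))"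
    unfolding gauss_int_def by (rule integral_complex_of_real)
  finally show ?thesis by (simp add: gauss_int_fock_poly)
qed

lemma norm_fock [simp]: "norm (fock n) = 1"
proof -
  have "complex_of_real ((norm (fock n))\<^sup>2) = complex_of_real 1"
    using cinner_self[of "fock n"] by simp
  then have "(norm (fock n))\<^sup>2 = 1" using of_real_eq_iff by blast
  then show ?thesis using norm_ge_zero[of "fock n"] by (simp add: power2_eq_1_iff)
qed

text \<open>By \<open>2 t q\<^sub>n = sqrt (2 (n + 1)) q\<^sub>n\<^sub>+\<^sub>1 + sqrt (2 n) q\<^sub>n\<^sub>-\<^sub>1\<close>, a function orthogonal to the Fock basis
  is orthogonal to all monomials times the vacuum.\<close>

lemma fock_orthogonal_monomials:
  assumes f: "sq_int f" and orth: "\<And>n. cinner (fock n) (abs_L2 f) = 0"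
  shows "(CLINT t|lborel. complex_of_real (t ^ m * exp (- t\<^sup>2 / 2)) * f t) = 0"
proof -
  define g where "g p t = complex_of_real (poly p t * exp (- t\<^sup>2 / 2))" for p t
  have gf: "integrable lborel (\<lambda>t. g p t * f t)" for p
  proof -
    have "sq_int (g p)"
      using gauss_dom_mult[OF gauss_dom_poly[of p] gauss_dom_exp_half]
      unfolding g_def[abs_def]
      by (intro gauss_dom_sq_int[where c = "1/2"])
        (auto intro!: borel_measurable_continuous_onI continuous_intros
              simp: gauss_dom_of_real simp del: of_real_mult)
    from sq_int_integrable_mult[OF this f] show ?thesis by (simp add: g_def)
  qed
  define L where "L p = (CLINT t|lborel. g p t * f t)" for p
  have L_add: "L (p + q) = L p + L q" for p q
    unfolding L_def using gf[of p] gf[of q]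
    by (subst Bochner_Integration.integral_add [symmetric]) (auto simp: g_def algebra_simps)
  have L_smult: "L (smult c p) = of_real c * L p" for c p
    unfolding L_def by (subst integral_mult_right_zero [symmetric]) (simp add: g_def mult.assoc)
  have L0: "L (fock_poly n) = 0" for n
    using orth[of n] cinner_fock_abs[OF f, of n] by (simp add: L_def g_def fock_fn_def)
  have "L (monom 1 m * fock_poly n) = 0" for m n
  proof (induction m arbitrary: n)
    case 0
    show ?case using L0 by (simp add: monom_0 one_pCons[symmetric])
  next
    case (Suc m)
    define a where "a = sqrt 2 * sqrt (real n + 1)"
    have a: "a > 0" by (simp add: a_def)
    have "smult a (fock_poly (Suc n)) = [:0, 2:] * fock_poly n - pderiv (fock_poly n)"
      using a by (simp add: a_def)
    then have e: "[:0, 2:] * fock_poly n = smult a (fock_poly (Suc n)) + pderiv (fock_poly n)" by simp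
    have "smult 2 (monom 1 (Suc m) * fock_poly n) = monom 1 m * ([:0, 2:] * fock_poly n)"
      by (simp add: monom_Suc algebra_simps)
    also have "\<dots> = smult a (monom 1 m * fock_poly (Suc n)) + monom 1 m * pderiv (fock_poly n)"
      unfolding e by (simp add: distrib_left del: fock_poly.simps)
    finally have "2 * L (monom 1 (Suc m) * fock_poly n) = L (monom 1 m * pderiv (fock_poly n))"
      using L_smult[of 2 "monom 1 (Suc m) * fock_poly n"]
      by (simp add: L_add L_smult Suc del: fock_poly.simps)
    also have "\<dots> = 0"
    proof (cases n)
      case 0
      then show ?thesis using L_smult[of 0 0] by simp
    next
      case (Suc k)
      then show ?thesis using Suc.IH[of k] by (simp add: pderiv_fock_poly L_smult del: fock_poly.simps)
    qed
    finally show ?case by simp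
  qed
  from this[of m 0] have "L (smult (pi powr (-1/4)) (monom 1 m)) = 0"
    by (simp add: mult.commute)
  then have "L (monom 1 m) = 0" by (simp add: L_smult)
  then show ?thesis by (simp add: L_def g_def poly_monom)
qed

lemma norm_exp_partial_sum_le: "norm (\<Sum>m<N. z ^ m /\<^sub>R fact m) \<le> exp (cmod z)"
proof -
  have "norm (\<Sum>m<N. z ^ m /\<^sub>R fact m) \<le> (\<Sum>m<N. cmod z ^ m /\<^sub>R fact m)"
    by (rule sum_norm_le) (simp add: norm_power)
  also have "\<dots> \<le> exp (cmod z)"
    using sum_le_suminf[OF sums_summable[OF exp_converges[of "cmod z"]], of "{..<N}"]
      sums_unique[OF exp_converges[of "cmod z"]] by simp
  finally show ?thesis .
qed

text \<open>Orthogonality to all monomials times the vacuum makes the Fourier transform of the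
  vacuum times f vanish, by integrating the exponential series term by term. The vacuum has no
  zeros, so f vanishes almost everywhere.\<close>

theorem fock_total:
  assumes orth: "\<And>n. cinner (fock n) \<psi> = 0"
  shows "\<psi> = 0"
proof -
  obtain f where f: "sq_int f" "\<psi> = abs_L2 f" by (rule L2_cases)
  have [measurable]: "f \<in> borel_measurable borel" using f by (simp add: sq_int_def)
  define v where "v t = complex_of_real (exp (- t\<^sup>2 / 2))" for t
  have [measurable]: "v \<in> borel_measurable borel" by (simp add: v_def[abs_def])
  \<comment> \<open>The weight exp (k |t|) dominates every partial sum of the exponential series,
    and the Gaussian keeps the product square-integrable; this provides the integrable majorant for
    dominated convergence.\<close>
  have v_dom: "gauss_dom (1/2) (\<lambda>t. v t * complex_of_real (exp (k * \<bar>t\<bar>)))" for k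
    by (rule gauss_domI[where C = 1 and k = k]) (simp add: v_def norm_mult mult_exp_exp)
  have dom: "integrable lborel (\<lambda>t. v t * complex_of_real (exp (k * \<bar>t\<bar>)) * f t)" for k
  proof -
    have "sq_int (\<lambda>t. v t * complex_of_real (exp (k * \<bar>t\<bar>)))"
      by (rule gauss_dom_sq_int[OF v_dom]) auto
    from sq_int_integrable_mult[OF this f(1)] show ?thesis by (simp add: v_def)
  qed
  have vf: "integrable lborel (\<lambda>t. v t * f t)" using dom[of 0] by simp
  have "AE t in lborel. v t * f t = 0"
  proof (rule fourier_unique[OF vf])
    fix k
    define s where "s N t = (\<Sum>m<N. (\<i> * of_real (k * t)) ^ m /\<^sub>R fact m)" for N and t :: real
    have [measurable]: "s N \<in> borel_measurable borel" for N by (simp add: s_def[abs_def])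
    have "(\<lambda>N. CLINT t|lborel. v t * f t * s N t) \<longlonglongrightarrow> (CLINT t|lborel. v t * f t * iexp (k * t))"
    proof (rule integral_dominated_convergence)
      show "integrable lborel (\<lambda>t. norm (v t * complex_of_real (exp (\<bar>k\<bar> * \<bar>t\<bar>)) * f t))"
        using dom by (rule integrable_norm)
      show "AE t in lborel. (\<lambda>N. v t * f t * s N t) \<longlonglongrightarrow> v t * f t * iexp (k * t)"
        using exp_converges[of "\<i> * of_real (k * t)" for t]
        by (intro AE_I2 tendsto_mult tendsto_const) (simp add: s_def sums_def)
      show "AE t in lborel. norm (v t * f t * s N t) \<le> norm (v t * complex_of_real (exp (\<bar>k\<bar> * \<bar>t\<bar>)) * f t)" for N
      proof (rule AE_I2)
        fix t
        have "norm (s N t) \<le> exp (\<bar>k\<bar> * \<bar>t\<bar>)"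
          using norm_exp_partial_sum_le[of "\<i> * of_real (k * t)" N] by (simp add: s_def norm_mult abs_mult)
        then have "norm (v t * f t) * norm (s N t) \<le> norm (v t * f t) * exp (\<bar>k\<bar> * \<bar>t\<bar>)"
          by (intro mult_left_mono) auto
        then show "norm (v t * f t * s N t) \<le> norm (v t * complex_of_real (exp (\<bar>k\<bar> * \<bar>t\<bar>)) * f t)"
          by (simp add: norm_mult mult_ac)
      qed
    qed auto
    moreover have "(CLINT t|lborel. v t * f t * s N t) = 0" for N
    proof -
      have i: "integrable lborel (\<lambda>t. complex_of_real (t ^ m * exp (- t\<^sup>2 / 2)) * f t)" for m
      proof -
        have "gauss_dom (1/2) (\<lambda>t. poly (monom 1 m) t * exp (- t\<^sup>2 / 2))"
          using gauss_dom_mult[OF gauss_dom_poly[of "monom 1 m"] gauss_dom_exp_half] by simp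
        then have "sq_int (\<lambda>t. complex_of_real (t ^ m * exp (- t\<^sup>2 / 2)))"
          by (intro gauss_dom_sq_int[where c = "1/2"]) (auto simp: gauss_dom_of_real poly_monom simp del: of_real_mult)
        from sq_int_integrable_mult[OF this f(1)] show ?thesis by simp
      qed
      have "(CLINT t|lborel. v t * f t * s N t)
         = (CLINT t|lborel. (\<Sum>m<N. ((\<i> * of_real k) ^ m /\<^sub>R fact m) * (complex_of_real (t ^ m * exp (- t\<^sup>2 / 2)) * f t)))"
        by (intro Bochner_Integration.integral_cong refl)
          (simp add: s_def sum_distrib_left v_def power_mult_distrib mult_ac scaleR_conv_of_real)
      also have "\<dots> = 0"
        using i fock_orthogonal_monomials[OF f(1) orth[unfolded f(2)]]
        by (subst Bochner_Integration.integral_sum) (auto simp del: of_real_mult)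
      finally show ?thesis .
    qed
    ultimately show "(CLINT t|lborel. v t * f t * iexp (k * t)) = 0"
      by (simp add: LIMSEQ_const_iff)
  qed
  then have "AE t in lborel. f t = 0" by eventually_elim (simp add: v_def)
  then have "abs_L2 f = abs_L2 (\<lambda>t. 0)" by (intro abs_L2_eqI f sq_int_zero)
  then show ?thesis by (simp add: f zero_L2_def)
qed

lemma fock_ext: "(\<And>n. cinner (fock n) a = cinner (fock n) b) \<Longrightarrow> a = b"
  using fock_total[of "a - b"] by (simp add: cinner_diff_right)

section \<open>Bessel, Parseval and expansion in the Fock basis\<close>

lemma norm_sum_fock: "finite A \<Longrightarrow> (norm (\<Sum>n\<in>A. c n *\<^sub>C fock n))\<^sup>2 = (\<Sum>n\<in>A. (cmod (c n))\<^sup>2)"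
proof -
  assume A: "finite A"
  have "complex_of_real ((norm (\<Sum>n\<in>A. c n *\<^sub>C fock n))\<^sup>2) = (\<Sum>m\<in>A. \<Sum>n\<in>A. cnj (c n) * c m * (if n = m then 1 else 0))"
    unfolding cinner_self[symmetric] cinner_sum_right cinner_sum_left cinner_scaleC_left cinner_scaleC_right
    by (intro sum.cong refl) (simp add: sum_distrib_left mult_ac)
  also have "\<dots> = (\<Sum>m\<in>A. cnj (c m) * c m)"
    using A by (simp add: if_distrib[of "(*) z" for z] cong: if_cong)
  also have "\<dots> = complex_of_real (\<Sum>n\<in>A. (cmod (c n))\<^sup>2)"
    unfolding of_real_sum by (intro sum.cong refl) (metis complex_norm_square mult.commute)
  finally show ?thesis using of_real_eq_iff by blast
qed

lemma fock_bessel: "(\<Sum>n<N. (cmod (cinner (fock n) \<psi>))\<^sup>2) \<le> (norm \<psi>)\<^sup>2"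
proof -
  define s where "s = (\<Sum>n<N. cinner (fock n) \<psi> *\<^sub>C fock n)"
  define S where "S = (\<Sum>n<N. (cmod (cinner (fock n) \<psi>))\<^sup>2)"
  have s: "(norm s)\<^sup>2 = S" unfolding s_def S_def by (rule norm_sum_fock) simp
  have "cinner s \<psi> = (\<Sum>n<N. cnj (cinner (fock n) \<psi>) * cinner (fock n) \<psi>)"
    by (simp add: s_def cinner_sum_left cinner_scaleC_left)
  also have "\<dots> = complex_of_real S"
    unfolding of_real_sum S_def by (intro sum.cong refl) (metis complex_norm_square mult.commute)
  finally have "S \<le> norm s * norm \<psi>"
    using cinner_cauchy_schwarz[of s \<psi>] by simp
  then have "norm s * norm s \<le> norm s * norm \<psi>" using s by (simp add: power2_eq_square)
  then have "norm s \<le> norm \<psi>" by (cases "norm s = 0") (auto simp: mult_le_cancel_left)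
  then have "(norm s)\<^sup>2 \<le> (norm \<psi>)\<^sup>2" by (rule power_mono) simp
  then show ?thesis using s by (simp add: S_def)
qed

lemma summable_fock_coeffs: "summable (\<lambda>n. (cmod (cinner (fock n) \<psi>))\<^sup>2)"
  by (rule bounded_imp_summable[where B = "(norm \<psi>)\<^sup>2"]) (auto simp: fock_bessel lessThan_Suc_atMost[symmetric] simp del: sum.lessThan_Suc)

lemma summable_fock:
  assumes "summable (\<lambda>n. (cmod (c n))\<^sup>2)"
  shows "summable (\<lambda>n. c n *\<^sub>C fock n)"
  unfolding summable_Cauchy
proof (intro allI impI)
  fix e :: real assume e: "0 < e"
  then obtain N where N: "\<And>m n. m \<ge> N \<Longrightarrow> norm (\<Sum>n\<in>{m..<n}. (cmod (c n))\<^sup>2) < e\<^sup>2"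
    using assms unfolding summable_Cauchy by (metis zero_less_power)
  have "norm (\<Sum>n\<in>{m..<n}. c n *\<^sub>C fock n) < e" if "m \<ge> N" for m n
  proof -
    have "(norm (\<Sum>n\<in>{m..<n}. c n *\<^sub>C fock n))\<^sup>2 < e\<^sup>2"
      using N[OF that, of n] by (subst norm_sum_fock) auto
    then show ?thesis using e by (simp add: power_less_imp_less_base less_imp_le)
  qed
  then show "\<exists>N. \<forall>m\<ge>N. \<forall>n. norm (\<Sum>n\<in>{m..<n}. c n *\<^sub>C fock n) < e" by blast
qed

lemma cinner_fock_suminf:
  assumes "summable (\<lambda>n. (cmod (c n))\<^sup>2)"
  shows "cinner (fock m) (\<Sum>n. c n *\<^sub>C fock n) = c m"
proof -
  have "(\<lambda>n. cinner (fock m) (c n *\<^sub>C fock n)) sums cinner (fock m) (\<Sum>n. c n *\<^sub>C fock n)"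
    by (rule cinner_sums_right[OF summable_sums[OF summable_fock[OF assms]]])
  moreover have "(\<lambda>n. cinner (fock m) (c n *\<^sub>C fock n)) = (\<lambda>n. if n = m then c n else 0)"
    by (auto simp: cinner_scaleC_right)
  ultimately show ?thesis
    using sums_unique2[OF _ sums_single[of m c]] by auto
qed

text \<open>Square-summable coefficients define a vector with exactly these coefficients, and
  completeness leaves no other candidate for it than \<open>\<psi>\<close>.\<close>

lemma fock_sums: "(\<lambda>n. cinner (fock n) \<psi> *\<^sub>C fock n) sums \<psi>"
proof -
  have "(\<Sum>n. cinner (fock n) \<psi> *\<^sub>C fock n) = \<psi>"
    by (rule fock_ext) (rule cinner_fock_suminf[OF summable_fock_coeffs])
  then show ?thesis
    using summable_sums[OF summable_fock[OF summable_fock_coeffs[of \<psi>]]] by simp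
qed

lemma cinner_fock_sums: "(\<lambda>n. cnj (cinner (fock n) a) * cinner (fock n) b) sums cinner a b"
  using cinner_sums_left[OF fock_sums[of a], of b] by (simp add: cinner_scaleC_left)

lemma norm_fock_sums: "(\<lambda>n. (cmod (cinner (fock n) \<psi>))\<^sup>2) sums (norm \<psi>)\<^sup>2"
proof -
  have "(\<lambda>n. Re (cnj (cinner (fock n) \<psi>) * cinner (fock n) \<psi>)) sums Re (cinner \<psi> \<psi>)"
    by (rule sums_Re[OF cinner_fock_sums])
  moreover have "Re (cnj z * z) = (cmod z)\<^sup>2" for z by (simp only: cmod_power2) (simp add: power2_eq_square)
  ultimately show ?thesis by (simp add: cinner_self del: of_real_power)
qed

lemma suminf_norm_fock: "(\<Sum>n. ennreal ((cmod (cinner (fock n) \<psi>))\<^sup>2)) = ennreal ((norm \<psi>)\<^sup>2)"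
  by (rule suminf_ennreal_eq[OF _ norm_fock_sums]) simp

section \<open>The phase rotation\<close>

lemma cinner_fock_exp_number: "cinner (fock n) (exp_number \<theta> \<psi>) = cis (\<theta> * real n) * cinner (fock n) \<psi>"
  unfolding exp_number_def
  by (rule cinner_fock_suminf) (simp add: norm_mult summable_fock_coeffs)

lemma exp_number_add: "exp_number \<theta> (a + b) = exp_number \<theta> a + exp_number \<theta> b"
  by (rule fock_ext) (simp add: cinner_fock_exp_number cinner_add_right distrib_left)

lemma exp_number_scaleC: "exp_number \<theta> (c *\<^sub>C a) = c *\<^sub>C exp_number \<theta> a"
  by (rule fock_ext) (simp add: cinner_fock_exp_number cinner_scaleC_right)

lemma exp_number_inverse: "exp_number (- \<theta>) (exp_number \<theta> \<psi>) = \<psi>"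
  by (rule fock_ext) (simp add: cinner_fock_exp_number cis_mult mult.assoc[symmetric])

lemma exp_number_inverse': "exp_number \<theta> (exp_number (- \<theta>) \<psi>) = \<psi>"
  using exp_number_inverse[of "- \<theta>"] by simp

lemma norm_exp_number [simp]: "norm (exp_number \<theta> \<psi>) = norm \<psi>"
proof -
  have "(norm (exp_number \<theta> \<psi>))\<^sup>2 = (norm \<psi>)\<^sup>2"
    using norm_fock_sums[of "exp_number \<theta> \<psi>"] norm_fock_sums[of \<psi>]
    by (simp add: cinner_fock_exp_number norm_mult sums_unique2)
  then show ?thesis by simp
qed

lemma cinner_exp_number: "cinner (exp_number \<theta> a) b = cinner a (exp_number (- \<theta>) b)"
proof -
  have "(\<lambda>n. cnj (cinner (fock n) (exp_number \<theta> a)) * cinner (fock n) b)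
      = (\<lambda>n. cnj (cinner (fock n) a) * cinner (fock n) (exp_number (- \<theta>) b))"
    by (simp add: cinner_fock_exp_number cis_cnj mult_ac)
  then show ?thesis
    using cinner_fock_sums[of "exp_number \<theta> a" b] cinner_fock_sums[of a "exp_number (- \<theta>) b"]
    by (simp add: sums_unique2)
qed

lemma bounded_linear_exp_number: "bounded_linear (exp_number \<theta>)"
  by (rule bounded_linear_intro[where K = 1])
    (auto simp: exp_number_add scaleR_L2_def exp_number_scaleC)

section \<open>Positive operators and their square roots\<close>

text \<open>Formulated with the real inner product, for which symmetry does not follow from
  positivity. Complex linearity is added afterwards, as commutation with multiplication by
  i.\<close>

definition pos_sa :: "('a::real_inner \<Rightarrow>\<^sub>L 'a) \<Rightarrow> bool" where
  "pos_sa S \<longleftrightarrow> (\<forall>\<phi> \<psi>. inner \<phi> (S \<psi>) = inner (S \<phi>) \<psi>) \<and> (\<forall>\<phi>. 0 \<le> inner \<phi> (S \<phi>))"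

lemma pos_sa_sym: "pos_sa S \<Longrightarrow> inner \<phi> (S \<psi>) = inner (S \<phi>) \<psi>"
  by (simp add: pos_sa_def)

lemma pos_sa_nonneg: "pos_sa S \<Longrightarrow> 0 \<le> inner \<phi> (S \<phi>)"
  unfolding pos_sa_def by blast

lemma pos_sa_cauchy_schwarz:
  assumes "pos_sa S"
  shows "(inner \<phi> (S \<psi>))\<^sup>2 \<le> inner \<phi> (S \<phi>) * inner \<psi> (S \<psi>)"
proof -
  define a where "a = inner \<phi> (S \<phi>)"
  define b where "b = inner \<phi> (S \<psi>)"
  define c where "c = inner \<psi> (S \<psi>)"
  have q: "0 \<le> a + 2 * t * b + t\<^sup>2 * c" for t
  proof -
    have "inner \<psi> (S \<phi>) = b" using pos_sa_sym[OF assms, of \<psi> \<phi>] by (simp add: b_def inner_commute)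
    then have "inner (\<phi> + t *\<^sub>R \<psi>) (S (\<phi> + t *\<^sub>R \<psi>)) = a + 2 * t * b + t\<^sup>2 * c"
      by (simp add: blinfun.add_right blinfun.scaleR_right inner_add_left inner_add_right
          a_def b_def c_def power2_eq_square algebra_simps)
    then show ?thesis using pos_sa_nonneg[OF assms] by metis
  qed
  have "c \<ge> 0" using pos_sa_nonneg[OF assms] by (simp add: c_def)
  have "b\<^sup>2 \<le> a * c"
  proof (cases "c = 0")
    case True
    have "b = 0"
    proof (rule ccontr)
      assume "b \<noteq> 0"
      \<comment> \<open>At this t the linear expression a + 2 t b takes the value -1.\<close>
      then show False using q[of "- (a + 1) / (2 * b)"] True by (simp add: field_simps)
    qed
    then show ?thesis using True by simp
  next
    case False
    have "a + 2 * (- b / c) * b + (- b / c)\<^sup>2 * c = a - b\<^sup>2 / c"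
      using False by (simp add: field_simps power2_eq_square)
    then have "0 \<le> a - b\<^sup>2 / c" using q[of "- b / c"] by simp
    then show ?thesis using False \<open>c \<ge> 0\<close> by (simp add: field_simps)
  qed
  then show ?thesis by (simp add: a_def b_def c_def)
qed

lemma pos_sa_kernel:
  assumes "pos_sa S" "inner \<psi> (S \<psi>) = 0"
  shows "S \<psi> = 0"
  using pos_sa_cauchy_schwarz[OF assms(1), of "S \<psi>" \<psi>] assms(2) by simp

text \<open>Cauchy-Schwarz for the form of S at the pair S \<psi>, \<psi>; one factor |S \<psi>|^2
  cancels.\<close>

lemma pos_sa_norm_bound:
  assumes "pos_sa S"
  shows "(norm (S \<psi>))\<^sup>2 \<le> norm S * inner \<psi> (S \<psi>)"
proof (cases "S \<psi> = 0")
  case False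
  have "((norm (S \<psi>))\<^sup>2)\<^sup>2 \<le> inner (S \<psi>) (S (S \<psi>)) * inner \<psi> (S \<psi>)"
    using pos_sa_cauchy_schwarz[OF assms, of "S \<psi>" \<psi>] by (simp add: power2_norm_eq_inner)
  also have "inner (S \<psi>) (S (S \<psi>)) \<le> norm (S \<psi>) * (norm S * norm (S \<psi>))"
    by (rule order_trans[OF norm_cauchy_schwarz]) (intro mult_left_mono norm_blinfun norm_ge_zero)
  finally have "(norm (S \<psi>))\<^sup>2 * (norm (S \<psi>))\<^sup>2 \<le> (norm (S \<psi>))\<^sup>2 * (norm S * inner \<psi> (S \<psi>))"
    using pos_sa_nonneg[OF assms, of \<psi>] by (simp add: power2_eq_square mult_ac mult_right_mono)
  then show ?thesis by (rule mult_left_le_imp_le) (use False in simp)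
qed (simp add: pos_sa_nonneg assms)

text \<open>Makes R = 1 - S admissible for the square root iteration. In the expansion of the square
  the cross term -2 <\<psi>, S \<psi>> outweighs |S \<psi>|^2, by the preceding bound.\<close>

lemma pos_sa_id_diff_norm:
  assumes "pos_sa S" "norm S \<le> 1"
  shows "norm (id_blinfun - S) \<le> 1"
proof (rule norm_blinfun_bound)
  fix \<psi>
  have "(norm ((id_blinfun - S) \<psi>))\<^sup>2 = (norm \<psi>)\<^sup>2 - 2 * inner \<psi> (S \<psi>) + (norm (S \<psi>))\<^sup>2"
    by (simp add: blinfun.diff_left power2_norm_eq_inner inner_diff_left inner_diff_right inner_commute)
  also have "\<dots> \<le> (norm \<psi>)\<^sup>2"
  proof -
    have "norm S * inner \<psi> (S \<psi>) \<le> 1 * inner \<psi> (S \<psi>)"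
      using assms pos_sa_nonneg by (intro mult_right_mono) auto
    then show ?thesis using pos_sa_norm_bound[OF assms(1), of \<psi>] pos_sa_nonneg[OF assms(1), of \<psi>] by linarith
  qed
  finally have "norm ((id_blinfun - S) \<psi>) \<le> norm \<psi>" by (rule power2_le_imp_le) simp
  then show "norm ((id_blinfun - S) \<psi>) \<le> 1 * norm \<psi>" by simp
qed simp

text \<open>With \<open>R = 1 - S\<close>, the iteration \<open>X \<mapsto> (R + X\<^sup>2) / 2\<close> converges to \<open>1 - sqrt S\<close>; for \<open>norm R \<le> 1\<close>
  its increments are dominated by those of the scalar iteration with \<open>R = 1\<close>.\<close>

primrec sqrt_iter :: "('a::real_normed_vector \<Rightarrow>\<^sub>L 'a) \<Rightarrow> nat \<Rightarrow> ('a \<Rightarrow>\<^sub>L 'a)" where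
  "sqrt_iter R 0 = 0"
| "sqrt_iter R (Suc n) = (1/2) *\<^sub>R (R + (sqrt_iter R n o\<^sub>L sqrt_iter R n))"

primrec sqrt_majorant :: "nat \<Rightarrow> real" where
  "sqrt_majorant 0 = 0"
| "sqrt_majorant (Suc n) = (1/2) * (1 + (sqrt_majorant n)\<^sup>2)"

lemma sqrt_majorant_bounds: "0 \<le> sqrt_majorant n" "sqrt_majorant n \<le> 1"
proof -
  have "0 \<le> sqrt_majorant n \<and> sqrt_majorant n \<le> 1"
    by (induction n) (auto simp: power_le_one)
  then show "0 \<le> sqrt_majorant n" "sqrt_majorant n \<le> 1" by auto
qed

lemma sqrt_majorant_mono: "sqrt_majorant n \<le> sqrt_majorant (Suc n)"
proof -
  have "0 \<le> (1 - sqrt_majorant n)\<^sup>2" by simp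
  then show ?thesis by (simp add: power2_diff)
qed

lemma norm_sqrt_iter:
  assumes "norm R \<le> 1"
  shows "norm (sqrt_iter R n) \<le> sqrt_majorant n"
proof (induction n)
  case (Suc n)
  have "norm (sqrt_iter R n o\<^sub>L sqrt_iter R n) \<le> (sqrt_majorant n)\<^sup>2"
    unfolding power2_eq_square using Suc
    by (intro order_trans[OF norm_blinfun_compose] mult_mono) (auto intro: sqrt_majorant_bounds)
  then have "norm (R + (sqrt_iter R n o\<^sub>L sqrt_iter R n)) \<le> 1 + (sqrt_majorant n)\<^sup>2"
    using assms by (intro order_trans[OF norm_triangle_ineq] add_mono)
  then show ?case by simp
qed simp

text \<open>The difference of squares is written as Y (Y - X) + (Y - X) X, which needs no
  commutativity. For the scalar iteration the same identity is exact, so the domination reproduces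
  itself.\<close>

lemma norm_sqrt_iter_step:
  fixes R :: "'a::real_normed_vector \<Rightarrow>\<^sub>L 'a"
  assumes "norm R \<le> 1"
  shows "norm (sqrt_iter R (Suc n) - sqrt_iter R n) \<le> sqrt_majorant (Suc n) - sqrt_majorant n"
proof (induction n)
  case 0
  show ?case using assms by simp
next
  case (Suc n)
  define X where "X = sqrt_iter R n"
  define Y where "Y = sqrt_iter R (Suc n)"
  define x where "x = sqrt_majorant n"
  define y where "y = sqrt_majorant (Suc n)"
  have d: "norm (Y - X) \<le> y - x" using Suc by (simp add: X_def Y_def x_def y_def)
  have n: "norm X \<le> x" "norm Y \<le> y" "0 \<le> x" "0 \<le> y"
    unfolding X_def Y_def x_def y_def by (intro norm_sqrt_iter assms sqrt_majorant_bounds)+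
  have "sqrt_iter R (Suc (Suc n)) - sqrt_iter R (Suc n) = (1/2) *\<^sub>R ((Y o\<^sub>L Y) - (X o\<^sub>L X))"
  proof -
    have Y: "Y = (1/2) *\<^sub>R (R + (X o\<^sub>L X))" by (simp add: X_def Y_def)
    have Z: "sqrt_iter R (Suc (Suc n)) = (1/2) *\<^sub>R (R + (Y o\<^sub>L Y))" by (simp add: Y_def)
    have "(1/2) *\<^sub>R (R + P) - (1/2) *\<^sub>R (R + Q) = (1/2) *\<^sub>R (P - Q)" for P Q :: "'a \<Rightarrow>\<^sub>L 'a"
      by (simp add: scaleR_diff_right[symmetric])
    from this[of "Y o\<^sub>L Y" "X o\<^sub>L X"] show ?thesis
      unfolding Y[symmetric] Z[symmetric] by (simp only: Y_def)
  qed
  also have "(Y o\<^sub>L Y) - (X o\<^sub>L X) = (Y o\<^sub>L (Y - X)) + ((Y - X) o\<^sub>L X)"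
    by (rule blinfun_eqI) (simp add: blinfun.diff_left blinfun.add_left blinfun.diff_right)
  finally have "norm (sqrt_iter R (Suc (Suc n)) - sqrt_iter R (Suc n))
      = (1/2) * norm ((Y o\<^sub>L (Y - X)) + ((Y - X) o\<^sub>L X))" by simp
  also have "\<dots> \<le> (1/2) * (y * (y - x) + (y - x) * x)"
  proof -
    have "norm (Y o\<^sub>L (Y - X)) \<le> y * (y - x)" "norm ((Y - X) o\<^sub>L X) \<le> (y - x) * x"
      using d n order_trans[OF norm_ge_zero d]
      by (auto intro!: order_trans[OF norm_blinfun_compose] mult_mono)
    then show ?thesis using norm_triangle_ineq[of "Y o\<^sub>L (Y - X)" "(Y - X) o\<^sub>L X"] by simp
  qed
  also have "\<dots> = sqrt_majorant (Suc (Suc n)) - sqrt_majorant (Suc n)"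
  proof -
    have y: "y = (1/2) * (1 + x\<^sup>2)" by (simp add: x_def y_def)
    have z: "sqrt_majorant (Suc (Suc n)) = (1/2) * (1 + y\<^sup>2)" by (simp add: y_def)
    have "(1/2) * (y * (y - x) + (y - x) * x) = (1/2) * (1 + y\<^sup>2) - (1/2) * (1 + x\<^sup>2)"
      by (simp add: power2_eq_square algebra_simps)
    then show ?thesis unfolding y[symmetric] z[symmetric] by (simp only: y_def)
  qed
  finally show ?case .
qed

text \<open>The majorant is monotone and bounded, hence its increments are summable and dominate
  those of the operators. The fixed-point equation says that the square of 1 - X is 1 - R.\<close>

lemma sqrt_iter_convergent:
  fixes R :: "'a::banach \<Rightarrow>\<^sub>L 'a"
  assumes "norm R \<le> 1"
  obtains X where "sqrt_iter R \<longlonglongrightarrow> X" "norm X \<le> 1" "2 *\<^sub>R X = R + (X o\<^sub>L X)"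
proof -
  have "convergent sqrt_majorant"
    using sqrt_majorant_bounds sqrt_majorant_mono
    by (intro Bseq_mono_convergent BseqI'[where K = 1]) (auto intro: lift_Suc_mono_le)
  then have "convergent (\<lambda>n. \<Sum>i<n. sqrt_majorant (Suc i) - sqrt_majorant i)"
    by (simp only: sum_lessThan_telescope convergent_diff_const_right_iff)
  then have "summable (\<lambda>n. sqrt_majorant (Suc n) - sqrt_majorant n)"
    by (simp only: summable_iff_convergent)
  then have "summable (\<lambda>n. sqrt_iter R (Suc n) - sqrt_iter R n)"
    by (rule summable_comparison_test'[where N = 0]) (rule norm_sqrt_iter_step[OF assms])
  then have "convergent (\<lambda>n. \<Sum>i<n. sqrt_iter R (Suc i) - sqrt_iter R i)"
    by (simp only: summable_iff_convergent)
  then have "convergent (\<lambda>n. sqrt_iter R n - sqrt_iter R 0)"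
    by (simp only: sum_lessThan_telescope[of "sqrt_iter R"])
  then obtain X where X: "sqrt_iter R \<longlonglongrightarrow> X"
    by (auto simp: convergent_def)
  have "norm X \<le> 1"
    by (rule LIMSEQ_le_const2[OF tendsto_norm[OF X]])
      (use norm_sqrt_iter[OF assms] sqrt_majorant_bounds order_trans in blast)
  moreover have "(\<lambda>n. sqrt_iter R (Suc n)) \<longlonglongrightarrow> (1/2) *\<^sub>R (R + (X o\<^sub>L X))"
    unfolding sqrt_iter.simps
    by (intro tendsto_intros X bounded_bilinear.tendsto[OF bounded_bilinear_blinfun_compose])
  then have "X = (1/2) *\<^sub>R (R + (X o\<^sub>L X))"
    using LIMSEQ_unique LIMSEQ_Suc[OF X] by blast
  then have "2 *\<^sub>R X = 2 *\<^sub>R (1/2) *\<^sub>R (R + (X o\<^sub>L X))" by simp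
  then have "2 *\<^sub>R X = R + (X o\<^sub>L X)" by simp
  ultimately show ?thesis using that X by blast
qed

lemma sqrt_iter_commute:
  assumes "R o\<^sub>L C = C o\<^sub>L R"
  shows "sqrt_iter R n o\<^sub>L C = C o\<^sub>L sqrt_iter R n"
proof (induction n)
  case 0
  show ?case by (rule blinfun_eqI) simp
next
  case (Suc n)
  have a: "R (C \<psi>) = C (R \<psi>)" for \<psi> using assms by (metis blinfun_apply_blinfun_compose)
  have b: "sqrt_iter R n (C \<psi>) = C (sqrt_iter R n \<psi>)" for \<psi>
    using Suc by (metis blinfun_apply_blinfun_compose)
  show ?case
    by (rule blinfun_eqI) (simp add: blinfun.scaleR_left blinfun.add_left blinfun.scaleR_right blinfun.add_right a b)
qed

lemma sqrt_iter_sym: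
  fixes R :: "'a::real_inner \<Rightarrow>\<^sub>L 'a"
  assumes "\<And>\<phi> \<psi>. inner \<phi> (R \<psi>) = inner (R \<phi>) \<psi>"
  shows "inner \<phi> (sqrt_iter R n \<psi>) = inner (sqrt_iter R n \<phi>) \<psi>"
  by (induction n arbitrary: \<phi> \<psi>)
    (simp_all add: blinfun.scaleR_left blinfun.add_left inner_add_left inner_add_right assms)

text \<open>The root is B = 1 - X. Its commutation with everything that commutes with S holds for
  each iterate and survives the limit; it is used twice, for uniqueness of the root and for its
  complex linearity.\<close>

lemma pos_sa_sqrt_contraction:
  fixes S :: "'a::{real_inner, banach} \<Rightarrow>\<^sub>L 'a"
  assumes S: "pos_sa S" and S1: "norm S \<le> 1"
  obtains B where "pos_sa B" "B o\<^sub>L B = S" "\<forall>C. S o\<^sub>L C = C o\<^sub>L S \<longrightarrow> B o\<^sub>L C = C o\<^sub>L B"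
proof -
  define R where "R = id_blinfun - S"
  obtain X where X: "sqrt_iter R \<longlonglongrightarrow> X" and X1: "norm X \<le> 1" and XX: "2 *\<^sub>R X = R + (X o\<^sub>L X)"
    using sqrt_iter_convergent[OF pos_sa_id_diff_norm[OF S S1]] unfolding R_def by metis
  have Rsym: "inner \<phi> (R \<psi>) = inner (R \<phi>) \<psi>" for \<phi> \<psi>
    by (simp add: R_def blinfun.diff_left inner_diff_left inner_diff_right pos_sa_sym[OF S])
  have app: "(\<lambda>n. sqrt_iter R n \<psi>) \<longlonglongrightarrow> X \<psi>" for \<psi>
    by (intro tendsto_intros X)
  have Xsym: "inner \<phi> (X \<psi>) = inner (X \<phi>) \<psi>" for \<phi> \<psi>
  proof (rule LIMSEQ_unique)
    show "(\<lambda>n. inner \<phi> (sqrt_iter R n \<psi>)) \<longlonglongrightarrow> inner \<phi> (X \<psi>)" by (intro tendsto_intros app)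
    show "(\<lambda>n. inner \<phi> (sqrt_iter R n \<psi>)) \<longlonglongrightarrow> inner (X \<phi>) \<psi>"
      unfolding sqrt_iter_sym[OF Rsym] by (intro tendsto_intros app)
  qed
  define B where "B = id_blinfun - X"
  have "pos_sa B"
    unfolding pos_sa_def
  proof (intro conjI allI)
    show "inner \<phi> (B \<psi>) = inner (B \<phi>) \<psi>" for \<phi> \<psi>
      by (simp add: B_def blinfun.diff_left inner_diff_left inner_diff_right Xsym)
    fix \<phi>
    have "inner \<phi> (X \<phi>) \<le> norm \<phi> * (norm X * norm \<phi>)"
      by (rule order_trans[OF norm_cauchy_schwarz]) (intro mult_left_mono norm_blinfun norm_ge_zero)
    also have "\<dots> \<le> norm \<phi> * (1 * norm \<phi>)"
      by (intro mult_left_mono mult_right_mono X1) auto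
    finally show "0 \<le> inner \<phi> (B \<phi>)"
      by (simp add: B_def blinfun.diff_left inner_diff_right power2_norm_eq_inner[symmetric] power2_eq_square)
  qed
  moreover have "B o\<^sub>L B = S"
  proof (rule blinfun_eqI)
    fix \<psi>
    have "2 *\<^sub>R X \<psi> = R \<psi> + X (X \<psi>)"
      using arg_cong[OF XX, of "\<lambda>T. T \<psi>"] by (simp add: blinfun.scaleR_left blinfun.add_left)
    then show "(B o\<^sub>L B) \<psi> = S \<psi>"
      by (simp add: B_def R_def blinfun.diff_left blinfun.diff_right scaleR_2 algebra_simps)
  qed
  moreover have "B o\<^sub>L C = C o\<^sub>L B" if C: "S o\<^sub>L C = C o\<^sub>L S" for C
  proof -
    have c: "S (C \<psi>) = C (S \<psi>)" for \<psi> using C by (metis blinfun_apply_blinfun_compose)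
    have "R o\<^sub>L C = C o\<^sub>L R"
      by (rule blinfun_eqI) (simp add: R_def blinfun.diff_left blinfun.diff_right c)
    then have eq: "sqrt_iter R n o\<^sub>L C = C o\<^sub>L sqrt_iter R n" for n by (rule sqrt_iter_commute)
    have "X o\<^sub>L C = C o\<^sub>L X"
    proof (rule LIMSEQ_unique)
      show "(\<lambda>n. sqrt_iter R n o\<^sub>L C) \<longlonglongrightarrow> (X o\<^sub>L C)"
        by (intro bounded_bilinear.tendsto[OF bounded_bilinear_blinfun_compose] X tendsto_const)
      show "(\<lambda>n. sqrt_iter R n o\<^sub>L C) \<longlonglongrightarrow> (C o\<^sub>L X)"
        unfolding eq by (intro bounded_bilinear.tendsto[OF bounded_bilinear_blinfun_compose] X tendsto_const)
    qed
    then have x: "X (C \<psi>) = C (X \<psi>)" for \<psi> by (metis blinfun_apply_blinfun_compose)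
    show ?thesis by (rule blinfun_eqI) (simp add: B_def blinfun.diff_left blinfun.diff_right x)
  qed
  ultimately show ?thesis using that by blast
qed

lemma pos_sa_scaleR: "pos_sa S \<Longrightarrow> 0 \<le> r \<Longrightarrow> pos_sa (r *\<^sub>R S)"
  using pos_sa_nonneg[of S] pos_sa_sym[of S]
  by (simp add: pos_sa_def[of "r *\<^sub>R S"] blinfun.scaleR_left)

lemma pos_sa_sqrt:
  fixes S :: "'a::{real_inner, banach} \<Rightarrow>\<^sub>L 'a"
  assumes S: "pos_sa S"
  obtains B where "pos_sa B" "B o\<^sub>L B = S" "\<forall>C. S o\<^sub>L C = C o\<^sub>L S \<longrightarrow> B o\<^sub>L C = C o\<^sub>L B"
proof -
  \<comment> \<open>The added 1 keeps the scaling factor positive also for S = 0.\<close>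
  define c where "c = norm S + 1"
  have c: "c > 0" using norm_ge_zero[of S] unfolding c_def by linarith
  have h1: "pos_sa ((1 / c) *\<^sub>R S)" using S c by (intro pos_sa_scaleR) auto
  have h2: "norm ((1 / c) *\<^sub>R S) \<le> 1" using c by (simp add: c_def)
  obtain B where B: "pos_sa B" "B o\<^sub>L B = (1 / c) *\<^sub>R S"
    "\<forall>C. ((1 / c) *\<^sub>R S) o\<^sub>L C = C o\<^sub>L ((1 / c) *\<^sub>R S) \<longrightarrow> B o\<^sub>L C = C o\<^sub>L B"
    by (rule pos_sa_sqrt_contraction[OF h1 h2])
  note comp_scaleR = bounded_bilinear.scaleR_left[OF bounded_bilinear_blinfun_compose]
    bounded_bilinear.scaleR_right[OF bounded_bilinear_blinfun_compose]
  show ?thesis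
  proof (rule that[of "sqrt c *\<^sub>R B"])
    show "pos_sa (sqrt c *\<^sub>R B)" using B(1) c by (intro pos_sa_scaleR) auto
    show "(sqrt c *\<^sub>R B) o\<^sub>L (sqrt c *\<^sub>R B) = S"
      using c by (simp add: comp_scaleR B(2))
    show "\<forall>C. S o\<^sub>L C = C o\<^sub>L S \<longrightarrow> (sqrt c *\<^sub>R B) o\<^sub>L C = C o\<^sub>L (sqrt c *\<^sub>R B)"
      using B(3) by (auto simp: comp_scaleR)
  qed
qed

text \<open>Both roots are compared with the constructed root D, which commutes with any root C
  because C commutes with its own square. For y = C \<psi> - D \<psi> this gives (C + D) y = 0;
  positivity forces C y = D y = 0, and then |y|^2 = <C y, \<psi>> - <D y, \<psi>> = 0.\<close>

lemma pos_sa_sqrt_unique: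
  fixes A B :: "'a::{real_inner, banach} \<Rightarrow>\<^sub>L 'a"
  assumes A: "pos_sa A" and B: "pos_sa B" and eq: "A o\<^sub>L A = B o\<^sub>L B"
  shows "A = B"
proof -
  have SP: "pos_sa (A o\<^sub>L A)"
    unfolding pos_sa_def
  proof (intro conjI allI)
    show "inner \<phi> ((A o\<^sub>L A) \<psi>) = inner ((A o\<^sub>L A) \<phi>) \<psi>" for \<phi> \<psi>
      by (simp add: pos_sa_sym[OF A])
    show "0 \<le> inner \<phi> ((A o\<^sub>L A) \<phi>)" for \<phi>
      by (simp add: pos_sa_sym[OF A, of \<phi> "A \<phi>"])
  qed
  obtain D where D: "pos_sa D" "D o\<^sub>L D = A o\<^sub>L A"
    and com: "\<forall>C. (A o\<^sub>L A) o\<^sub>L C = C o\<^sub>L (A o\<^sub>L A) \<longrightarrow> D o\<^sub>L C = C o\<^sub>L D"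
    by (rule pos_sa_sqrt[OF SP])
  have un: "C = D" if C: "pos_sa C" and CC: "C o\<^sub>L C = A o\<^sub>L A" for C
  proof (rule blinfun_eqI)
    fix \<psi>
    have "D o\<^sub>L C = C o\<^sub>L D"
      by (rule com[rule_format]) (rule blinfun_eqI, simp add: CC[symmetric])
    then have dc: "D (C \<phi>) = C (D \<phi>)" for \<phi> by (metis blinfun_apply_blinfun_compose)
    have sq: "D (D \<phi>) = C (C \<phi>)" for \<phi> using D(2) CC by (metis blinfun_apply_blinfun_compose)
    define y where "y = C \<psi> - D \<psi>"
    have "C y + D y = 0" by (simp add: y_def blinfun.diff_right dc sq)
    then have "inner y (C y) + inner y (D y) = 0" by (metis inner_add_right inner_zero_right)
    then have "inner y (C y) = 0" "inner y (D y) = 0"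
      using pos_sa_nonneg[OF C, of y] pos_sa_nonneg[OF D(1), of y] by linarith+
    then have z: "C y = 0" "D y = 0" using pos_sa_kernel C D(1) by auto
    have "inner y y = inner (C y) \<psi> - inner (D y) \<psi>"
      by (subst (2) y_def) (simp add: inner_diff_right pos_sa_sym[OF C] pos_sa_sym[OF D(1)])
    then show "C \<psi> = D \<psi>" using z by (simp add: y_def)
  qed
  show ?thesis using un[OF A refl] un[OF B eq[symmetric]] by simp
qed

section \<open>Complex linear operators, adjoints and the trace norm\<close>

lemma inner_imaginary_left: "inner (\<i> *\<^sub>C a) b = Im (cinner a b)"
  by (simp add: inner_L2_def cinner_scaleC_left)

lemma clinear_opD: "clinear_op T \<Longrightarrow> T (c *\<^sub>C \<psi>) = c *\<^sub>C T \<psi>"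
  by (simp add: clinear_op_def)

lemma scaleC_Re_Im: "c *\<^sub>C \<psi> = Re c *\<^sub>R \<psi> + Im c *\<^sub>R (\<i> *\<^sub>C \<psi>)"
  by (simp add: scaleR_L2_def scaleC_scaleC scaleC_add_left[symmetric])
    (metis complex_eq mult.commute)

text \<open>Multiplication by i as a bounded operator: complex linearity becomes a commutation
  relation, which square roots inherit.\<close>

definition imaginary_op :: "L2 \<Rightarrow>\<^sub>L L2" where
  "imaginary_op = Blinfun (scaleC \<i>)"

lemma imaginary_op_apply [simp]: "imaginary_op \<psi> = \<i> *\<^sub>C \<psi>"
  unfolding imaginary_op_def
  by (subst bounded_linear_Blinfun_apply)
    (simp_all add: bounded_bilinear.bounded_linear_right[OF bounded_bilinear_scaleC])

lemma clinear_op_iff: "clinear_op T \<longleftrightarrow> T o\<^sub>L imaginary_op = imaginary_op o\<^sub>L T"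
proof
  assume "clinear_op T"
  then show "T o\<^sub>L imaginary_op = imaginary_op o\<^sub>L T"
    by (intro blinfun_eqI) (simp add: clinear_opD)
next
  assume "T o\<^sub>L imaginary_op = imaginary_op o\<^sub>L T"
  then have i: "T (\<i> *\<^sub>C \<psi>) = \<i> *\<^sub>C T \<psi>" for \<psi>
    by (metis blinfun_apply_blinfun_compose imaginary_op_apply)
  show "clinear_op T"
    unfolding clinear_op_def
    by (subst (1 2) scaleC_Re_Im) (simp add: blinfun.add_right blinfun.scaleR_right i)
qed

lemma cinner_sym_of_inner_sym:
  assumes "clinear_op T" "\<And>\<phi> \<psi>. inner \<phi> (T \<psi>) = inner (T \<phi>) \<psi>"
  shows "cinner \<phi> (T \<psi>) = cinner (T \<phi>) \<psi>"
proof (rule complex_eqI)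
  show "Re (cinner \<phi> (T \<psi>)) = Re (cinner (T \<phi>) \<psi>)"
    using assms(2) by (simp add: inner_L2_def)
  show "Im (cinner \<phi> (T \<psi>)) = Im (cinner (T \<phi>) \<psi>)"
    using assms(2)[of "\<i> *\<^sub>C \<phi>" \<psi>] by (simp add: clinear_opD[OF assms(1)] inner_imaginary_left)
qed

lemma positive_op_iff: "positive_op T \<longleftrightarrow> clinear_op T \<and> pos_sa T"
proof
  assume T: "positive_op T"
  then have cl: "clinear_op T" and im: "Im (cinner \<psi> (T \<psi>)) = 0" and re: "0 \<le> inner \<psi> (T \<psi>)" for \<psi>
    by (auto simp: positive_op_def inner_L2_def)
  have sym: "inner \<phi> (T \<psi>) = inner (T \<phi>) \<psi>" for \<phi> \<psi>
  proof -
    \<comment> \<open>Polarization: at \<phi> + i \<psi> the imaginary part of the quadratic form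
      compares the real parts of its two cross terms.\<close>
    have "Im (cinner (\<phi> + \<i> *\<^sub>C \<psi>) (T (\<phi> + \<i> *\<^sub>C \<psi>))) = 0" by (rule im)
    then have "Re (cinner \<phi> (T \<psi>)) - Re (cinner \<psi> (T \<phi>)) = 0"
      by (simp add: blinfun.add_right cinner_add_left cinner_add_right cinner_scaleC_left cinner_scaleC_right
          clinear_opD[OF cl] im)
    then show ?thesis by (simp add: inner_L2_def cinner_commute[of "T \<phi>"])
  qed
  show "clinear_op T \<and> pos_sa T" using cl re sym by (auto simp: pos_sa_def)
next
  assume T: "clinear_op T \<and> pos_sa T"
  then have "cinner \<psi> (T \<psi>) = cinner (T \<psi>) \<psi>" for \<psi>
    by (intro cinner_sym_of_inner_sym) (auto intro: pos_sa_sym)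
  then have "cinner \<psi> (T \<psi>) = cnj (cinner \<psi> (T \<psi>))" for \<psi>
    by (metis cinner_commute)
  from arg_cong[OF this, of Im] have "Im (cinner \<psi> (T \<psi>)) = 0" for \<psi> by simp
  then show "positive_op T"
    using T pos_sa_nonneg[of T] by (auto simp: positive_op_def inner_L2_def)
qed

lemma positive_op_sym: "positive_op T \<Longrightarrow> cinner \<phi> (T \<psi>) = cinner (T \<phi>) \<psi>"
  unfolding positive_op_iff by (intro cinner_sym_of_inner_sym) (auto intro: pos_sa_sym)

text \<open>The image of \<phi> is assembled from its prospective Fock coefficients <T e_n, \<phi>>.
  Applying T to their own partial sums bounds their square sum by (|T| |\<phi>|)^2.\<close>

lemma adjoint_exists:
  assumes T: "clinear_op T"
  obtains S where "clinear_op S" "\<And>\<phi> \<psi>. cinner \<phi> (T \<psi>) = cinner (S \<phi>) \<psi>"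
proof -
  define d where "d \<phi> n = cinner (T (fock n)) \<phi>" for \<phi> n
  have sd: "summable (\<lambda>n. (cmod (d \<phi> n))\<^sup>2)" for \<phi>
  proof (rule bounded_imp_summable[where B = "(norm T * norm \<phi>)\<^sup>2"])
    fix N
    define \<xi> where "\<xi> = (\<Sum>n\<le>N. d \<phi> n *\<^sub>C fock n)"
    have n: "(norm \<xi>)\<^sup>2 = (\<Sum>n\<le>N. (cmod (d \<phi> n))\<^sup>2)"
      unfolding \<xi>_def by (rule norm_sum_fock) simp
    have "cinner (T \<xi>) \<phi> = (\<Sum>n\<le>N. cnj (d \<phi> n) * d \<phi> n)"
      by (simp add: \<xi>_def blinfun.sum_right cinner_sum_left clinear_opD[OF T] cinner_scaleC_left d_def)
    also have "\<dots> = complex_of_real ((norm \<xi>)\<^sup>2)"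
      unfolding n of_real_sum by (intro sum.cong refl) (metis complex_norm_square mult.commute)
    finally have "cmod (complex_of_real ((norm \<xi>)\<^sup>2)) \<le> norm (T \<xi>) * norm \<phi>"
      using cinner_cauchy_schwarz[of "T \<xi>" \<phi>] by simp
    then have "(norm \<xi>)\<^sup>2 \<le> norm (T \<xi>) * norm \<phi>" by (simp add: norm_power)
    also have "\<dots> \<le> (norm T * norm \<xi>) * norm \<phi>" by (intro mult_right_mono norm_blinfun) simp
    finally have "norm \<xi> * norm \<xi> \<le> norm \<xi> * (norm T * norm \<phi>)" by (simp add: power2_eq_square mult_ac)
    then have "norm \<xi> \<le> norm T * norm \<phi>"
      by (cases "norm \<xi> = 0") (auto simp: mult_le_cancel_left)
    then show "(\<Sum>n\<le>N. (cmod (d \<phi> n))\<^sup>2) \<le> (norm T * norm \<phi>)\<^sup>2"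
      unfolding n[symmetric] by (rule power_mono) simp
  qed simp
  define s where "s \<phi> = (\<Sum>n. d \<phi> n *\<^sub>C fock n)" for \<phi>
  have adj: "cinner \<phi> (T \<psi>) = cinner (s \<phi>) \<psi>" for \<phi> \<psi>
  proof -
    have "(\<lambda>n. T (cinner (fock n) \<psi> *\<^sub>C fock n)) sums T \<psi>"
      by (rule blinfun.bounded_linear_right[THEN bounded_linear.sums, OF fock_sums])
    then have "(\<lambda>n. cinner (fock n) \<psi> * cinner \<phi> (T (fock n))) sums cinner \<phi> (T \<psi>)"
      using cinner_sums_right by (fastforce simp: clinear_opD[OF T] cinner_scaleC_right)
    moreover have "cinner \<phi> (T (fock n)) = cnj (cinner (fock n) (s \<phi>))" for n
      using cinner_fock_suminf[OF sd, of n \<phi>] cinner_commute[of \<phi> "T (fock n)"] by (simp add: s_def d_def)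
    moreover have "(\<lambda>n. cinner (fock n) \<psi> * cnj (cinner (fock n) (s \<phi>))) sums cinner (s \<phi>) \<psi>"
      using cinner_fock_sums[of "s \<phi>" \<psi>] by (simp add: mult.commute)
    ultimately show ?thesis by (simp add: sums_unique2)
  qed
  have add: "s (a + b) = s a + s b" for a b
    by (rule cinner_ext_left) (simp add: adj[symmetric] cinner_add_left)
  have scl: "s (c *\<^sub>C a) = c *\<^sub>C s a" for c a
    by (rule cinner_ext_left) (simp add: adj[symmetric] cinner_scaleC_left)
  have bl: "bounded_linear s"
  proof (rule bounded_linear_intro[where K = "norm T"])
    fix \<phi>
    have "complex_of_real ((norm (s \<phi>))\<^sup>2) = cinner \<phi> (T (s \<phi>))" by (simp only: adj cinner_self)
    then have "cmod (complex_of_real ((norm (s \<phi>))\<^sup>2)) \<le> norm \<phi> * norm (T (s \<phi>))"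
      using cinner_cauchy_schwarz[of \<phi> "T (s \<phi>)"] by simp
    then have "(norm (s \<phi>))\<^sup>2 \<le> norm \<phi> * norm (T (s \<phi>))" by (simp add: norm_power)
    also have "\<dots> \<le> norm \<phi> * (norm T * norm (s \<phi>))" by (intro mult_left_mono norm_blinfun) simp
    finally have "norm (s \<phi>) * norm (s \<phi>) \<le> norm (s \<phi>) * (norm \<phi> * norm T)"
      by (simp add: power2_eq_square mult_ac)
    then show "norm (s \<phi>) \<le> norm \<phi> * norm T"
      by (cases "norm (s \<phi>) = 0") (auto simp: mult_le_cancel_left)
  qed (auto simp: add scaleR_L2_def scl)
  show ?thesis
  proof (rule that[of "Blinfun s"])
    show "clinear_op (Blinfun s)"
      by (simp add: clinear_op_def bounded_linear_Blinfun_apply[OF bl] scl)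
    show "cinner \<phi> (T \<psi>) = cinner (Blinfun s \<phi>) \<psi>" for \<phi> \<psi>
      by (simp add: bounded_linear_Blinfun_apply[OF bl] adj)
  qed
qed

section \<open>Adjoint and modulus\<close>

lemma adj_op_eqI:
  fixes S T :: "L2 \<Rightarrow>\<^sub>L L2"
  assumes "\<And>\<phi> \<psi>. cinner \<phi> (T \<psi>) = cinner (S \<phi>) \<psi>"
  shows "adj_op T = S"
  unfolding adj_op_def
proof (rule the_equality)
  fix S' :: "L2 \<Rightarrow>\<^sub>L L2"
  assume "\<forall>\<phi> \<psi>. cinner \<phi> (T \<psi>) = cinner (S' \<phi>) \<psi>"
  then show "S' = S"
    by (intro blinfun_eqI cinner_ext_left) (metis assms)
qed (use assms in blast)

lemma adj_op:
  assumes "clinear_op T"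
  shows "clinear_op (adj_op T)" "cinner \<phi> (T \<psi>) = cinner (adj_op T \<phi>) \<psi>"
proof -
  obtain S where "clinear_op S" "\<And>\<phi> \<psi>. cinner \<phi> (T \<psi>) = cinner (S \<phi>) \<psi>"
    using adjoint_exists[OF assms] by blast
  then show "clinear_op (adj_op T)" "cinner \<phi> (T \<psi>) = cinner (adj_op T \<phi>) \<psi>"
    using adj_op_eqI by metis+
qed

lemma clinear_op_compose: "clinear_op S \<Longrightarrow> clinear_op T \<Longrightarrow> clinear_op (S o\<^sub>L T)"
  by (simp add: clinear_op_def)

lemma positive_op_sqrt:
  assumes "positive_op S"
  obtains B where "positive_op B" "B o\<^sub>L B = S"
proof -
  have S: "clinear_op S" "pos_sa S" using assms by (auto simp: positive_op_iff)
  obtain B where B: "pos_sa B" "B o\<^sub>L B = S" "\<forall>C. S o\<^sub>L C = C o\<^sub>L S \<longrightarrow> B o\<^sub>L C = C o\<^sub>L B"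
    by (rule pos_sa_sqrt[OF S(2)])
  have "clinear_op B" using B(3) S(1) unfolding clinear_op_iff by blast
  then show ?thesis using that B(1,2) by (simp add: positive_op_iff)
qed

lemma abs_op_eqI:
  assumes "positive_op B" "B o\<^sub>L B = adj_op T o\<^sub>L T"
  shows "abs_op T = B"
  unfolding abs_op_def
proof (rule the_equality)
  fix B' assume "positive_op B' \<and> B' o\<^sub>L B' = adj_op T o\<^sub>L T"
  then show "B' = B" using assms pos_sa_sqrt_unique[of B' B] by (simp add: positive_op_iff)
qed (use assms in simp)

lemma abs_op:
  assumes "clinear_op T"
  shows "positive_op (abs_op T)" "abs_op T o\<^sub>L abs_op T = adj_op T o\<^sub>L T"
proof -
  have "cinner \<psi> ((adj_op T o\<^sub>L T) \<psi>) = complex_of_real ((norm (T \<psi>))\<^sup>2)" for \<psi>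
    by (simp only: blinfun_apply_blinfun_compose cinner_self[symmetric])
      (metis adj_op(2)[OF assms] cinner_commute)
  then have "positive_op (adj_op T o\<^sub>L T)"
    using clinear_op_compose[OF adj_op(1)[OF assms] assms]
    by (simp add: positive_op_def del: blinfun_apply_blinfun_compose of_real_power)
  then obtain B where "positive_op B" "B o\<^sub>L B = adj_op T o\<^sub>L T"
    by (rule positive_op_sqrt)
  then show "positive_op (abs_op T)" "abs_op T o\<^sub>L abs_op T = adj_op T o\<^sub>L T"
    using abs_op_eqI by metis+
qed

lemma norm_abs_op: "clinear_op T \<Longrightarrow> norm (abs_op T \<psi>) = norm (T \<psi>)"
proof -
  assume T: "clinear_op T"
  have "cinner (abs_op T \<psi>) (abs_op T \<psi>) = cinner \<psi> (abs_op T (abs_op T \<psi>))"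
    by (rule positive_op_sym[OF abs_op(1)[OF T], symmetric])
  also have "\<dots> = cinner \<psi> (adj_op T (T \<psi>))"
    using abs_op(2)[OF T] by (metis blinfun_apply_blinfun_compose)
  also have "\<dots> = cinner (T \<psi>) (T \<psi>)"
    by (metis adj_op(2)[OF T] cinner_commute)
  finally have "(norm (abs_op T \<psi>))\<^sup>2 = (norm (T \<psi>))\<^sup>2"
    unfolding cinner_self of_real_eq_iff .
  then show ?thesis by simp
qed

lemma abs_op_positive: "positive_op T \<Longrightarrow> abs_op T = T"
  using adj_op_eqI[of T T] positive_op_sym by (intro abs_op_eqI) auto

section \<open>Hilbert-Schmidt sums, trace norm and trace\<close>

lemma suminf_swap_ennreal:
  fixes f :: "nat \<Rightarrow> nat \<Rightarrow> ennreal"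
  shows "(\<Sum>n. \<Sum>m. f m n) = (\<Sum>m. \<Sum>n. f m n)"
proof -
  have "(\<Sum>n. \<Sum>m. f m n) = (\<integral>\<^sup>+n. (\<Sum>m. f m n) \<partial>count_space UNIV)"
    by (rule nn_integral_count_space_nat [symmetric])
  also have "\<dots> = (\<Sum>m. \<integral>\<^sup>+n. f m n \<partial>count_space UNIV)"
    by (rule nn_integral_suminf) simp
  finally show ?thesis by (simp only: nn_integral_count_space_nat)
qed

text \<open>For symmetric A and P the products A P and P A are adjoint to each other: their matrices
  agree in modulus after transposition, and a double sum of nonnegative terms may be
  reordered.\<close>

lemma hilbert_schmidt_swap:
  fixes A P :: "L2 \<Rightarrow>\<^sub>L L2"
  assumes A: "\<And>\<phi> \<psi>. cinner \<phi> (A \<psi>) = cinner (A \<phi>) \<psi>" and P: "\<And>\<phi> \<psi>. cinner \<phi> (P \<psi>) = cinner (P \<phi>) \<psi>"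
  shows "(\<Sum>n. ennreal ((norm (A (P (fock n))))\<^sup>2)) = (\<Sum>n. ennreal ((norm (P (A (fock n))))\<^sup>2))"
proof -
  have "cmod (cinner (fock m) (A (P (fock n)))) = cmod (cinner (fock n) (P (A (fock m))))" for m n
    by (metis A P cinner_commute complex_mod_cnj)
  then have "(\<Sum>n. \<Sum>m. ennreal ((cmod (cinner (fock m) (A (P (fock n)))))\<^sup>2))
      = (\<Sum>n. \<Sum>m. ennreal ((cmod (cinner (fock n) (P (A (fock m)))))\<^sup>2))" by simp
  also have "\<dots> = (\<Sum>m. \<Sum>n. ennreal ((cmod (cinner (fock n) (P (A (fock m)))))\<^sup>2))"
    by (rule suminf_swap_ennreal)
  finally show ?thesis by (simp only: suminf_norm_fock)
qed

text \<open>The operator norm is at most the trace norm. For A with A^2 = |T| the trace norm is the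
  squared Hilbert-Schmidt norm of A, which bounds A as an operator; this is applied twice to |T
  \<psi>| = |A (A \<psi>)|. It turns trace-norm approximation into strong convergence.\<close>

lemma trace_norm_bound:
  assumes T: "clinear_op T" and t: "trace_norm T < ennreal e"
  shows "norm (T \<psi>) \<le> e * norm \<psi>"
proof -
  have e: "e > 0" using t by (metis ennreal_neg not_le not_less_zero zero_less_iff_neq_zero)
  obtain A where A: "positive_op A" "A o\<^sub>L A = abs_op T"
    using positive_op_sqrt[OF abs_op(1)[OF T]] by blast
  have AA: "A (A \<psi>) = abs_op T \<psi>" for \<psi> using A(2) by (metis blinfun_apply_blinfun_compose)
  note sym = positive_op_sym[OF A(1)]
  have "Re (cinner (fock n) (abs_op T (fock n))) = (norm (A (fock n)))\<^sup>2" for n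
    unfolding AA[symmetric] sym cinner_self by simp
  then have hs: "(\<Sum>n. ennreal ((norm (A (fock n)))\<^sup>2)) < ennreal e"
    using t by (simp add: trace_norm_def)
  have bound: "(norm (A \<psi>))\<^sup>2 \<le> e * (norm \<psi>)\<^sup>2" for \<psi>
  proof -
    have "ennreal ((norm (A \<psi>))\<^sup>2) = (\<Sum>n. ennreal ((cmod (cinner (A (fock n)) \<psi>))\<^sup>2))"
      unfolding suminf_norm_fock[symmetric] sym ..
    also have "\<dots> \<le> (\<Sum>n. ennreal ((norm (A (fock n)))\<^sup>2) * ennreal ((norm \<psi>)\<^sup>2))"
    proof (intro suminf_le)
      fix n
      have "(cmod (cinner (A (fock n)) \<psi>))\<^sup>2 \<le> (norm (A (fock n)) * norm \<psi>)\<^sup>2"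
        by (intro power_mono cinner_cauchy_schwarz) simp
      then show "ennreal ((cmod (cinner (A (fock n)) \<psi>))\<^sup>2) \<le> ennreal ((norm (A (fock n)))\<^sup>2) * ennreal ((norm \<psi>)\<^sup>2)"
        by (simp add: ennreal_mult[symmetric] power_mult_distrib ennreal_leI)
    qed auto
    also have "\<dots> = (\<Sum>n. ennreal ((norm (A (fock n)))\<^sup>2)) * ennreal ((norm \<psi>)\<^sup>2)"
      by (rule ennreal_suminf_multc)
    also have "\<dots> \<le> ennreal e * ennreal ((norm \<psi>)\<^sup>2)"
      using hs by (intro mult_right_mono) auto
    finally show ?thesis using e by (simp add: ennreal_mult[symmetric])
  qed
  have "(norm (T \<psi>))\<^sup>2 = (norm (A (A \<psi>)))\<^sup>2"
    unfolding AA norm_abs_op[OF T] ..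
  also have "\<dots> \<le> e * (norm (A \<psi>))\<^sup>2" by (rule bound)
  also have "\<dots> \<le> e * (e * (norm \<psi>)\<^sup>2)" using e by (intro mult_left_mono bound) auto
  also have "\<dots> = (e * norm \<psi>)\<^sup>2" by (simp add: power2_eq_square)
  finally show ?thesis by (rule power2_le_imp_le) (use e in simp)
qed

lemma projector_op_norm:
  assumes "projector_op W"
  shows "cinner \<psi> (W \<psi>) = complex_of_real ((norm (W \<psi>))\<^sup>2)"
    "(norm \<psi>)\<^sup>2 = (norm (W \<psi>))\<^sup>2 + (norm (\<psi> - W \<psi>))\<^sup>2"
proof -
  have WW: "W (W \<psi>) = W \<psi>" and sym: "cinner \<phi> (W \<psi>) = cinner (W \<phi>) \<psi>" for \<phi> \<psi>
    using assms unfolding projector_op_def by (metis blinfun_apply_blinfun_compose)+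
  show W: "cinner \<psi> (W \<psi>) = complex_of_real ((norm (W \<psi>))\<^sup>2)"
    unfolding cinner_self[symmetric] by (metis WW sym)
  have "inner \<psi> (W \<psi>) = inner (W \<psi>) (W \<psi>)"
    using W by (simp add: inner_L2_def cinner_self)
  then show "(norm \<psi>)\<^sup>2 = (norm (W \<psi>))\<^sup>2 + (norm (\<psi> - W \<psi>))\<^sup>2"
    by (simp add: power2_norm_eq_inner inner_diff_left inner_diff_right inner_commute)
qed

text \<open>Writing \<open>T = A\<^sup>2\<close>, the trace of \<open>T W\<close> is the squared Hilbert--Schmidt norm of \<open>A W\<close>: the cross term
  \<open>\<Sum>\<^sub>n \<langle>A (1 - W) e\<^sub>n, A W e\<^sub>n\<rangle>\<close> vanishes by polarization, since moving the projectors to the left of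
  \<open>A\<close> makes the two families orthogonal.\<close>

lemma op_trace_projector_sums:
  assumes T: "positive_op T" and fin: "trace_norm T < \<infinity>" and W: "projector_op W"
  shows "(\<lambda>n. inner (W (fock n)) (T (W (fock n)))) sums Re (op_trace (T o\<^sub>L W))"
proof -
  obtain A where A: "positive_op A" "A o\<^sub>L A = T"
    using positive_op_sqrt[OF T] by blast
  have AA: "T \<psi> = A (A \<psi>)" for \<psi> using A(2) by (metis blinfun_apply_blinfun_compose)
  note Asym = positive_op_sym[OF A(1)]
  have Wsym: "cinner \<phi> (W \<psi>) = cinner (W \<phi>) \<psi>" for \<phi> \<psi>
    using W unfolding projector_op_def by blast
  define V where "V = id_blinfun - W"
  have Vsym: "cinner \<phi> (V \<psi>) = cinner (V \<phi>) \<psi>" for \<phi> \<psi>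
    by (simp add: V_def blinfun.diff_left cinner_diff_left cinner_diff_right Wsym)
  define a where "a n = (norm (A (fock n)))\<^sup>2" for n
  define v where "v n = (norm (A (W (fock n))))\<^sup>2" for n
  define u where "u n = (norm (A (V (fock n))))\<^sup>2" for n
  define v' where "v' n = (norm (W (A (fock n))))\<^sup>2" for n
  define u' where "u' n = (norm (V (A (fock n))))\<^sup>2" for n
  have pyth: "a n = v' n + u' n" for n
    using projector_op_norm(2)[OF W, of "A (fock n)"] by (simp add: a_def v'_def u'_def V_def blinfun.diff_left)
  have nn: "0 \<le> a n" "0 \<le> v n" "0 \<le> u n" "0 \<le> v' n" "0 \<le> u' n" for n
    by (auto simp: a_def v_def u_def v'_def u'_def)
  have "trace_norm T = (\<Sum>n. ennreal (a n))"
    unfolding trace_norm_def abs_op_positive[OF T] AA Asym cinner_self a_def by simp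
  then have sa: "summable a"
    using fin nn by (intro summable_suminf_not_top) auto
  have sv': "summable v'" and su': "summable u'"
    using nn pyth by (auto intro!: summable_comparison_test'[OF sa, of 0])
  have swap: "summable g \<and> suminf g = suminf h"
    if "summable h" "\<And>n. 0 \<le> g n" "\<And>n. 0 \<le> h n" "(\<Sum>n. ennreal (g n)) = (\<Sum>n. ennreal (h n))" for g h :: "nat \<Rightarrow> real"
  proof -
    have h: "(\<Sum>n. ennreal (h n)) = ennreal (suminf h)" using that by (intro suminf_ennreal2) auto
    then have "summable g" using that by (intro summable_suminf_not_top) auto
    moreover from this have "(\<Sum>n. ennreal (g n)) = ennreal (suminf g)" using that by (intro suminf_ennreal2) auto
    ultimately show ?thesis using h that by (simp add: suminf_nonneg)
  qed
  have v: "summable v" "suminf v = suminf v'"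
    using swap[of v' v, OF sv' nn(2) nn(4)] hilbert_schmidt_swap[of A W, OF Asym Wsym] by (auto simp: v_def v'_def)
  have u: "summable u" "suminf u = suminf u'"
    using swap[of u' u, OF su' nn(3) nn(5)] hilbert_schmidt_swap[of A V, OF Asym Vsym] by (auto simp: u_def u'_def)
  \<comment> \<open>The cross terms vanish only in total, not one by one: since the sum of a is that
    of u plus that of v, the averages (a - u + v) / 2 below sum to that of v.\<close>
  have sum_a: "suminf a = suminf v + suminf u"
    unfolding v u suminf_add[OF sv' su'] pyth[symmetric] ..
  define z where "z n = cinner (fock n) (T (W (fock n)))" for n
  have z: "z n = cinner (A (fock n)) (A (W (fock n)))" for n
    by (simp add: z_def AA Asym)
  \<comment> \<open>\<open>op_trace\<close> is a \<open>suminf\<close>, so its value is informative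
    only once the diagonal series is known to converge.\<close>
  have "cmod (z n) \<le> a n + v n" for n
  proof -
    have "cmod (z n) \<le> norm (A (fock n)) * norm (A (W (fock n)))" unfolding z by (rule cinner_cauchy_schwarz)
    also have "\<dots> \<le> a n + v n"
      using sum_squares_bound[of "norm (A (fock n))" "norm (A (W (fock n)))"]
        mult_nonneg_nonneg[OF norm_ge_zero norm_ge_zero, of "A (fock n)" "A (W (fock n))"]
      unfolding a_def v_def by linarith
    finally show ?thesis .
  qed
  then have sz: "summable z"
    by (intro summable_comparison_test'[OF summable_add[OF sa v(1)], of 0]) auto
  have rez: "Re (z n) = (a n - u n + v n) / 2" for n
  proof -
    have e: "A (fock n) = A (V (fock n)) + A (W (fock n))"
      by (simp add: V_def blinfun.diff_left blinfun.diff_right)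
    have "a n = u n + 2 * inner (A (V (fock n))) (A (W (fock n))) + v n"
      unfolding a_def u_def v_def e power2_norm_eq_inner
      by (simp add: inner_add_left inner_add_right inner_commute)
    moreover have "Re (z n) = inner (A (V (fock n))) (A (W (fock n))) + v n"
      unfolding z inner_L2_def[symmetric] v_def power2_norm_eq_inner
      by (subst e) (simp add: inner_add_left)
    ultimately show ?thesis by simp
  qed
  have "(\<lambda>n. (a n - u n + v n) / 2) sums ((suminf a - suminf u + suminf v) / 2)"
    using sa u(1) v(1) by (intro sums_divide sums_add sums_diff summable_sums)
  then have "(\<lambda>n. Re (z n)) sums suminf v"
    unfolding rez[symmetric] by (simp add: sum_a)
  moreover have "(\<lambda>n. Re (z n)) sums Re (suminf z)"
    by (rule sums_Re[OF summable_sums[OF sz]])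
  ultimately have "Re (suminf z) = suminf v"
    by (rule sums_unique2[symmetric])
  then have "Re (op_trace (T o\<^sub>L W)) = suminf v"
    by (simp add: op_trace_def z_def[abs_def])
  moreover have "inner (W (fock n)) (T (W (fock n))) = v n" for n
    unfolding v_def AA inner_L2_def Asym cinner_self by simp
  ultimately show ?thesis using summable_sums[OF v(1)] by simp
qed

section \<open>Spectral projectors of the position operator\<close>

text \<open>Acts on an arbitrary representative; for Borel B the class of the product does not
  depend on that choice.\<close>

definition position_proj :: "real set \<Rightarrow> (L2 \<Rightarrow>\<^sub>L L2)" where
  "position_proj B = Blinfun (\<lambda>\<psi>. abs_L2 (\<lambda>t. of_real (indicator B t) * rep_L2 \<psi> t))"

lemma sq_int_bounded_mult:
  assumes f: "sq_int f" and b: "b \<in> borel_measurable borel" "\<And>t. cmod (b t) \<le> C"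
  shows "sq_int (\<lambda>t. b t * f t)"
  unfolding sq_int_def
proof
  have [measurable]: "f \<in> borel_measurable borel" "b \<in> borel_measurable borel"
    using f b by (auto simp: sq_int_def)
  show "(\<lambda>t. b t * f t) \<in> borel_measurable lborel" by measurable
  have "integrable lborel (\<lambda>t. C\<^sup>2 * (cmod (f t))\<^sup>2)" using f by (simp add: sq_int_def)
  then show "integrable lborel (\<lambda>t. (cmod (b t * f t))\<^sup>2)"
  proof (rule Bochner_Integration.integrable_bound)
    have "(cmod (b t * f t))\<^sup>2 \<le> C\<^sup>2 * (cmod (f t))\<^sup>2" for t
      unfolding norm_mult power_mult_distrib by (intro mult_right_mono power_mono b) auto
    from order_trans[OF this abs_ge_self]
    show "AE t in lborel. norm ((cmod (b t * f t))\<^sup>2) \<le> norm (C\<^sup>2 * (cmod (f t))\<^sup>2)"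
      by (intro AE_I2) (simp only: real_norm_def abs_power2)
  qed measurable
qed

lemma sq_int_indicator:
  "B \<in> sets borel \<Longrightarrow> sq_int f \<Longrightarrow> sq_int (\<lambda>t. of_real (indicator B t) * f t)"
  by (rule sq_int_bounded_mult[where C = 1]) (auto simp: indicator_def)

lemma norm_indicator_le:
  assumes "B \<in> sets borel" "sq_int f"
  shows "norm (abs_L2 (\<lambda>t. of_real (indicator B t) * f t)) \<le> norm (abs_L2 f)"
proof (rule power2_le_imp_le)
  show "(norm (abs_L2 (\<lambda>t. of_real (indicator B t) * f t)))\<^sup>2 \<le> (norm (abs_L2 f))\<^sup>2"
    using sq_int_indicator[OF assms] assms(2)
    by (simp add: norm_abs) (auto simp: sq_int_def indicator_def intro!: integral_mono)
qed simp

lemma position_proj_abs: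
  assumes B: "B \<in> sets borel" and f: "sq_int f"
  shows "position_proj B (abs_L2 f) = abs_L2 (\<lambda>t. of_real (indicator B t) * f t)"
proof -
  define T where "T \<psi> = abs_L2 (\<lambda>t. of_real (indicator B t) * rep_L2 \<psi> t)" for \<psi>
  have T: "T (abs_L2 g) = abs_L2 (\<lambda>t. of_real (indicator B t) * g t)" if g: "sq_int g" for g
  proof -
    have "abs_L2 (rep_L2 (abs_L2 g)) = abs_L2 g" by (rule abs_rep_L2)
    then have "AE t in lborel. rep_L2 (abs_L2 g) t = g t"
      using abs_L2_eq_iff[OF sq_int_rep g] by simp
    then have "AE t in lborel. of_real (indicator B t) * rep_L2 (abs_L2 g) t = of_real (indicator B t) * g t"
      by eventually_elim simp
    then show ?thesis
      unfolding T_def by (intro abs_L2_eqI sq_int_indicator B sq_int_rep g)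
  qed
  have "bounded_linear T"
  proof (rule bounded_linear_intro[where K = 1])
    show "T (a + b) = T a + T b" for a b
    proof -
      obtain g h where "sq_int g" "a = abs_L2 g" "sq_int h" "b = abs_L2 h" by (metis L2_cases)
      then show ?thesis
        by (simp add: plus_abs T sq_int_add sq_int_indicator[OF B] distrib_left)
    qed
    show "T (r *\<^sub>R a) = r *\<^sub>R T a" for r a
    proof -
      obtain g where "sq_int g" "a = abs_L2 g" by (metis L2_cases)
      then show ?thesis
        by (simp add: scaleR_L2_def scaleC_abs T sq_int_cmult sq_int_indicator[OF B] mult.left_commute)
    qed
    show "norm (T a) \<le> norm a * 1" for a
      unfolding T_def using norm_indicator_le[OF B sq_int_rep[of a]] by (simp add: abs_rep_L2)
  qed
  then show ?thesis
    unfolding position_proj_def using T[OF f]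
    by (simp add: bounded_linear_Blinfun_apply T_def[abs_def, symmetric])
qed

lemma position_proj_clinear: "B \<in> sets borel \<Longrightarrow> clinear_op (position_proj B)"
  unfolding clinear_op_def
proof (intro allI)
  fix c \<psi> assume B: "B \<in> sets borel"
  obtain f where f: "sq_int f" "\<psi> = abs_L2 f" by (rule L2_cases)
  then show "position_proj B (c *\<^sub>C \<psi>) = c *\<^sub>C position_proj B \<psi>"
    by (simp add: scaleC_abs position_proj_abs[OF B] sq_int_cmult sq_int_indicator[OF B] mult.left_commute)
qed

lemma position_proj_Int:
  assumes "B \<in> sets borel" "C \<in> sets borel"
  shows "position_proj (B \<inter> C) = position_proj B o\<^sub>L position_proj C"
proof (rule blinfun_eqI)
  fix \<psi>
  obtain f where f: "sq_int f" "\<psi> = abs_L2 f" by (rule L2_cases)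
  then show "position_proj (B \<inter> C) \<psi> = (position_proj B o\<^sub>L position_proj C) \<psi>"
    using assms by (simp add: position_proj_abs sq_int_indicator indicator_inter_arith mult.assoc)
qed

lemma position_proj_sym:
  assumes "B \<in> sets borel"
  shows "cinner \<phi> (position_proj B \<psi>) = cinner (position_proj B \<phi>) \<psi>"
proof -
  obtain f where f: "sq_int f" "\<phi> = abs_L2 f" by (rule L2_cases)
  obtain g where g: "sq_int g" "\<psi> = abs_L2 g" by (rule L2_cases)
  show ?thesis
    using assms f g by (simp add: position_proj_abs cinner_abs sq_int_indicator) (simp add: mult_ac)
qed

lemma position_proj_UNIV: "position_proj UNIV = id_blinfun"
proof (rule blinfun_eqI)
  fix \<psi>
  obtain f where f: "sq_int f" "\<psi> = abs_L2 f" by (rule L2_cases)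
  then show "position_proj UNIV \<psi> = id_blinfun \<psi>" by (simp add: position_proj_abs)
qed

lemma position_proj_empty: "position_proj {} \<psi> = 0"
proof -
  obtain f where f: "sq_int f" "\<psi> = abs_L2 f" by (rule L2_cases)
  then show ?thesis by (simp add: position_proj_abs zero_L2_def)
qed

lemma position_proj_projector: "B \<in> sets borel \<Longrightarrow> projector_op (position_proj B)"
  unfolding projector_op_def
  using position_proj_clinear position_proj_Int[of B B] position_proj_sym by auto

lemma position_proj_Un_disjoint:
  assumes "B \<in> sets borel" "C \<in> sets borel" "B \<inter> C = {}"
  shows "position_proj (B \<union> C) \<psi> = position_proj B \<psi> + position_proj C \<psi>"
proof -
  obtain f where f: "sq_int f" "\<psi> = abs_L2 f" by (rule L2_cases)
  have "indicator (B \<union> C) t = (indicator B t + indicator C t :: real)" for t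
    using assms(3) by (auto simp: indicator_def)
  then show ?thesis
    using assms f by (simp add: position_proj_abs sq_int_indicator plus_abs distrib_right)
qed

text \<open>Dominated convergence: a difference of indicators has modulus at most 1, so |f|^2 is a
  majorant. It yields countable additivity and, later, the exhaustion of open intervals and rays by
  compact intervals.\<close>

lemma position_proj_tendsto:
  assumes B: "\<And>n. B n \<in> sets borel" "C \<in> sets borel"
    and lim: "\<And>t. (\<lambda>n. indicator (B n) t :: real) \<longlonglongrightarrow> indicator C t"
  shows "(\<lambda>n. position_proj (B n) \<psi>) \<longlonglongrightarrow> position_proj C \<psi>"
proof -
  obtain f where f: "sq_int f" "\<psi> = abs_L2 f" by (rule L2_cases)
  have [measurable]: "f \<in> borel_measurable borel" "\<And>n. B n \<in> sets borel" "C \<in> sets borel"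
    using f B by (auto simp: sq_int_def)
  define d where "d n t = complex_of_real (indicator (B n) t - indicator C t) * f t" for n t
  have n: "(norm (position_proj (B n) \<psi> - position_proj C \<psi>))\<^sup>2 = (LINT t|lborel. (cmod (d n t))\<^sup>2)" for n
    using f B sq_int_diff[OF sq_int_indicator sq_int_indicator, OF B(1) f(1) B(2) f(1), of n]
    by (simp add: position_proj_abs minus_abs sq_int_indicator norm_abs d_def[abs_def] left_diff_distrib)
  have "(\<lambda>n. LINT t|lborel. (cmod (d n t))\<^sup>2) \<longlonglongrightarrow> (LINT t|(lborel::real measure). 0)"
  proof (rule integral_dominated_convergence)
    show "integrable lborel (\<lambda>t. (cmod (f t))\<^sup>2)" using f by (simp add: sq_int_def)
    show "AE t in lborel. (\<lambda>n. (cmod (d n t))\<^sup>2) \<longlonglongrightarrow> 0"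
    proof (rule AE_I2)
      fix t
      have "(\<lambda>n. (cmod (d n t))\<^sup>2) \<longlonglongrightarrow> (cmod (complex_of_real (indicator C t - indicator C t) * f t))\<^sup>2"
        unfolding d_def by (intro tendsto_intros lim)
      then show "(\<lambda>n. (cmod (d n t))\<^sup>2) \<longlonglongrightarrow> 0" by simp
    qed
    show "AE t in lborel. norm ((cmod (d n t))\<^sup>2) \<le> (cmod (f t))\<^sup>2" for n
      by (rule AE_I2) (auto simp: d_def indicator_def)
  qed (auto simp: d_def)
  then have "(\<lambda>n. (norm (position_proj (B n) \<psi> - position_proj C \<psi>))\<^sup>2) \<longlonglongrightarrow> 0" by (simp add: n)
  then have "(\<lambda>n. sqrt ((norm (position_proj (B n) \<psi> - position_proj C \<psi>))\<^sup>2)) \<longlonglongrightarrow> sqrt 0"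
    by (rule tendsto_real_sqrt)
  then show ?thesis by (simp add: LIM_zero_iff tendsto_norm_zero_iff)
qed

lemma position_proj_pvm: "projection_valued_measure position_proj"
  unfolding projection_valued_measure_def
proof (intro conjI ballI allI impI)
  fix B :: "nat \<Rightarrow> real set" and \<psi>
  assume B: "range B \<subseteq> sets borel" and d: "disjoint_family B"
  have [measurable]: "B i \<in> sets borel" for i using B by auto
  have "(\<Sum>i<n. position_proj (B i) \<psi>) = position_proj (\<Union>i<n. B i) \<psi>" for n
  proof (induction n)
    case (Suc n)
    have "(\<Union>i<n. B i) \<inter> B n = {}"
      using d by (auto simp: disjoint_family_on_def) (metis disjoint_iff less_irrefl)
    then have "position_proj ((\<Union>i<n. B i) \<union> B n) \<psi> = position_proj (\<Union>i<n. B i) \<psi> + position_proj (B n) \<psi>"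
      by (intro position_proj_Un_disjoint) auto
    then show ?case by (simp add: Suc lessThan_Suc Un_commute)
  qed (simp add: position_proj_empty)
  moreover have "(\<lambda>n. position_proj (\<Union>i<n. B i) \<psi>) \<longlonglongrightarrow> position_proj (\<Union>i. B i) \<psi>"
    by (intro position_proj_tendsto LIMSEQ_indicator_UN) auto
  ultimately show "(\<lambda>i. position_proj (B i) \<psi>) sums position_proj (\<Union>i. B i) \<psi>"
    by (simp add: sums_def)
qed (auto intro: position_proj_projector position_proj_UNIV position_proj_Int)

section \<open>Projection-valued measures and their distributions\<close>

lemma pvm_projector: "projection_valued_measure Q \<Longrightarrow> B \<in> sets borel \<Longrightarrow> projector_op (Q B)"
  by (simp add: projection_valued_measure_def)

lemma pvm_Int: "projection_valued_measure Q \<Longrightarrow> B \<in> sets borel \<Longrightarrow> C \<in> sets borel \<Longrightarrow> Q (B \<inter> C) = Q B o\<^sub>L Q C"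
  by (simp add: projection_valued_measure_def)

lemma pvm_sums:
  fixes B :: "nat \<Rightarrow> real set"
  shows "projection_valued_measure Q \<Longrightarrow> range B \<subseteq> sets borel \<Longrightarrow> disjoint_family B \<Longrightarrow> (\<lambda>i. Q (B i) \<psi>) sums Q (\<Union>i. B i) \<psi>"
  by (simp add: projection_valued_measure_def)

text \<open>Additivity over infinitely many empty sets makes a constant series converge, so its term
  is 0.\<close>

lemma pvm_empty:
  assumes Q: "projection_valued_measure Q"
  shows "Q {} \<psi> = 0"
proof -
  have "(\<lambda>i. Q {} \<psi>) sums Q (\<Union>i::nat. {}) \<psi>"
    using pvm_sums[OF Q, of "\<lambda>_. {}"] by (simp add: disjoint_family_on_def)
  then have "summable (\<lambda>i::nat. Q {} \<psi>)" by (rule sums_summable)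
  then show ?thesis by (simp add: summable_const_iff)
qed

lemma pvm_compl:
  assumes Q: "projection_valued_measure Q" and B: "B \<in> sets borel"
  shows "Q B \<psi> + Q (- B) \<psi> = \<psi>"
proof -
  have B': "- B \<in> sets borel" using B by (metis Compl_in_sets_lebesgue borel_comp)
  define A where "A i = (if i = 0 then B else if i = 1 then - B else {})" for i :: nat
  have "(\<lambda>i. Q (A i) \<psi>) sums Q (\<Union>i. A i) \<psi>"
    using B B' by (intro pvm_sums[OF Q]) (auto simp: A_def disjoint_family_on_def)
  moreover have "(\<Union>i. A i) = UNIV" by (auto simp: A_def intro: exI[of _ 0] exI[of _ 1])
  moreover have "Q UNIV = id_blinfun" using Q by (simp add: projection_valued_measure_def)
  moreover have "(\<lambda>i. Q (A i) \<psi>) sums (\<Sum>i\<in>{0, 1}. Q (A i) \<psi>)"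
    by (rule sums_finite) (auto simp: A_def pvm_empty[OF Q])
  ultimately have "(\<Sum>i\<in>{0, 1}. Q (A i) \<psi>) = \<psi>" using sums_unique2 by fastforce
  then show ?thesis by (simp add: A_def)
qed

text \<open>\<open>measure_of\<close> takes the prescribed values only for a countably additive set
  function; here additivity is inherited from strong convergence, and projections turn the quadratic
  form into a squared norm.\<close>

lemma
  assumes Q: "projection_valued_measure Q"
  shows sets_spectral_dist [simp, measurable_cong]: "sets (spectral_dist Q \<psi>) = sets borel"
    and space_spectral_dist [simp]: "space (spectral_dist Q \<psi>) = UNIV"
    and emeasure_spectral_dist: "B \<in> sets borel \<Longrightarrow> emeasure (spectral_dist Q \<psi>) B = ennreal ((norm (Q B \<psi>))\<^sup>2)"
proof -
  show s: "sets (spectral_dist Q \<psi>) = sets borel"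
    unfolding spectral_dist_def by (subst sets_measure_of) (auto simp: sets.sigma_sets_eq[of borel, simplified])
  show "space (spectral_dist Q \<psi>) = UNIV" unfolding spectral_dist_def by simp
  have n: "Re (cinner \<psi> (Q B \<psi>)) = (norm (Q B \<psi>))\<^sup>2" if "B \<in> sets borel" for B
    using projector_op_norm(1)[OF pvm_projector[OF Q that]] by simp
  show "emeasure (spectral_dist Q \<psi>) B = ennreal ((norm (Q B \<psi>))\<^sup>2)" if B: "B \<in> sets borel"
  proof -
    have "emeasure (spectral_dist Q \<psi>) B = ennreal (Re (cinner \<psi> (Q B \<psi>)))"
    proof (rule emeasure_measure_of[OF spectral_dist_def])
      show "positive (sets (spectral_dist Q \<psi>)) (\<lambda>B. ennreal (Re (cinner \<psi> (Q B \<psi>))))"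
        by (simp add: positive_def pvm_empty[OF Q])
      show "countably_additive (sets (spectral_dist Q \<psi>)) (\<lambda>B. ennreal (Re (cinner \<psi> (Q B \<psi>))))"
        unfolding s
      proof (rule countably_additiveI)
        fix A :: "nat \<Rightarrow> real set"
        assume A: "range A \<subseteq> sets borel" "disjoint_family A"
        have "(\<lambda>i. Re (cinner \<psi> (Q (A i) \<psi>))) sums Re (cinner \<psi> (Q (\<Union>i. A i) \<psi>))"
          by (intro sums_Re cinner_sums_right pvm_sums[OF Q] A)
        moreover have "0 \<le> Re (cinner \<psi> (Q (A i) \<psi>))" for i
          using n[of "A i"] A by auto
        ultimately show "(\<Sum>i. ennreal (Re (cinner \<psi> (Q (A i) \<psi>)))) = ennreal (Re (cinner \<psi> (Q (\<Union>i. A i) \<psi>)))"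
          by (intro suminf_ennreal_eq)
      qed
    qed (use B s in auto)
    then show ?thesis by (simp add: n[OF B])
  qed
qed

lemma spectral_dist_position:
  assumes f: "sq_int f"
  shows "spectral_dist position_proj (abs_L2 f) = density lborel (\<lambda>t. ennreal ((cmod (f t))\<^sup>2))"
proof (rule measure_eqI)
  have [measurable]: "f \<in> borel_measurable borel" using f by (simp add: sq_int_def)
  fix B assume "B \<in> sets (spectral_dist position_proj (abs_L2 f))"
  then have B [measurable]: "B \<in> sets borel" using position_proj_pvm by simp
  have i: "integrable lborel (\<lambda>t. (cmod (of_real (indicator B t) * f t))\<^sup>2)"
    using sq_int_indicator[OF B f] by (simp add: sq_int_def)
  have "emeasure (density lborel (\<lambda>t. ennreal ((cmod (f t))\<^sup>2))) B
     = (\<integral>\<^sup>+t. ennreal ((cmod (f t))\<^sup>2) * indicator B t \<partial>lborel)"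
    by (simp add: emeasure_density)
  also have "\<dots> = (\<integral>\<^sup>+t. ennreal ((cmod (of_real (indicator B t) * f t))\<^sup>2) \<partial>lborel)"
    by (intro nn_integral_cong) (auto simp: indicator_def)
  also have "\<dots> = ennreal ((norm (position_proj B (abs_L2 f)))\<^sup>2)"
    using i by (simp add: position_proj_abs f norm_abs sq_int_indicator nn_integral_eq_integral)
  finally show "emeasure (spectral_dist position_proj (abs_L2 f)) B = emeasure (density lborel (\<lambda>t. ennreal ((cmod (f t))\<^sup>2))) B"
    by (simp add: emeasure_spectral_dist[OF position_proj_pvm])
qed (simp add: position_proj_pvm)

lemma position_op_abs_iff:
  assumes f: "sq_int f"
  shows "position_op (abs_L2 f) \<phi> \<longleftrightarrow> sq_int (\<lambda>t. of_real t * f t) \<and> \<phi> = abs_L2 (\<lambda>t. of_real t * f t)"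
proof -
  obtain g where g: "sq_int g" "\<phi> = abs_L2 g" by (rule L2_cases)
  have [measurable]: "f \<in> borel_measurable borel" "g \<in> borel_measurable borel" using f g by (auto simp: sq_int_def)
  show ?thesis
  proof
    assume "position_op (abs_L2 f) \<phi>"
    then have ae: "AE t in lborel. g t = of_real t * f t" using position_op_abs f g by simp
    from ae have "AE t in lborel. (cmod (of_real t * f t))\<^sup>2 = (cmod (g t))\<^sup>2"
      by eventually_elim simp
    then have "integrable lborel (\<lambda>t. (cmod (of_real t * f t))\<^sup>2) = integrable lborel (\<lambda>t. (cmod (g t))\<^sup>2)"
      by (intro integrable_cong_AE) measurable
    then have "integrable lborel (\<lambda>t. (cmod (of_real t * f t))\<^sup>2)"
      using g(1) unfolding sq_int_def by blast
    then have "sq_int (\<lambda>t. of_real t * f t)" by (simp add: sq_int_def)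
    then show "sq_int (\<lambda>t. of_real t * f t) \<and> \<phi> = abs_L2 (\<lambda>t. of_real t * f t)"
      using g ae by (auto intro: abs_L2_eqI)
  qed (use position_op_abs f in auto)
qed

theorem spectral_measure_position: "spectral_measure_of position_op position_proj"
  unfolding spectral_measure_of_def
proof (intro conjI allI impI position_proj_pvm)
  fix \<psi> \<phi>
  obtain f where f: "sq_int f" "\<psi> = abs_L2 f" by (rule L2_cases)
  have [measurable]: "f \<in> borel_measurable borel" using f by (simp add: sq_int_def)
  have "(\<integral>\<^sup>+s. ennreal (s\<^sup>2) \<partial>spectral_dist position_proj \<psi>) = (\<integral>\<^sup>+s. ennreal ((cmod (of_real s * f s))\<^sup>2) \<partial>lborel)"
    unfolding f(2) spectral_dist_position[OF f(1)]
    by (subst nn_integral_density) (auto intro!: nn_integral_cong simp: norm_mult power_mult_distrib ennreal_mult mult.commute)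
  then show "(\<exists>\<phi>. position_op \<psi> \<phi>) \<longleftrightarrow> (\<integral>\<^sup>+s. ennreal (s\<^sup>2) \<partial>spectral_dist position_proj \<psi>) < \<infinity>"
    unfolding f(2) position_op_abs_iff[OF f(1)] by (auto simp: sq_int_def integrable_iff_bounded)
  assume p: "position_op \<psi> \<phi>"
  then have t: "sq_int (\<lambda>t. of_real t * f t)" "\<phi> = abs_L2 (\<lambda>t. of_real t * f t)"
    unfolding f(2) position_op_abs_iff[OF f(1)] by auto
  have "cinner \<psi> \<phi> = (LINT t|lborel. complex_of_real ((cmod (f t))\<^sup>2 * t))"
    unfolding f(2) t(2) cinner_abs[OF f(1) t(1)]
    by (intro Bochner_Integration.integral_cong refl)
       (simp only: of_real_mult complex_norm_square mult_ac)
  also have "\<dots> = complex_of_real (LINT t|lborel. (cmod (f t))\<^sup>2 * t)"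
    by (rule integral_complex_of_real)
  also have "(LINT t|lborel. (cmod (f t))\<^sup>2 * t) = (LINT s|spectral_dist position_proj \<psi>. s)"
    unfolding f(2) spectral_dist_position[OF f(1)] by (subst integral_density) auto
  finally show "cinner \<psi> \<phi> = complex_of_real (LINT s|spectral_dist position_proj \<psi>. s)" .
qed

section \<open>Uniqueness of the spectral projectors of the position operator\<close>

lemma position_op_add:
  "position_op a a' \<Longrightarrow> position_op b b' \<Longrightarrow> position_op (a + b) (a' + b')"
  by transfer (auto simp: sq_int_add distrib_left)

lemma position_op_scaleC: "position_op a a' \<Longrightarrow> position_op (c *\<^sub>C a) (c *\<^sub>C a')"
  by transfer (auto simp: sq_int_cmult)

lemma position_op_unique: "position_op a b \<Longrightarrow> position_op a c \<Longrightarrow> b = c"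
  by transfer auto

text \<open>The truncations of v to [-n, n] lie in the domain and their inner products with v are
  their own squared norms. If these vanish, so does the limit v.\<close>

lemma position_op_dense:
  assumes "\<And>\<psi> \<phi>. position_op \<psi> \<phi> \<Longrightarrow> cinner \<psi> v = 0"
  shows "v = 0"
proof -
  have z: "position_proj {- real n..real n} v = 0" for n
  proof -
    obtain f where f: "sq_int f" "v = abs_L2 f" by (rule L2_cases)
    define B where "B = {- real n..real n}"
    have "sq_int (\<lambda>t. (of_real t * of_real (indicator B t)) * f t)"
      by (rule sq_int_bounded_mult[OF f(1), where C = "real n"]) (auto simp: B_def indicator_def)
    then have "position_op (position_proj B v) (abs_L2 (\<lambda>t. of_real t * (of_real (indicator B t) * f t)))"
      using f by (simp add: position_proj_abs position_op_abs_iff sq_int_indicator B_def mult.assoc)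
    then have "cinner (position_proj B v) v = 0" by (rule assms)
    then have "cinner v (position_proj B v) = 0" by (subst cinner_commute) simp
    then show ?thesis
      using projector_op_norm(1)[OF position_proj_projector, of B v] by (simp add: B_def)
  qed
  have "(\<lambda>n. position_proj {- real n..real n} v) \<longlonglongrightarrow> position_proj UNIV v"
  proof (rule position_proj_tendsto)
    fix t :: real
    obtain N where N: "\<bar>t\<bar> \<le> real N" using real_arch_simple by blast
    have "eventually (\<lambda>n. indicator {- real n..real n} t = (indicator UNIV t :: real)) sequentially"
      using N by (intro eventually_sequentiallyI[of N]) (auto simp: indicator_def)
    then show "(\<lambda>n. indicator {- real n..real n} t) \<longlonglongrightarrow> (indicator UNIV t :: real)"
      by (rule tendsto_eventually)
  qed auto
  then show ?thesis using z by (simp add: position_proj_UNIV LIMSEQ_const_iff)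
qed

text \<open>Reduces moments of \<open>Q B \<psi>\<close> to integrals over B against the
  distribution of \<open>\<psi>\<close>.\<close>

lemma spectral_dist_restrict:
  assumes Q: "projection_valued_measure Q" and B: "B \<in> sets borel"
  shows "spectral_dist Q (Q B \<psi>) = density (spectral_dist Q \<psi>) (indicator B)"
proof (rule measure_eqI)
  fix C assume "C \<in> sets (spectral_dist Q (Q B \<psi>))"
  then have C: "C \<in> sets borel" using Q by simp
  have "Q C (Q B \<psi>) = Q (B \<inter> C) \<psi>"
    using pvm_Int[OF Q C B] by (simp add: Int_commute)
  then show "emeasure (spectral_dist Q (Q B \<psi>)) C = emeasure (density (spectral_dist Q \<psi>) (indicator B)) C"
    using B C Q by (simp add: emeasure_restricted emeasure_spectral_dist)
qed (use Q in simp)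

locale position_spectral =
  fixes Q :: "real set \<Rightarrow> (L2 \<Rightarrow>\<^sub>L L2)"
  assumes spec: "spectral_measure_of position_op Q"
begin

lemma Q: "projection_valued_measure Q"
  using spec by (simp add: spectral_measure_of_def)

lemma dom_iff: "(\<exists>\<phi>. position_op \<psi> \<phi>) \<longleftrightarrow> (\<integral>\<^sup>+s. ennreal (s\<^sup>2) \<partial>spectral_dist Q \<psi>) < \<infinity>"
  using spec by (simp add: spectral_measure_of_def)

lemma expectation: "position_op \<psi> \<phi> \<Longrightarrow> cinner \<psi> \<phi> = complex_of_real (LINT s|spectral_dist Q \<psi>. s)"
  using spec by (simp add: spectral_measure_of_def)

lemma finite_dist: "finite_measure (spectral_dist Q \<psi>)"
  by (rule finite_measureI) (simp add: Q emeasure_spectral_dist)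

lemma borel_measurable_dist [simp]: "borel_measurable (spectral_dist Q \<psi>) = borel_measurable borel"
  by (rule measurable_cong_sets) (simp_all add: Q)

lemma integrable_ident:
  assumes "position_op \<psi> \<phi>"
  shows "integrable (spectral_dist Q \<psi>) (\<lambda>s. s)"
proof -
  interpret finite_measure "spectral_dist Q \<psi>" by (rule finite_dist)
  have "integrable (spectral_dist Q \<psi>) (\<lambda>s. s\<^sup>2)"
  proof (rule integrableI_bounded)
    show "(\<integral>\<^sup>+s. ennreal (norm (s\<^sup>2)) \<partial>spectral_dist Q \<psi>) < \<infinity>"
      using dom_iff[of \<psi>] assms by auto
  qed simp
  then have i: "integrable (spectral_dist Q \<psi>) (\<lambda>s. 1 + s\<^sup>2)" by simp
  have "norm s \<le> norm (1 + s\<^sup>2)" for s :: real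
  proof -
    have "0 \<le> (\<bar>s\<bar> - 1)\<^sup>2" "0 \<le> \<bar>s\<bar>" by simp_all
    then show ?thesis by (simp add: power2_diff)
  qed
  then show ?thesis
    by (intro Bochner_Integration.integrable_bound[OF i] AE_I2) simp_all
qed

lemma dom_restrict:
  assumes "position_op \<psi> \<phi>" "B \<in> sets borel"
  obtains \<phi>' where "position_op (Q B \<psi>) \<phi>'"
proof -
  have [measurable]: "B \<in> sets (spectral_dist Q \<psi>)" using assms Q by simp
  have "(\<integral>\<^sup>+s. ennreal (s\<^sup>2) \<partial>spectral_dist Q (Q B \<psi>)) = (\<integral>\<^sup>+s. indicator B s * ennreal (s\<^sup>2) \<partial>spectral_dist Q \<psi>)"
    unfolding spectral_dist_restrict[OF Q assms(2)]
    using assms(2) by (subst nn_integral_density) auto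
  also have "\<dots> \<le> (\<integral>\<^sup>+s. ennreal (s\<^sup>2) \<partial>spectral_dist Q \<psi>)"
    by (intro nn_integral_mono) (auto simp: indicator_def)
  also have "\<dots> < \<infinity>" using dom_iff[of \<psi>] assms by auto
  finally have "\<exists>\<phi>'. position_op (Q B \<psi>) \<phi>'" using dom_iff by blast
  then show ?thesis using that by blast
qed

lemma expectation_restrict:
  assumes "position_op (Q B \<psi>) \<phi>" "B \<in> sets borel"
  shows "cinner (Q B \<psi>) \<phi> = complex_of_real (LINT s|spectral_dist Q \<psi>. indicator B s * s)"
  unfolding expectation[OF assms(1)] spectral_dist_restrict[OF Q assms(2)]
proof -
  have "density (spectral_dist Q \<psi>) (indicator B) = density (spectral_dist Q \<psi>) (\<lambda>s. ennreal (indicator B s))"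
    by (simp add: ennreal_indicator)
  then show "complex_of_real (LINT s|density (spectral_dist Q \<psi>) (indicator B). s) =
    complex_of_real (LINT s|spectral_dist Q \<psi>. indicator B s * s)"
    using assms by (simp add: integral_density)
qed

lemma compl_borel: "B \<in> sets borel \<Longrightarrow> - B \<in> sets (borel :: real measure)"
  using borel_comp by blast

lemma QQ: "B \<in> sets borel \<Longrightarrow> Q B (Q B \<psi>) = Q B \<psi>"
  using pvm_Int[OF Q, of B B] by (metis Int_absorb blinfun_apply_blinfun_compose)

lemma Q_disjoint: "B \<in> sets borel \<Longrightarrow> C \<in> sets borel \<Longrightarrow> B \<inter> C = {} \<Longrightarrow> Q B (Q C \<psi>) = 0"
  using pvm_Int[OF Q, of B C] pvm_empty[OF Q] by (metis blinfun_apply_blinfun_compose)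

lemma Qsym: "B \<in> sets borel \<Longrightarrow> cinner \<phi> (Q B \<psi>) = cinner (Q B \<phi>) \<psi>"
  using pvm_projector[OF Q] by (simp add: projector_op_def)

text \<open>Only diagonal matrix elements are given, so the off-diagonal ones between the ranges of
  \<open>Q B\<close> and \<open>Q (- B)\<close> are obtained by polarization.\<close>

lemma off_diagonal:
  assumes B: "B \<in> sets borel" and p: "position_op (Q B \<psi>) a" and q: "position_op (Q (- B) \<chi>') b"
  shows "cinner (Q (- B) \<chi>') a = 0"
proof -
  note B' = compl_borel[OF B]
  have cross: "cinner (Q B \<psi>) b + cinner (Q (- B) \<chi>') a = 0"
    if p: "position_op (Q B \<psi>) a" and q: "position_op (Q (- B) \<chi>') b" for \<psi> \<chi>' a b
  proof -
    define \<omega> where "\<omega> = Q B \<psi> + Q (- B) \<chi>'"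
    have w: "position_op \<omega> (a + b)" unfolding \<omega>_def by (rule position_op_add[OF p q])
    have wB: "Q B \<omega> = Q B \<psi>" "Q (- B) \<omega> = Q (- B) \<chi>'"
      using B B' by (simp_all add: \<omega>_def blinfun.add_right QQ Q_disjoint)
    have i: "integrable (spectral_dist Q \<omega>) (\<lambda>s. indicator C s * s)" if "C \<in> sets borel" for C
      using integrable_mult_indicator[OF _ integrable_ident[OF w], of C] that Q by simp
    have "cinner \<omega> (a + b) = complex_of_real (LINT s|spectral_dist Q \<omega>. s)" by (rule expectation[OF w])
    also have "(LINT s|spectral_dist Q \<omega>. s) = (LINT s|spectral_dist Q \<omega>. indicator B s * s + indicator (- B) s * s)"
      by (intro Bochner_Integration.integral_cong) (auto simp: indicator_def)
    also have "\<dots> = (LINT s|spectral_dist Q \<omega>. indicator B s * s) + (LINT s|spectral_dist Q \<omega>. indicator (- B) s * s)"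
      using i B B' by simp
    also have "complex_of_real \<dots> = cinner (Q B \<omega>) a + cinner (Q (- B) \<omega>) b"
      using expectation_restrict[of B \<omega> a] expectation_restrict[of "- B" \<omega> b] p q B B' by (simp add: wB)
    finally have "cinner \<omega> (a + b) = cinner (Q B \<psi>) a + cinner (Q (- B) \<chi>') b" by (simp add: wB)
    then show ?thesis by (simp add: \<omega>_def cinner_add_left cinner_add_right add.commute)
  qed
  \<comment> \<open>Repeating the identity with i \<chi>' reverses the relative sign of the two
    terms, so each of them vanishes.\<close>
  have "Q (- B) (\<i> *\<^sub>C \<chi>') = \<i> *\<^sub>C Q (- B) \<chi>'"
    using pvm_projector[OF Q B'] by (simp add: projector_op_def clinear_op_def)
  then have "position_op (Q (- B) (\<i> *\<^sub>C \<chi>')) (\<i> *\<^sub>C b)" using position_op_scaleC[OF q] by simp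
  from cross[OF p this] have "\<i> * cinner (Q B \<psi>) b - \<i> * cinner (Q (- B) \<chi>') a = 0"
    by (simp add: \<open>Q (- B) (\<i> *\<^sub>C \<chi>') = \<i> *\<^sub>C Q (- B) \<chi>'\<close> cinner_scaleC_left cinner_scaleC_right)
  then have "cinner (Q B \<psi>) b = cinner (Q (- B) \<chi>') a" by simp
  then show ?thesis using cross[OF p q] by simp
qed

text \<open>The component of a in the range of \<open>Q (- B)\<close> is orthogonal to every vector
  of the domain, by \<open>off_diagonal\<close>; the domain is dense.\<close>

lemma range_invariant:
  assumes B: "B \<in> sets borel" and p: "position_op (Q B \<psi>) a"
  shows "Q B a = a"
proof -
  note B' = compl_borel[OF B]
  have "Q (- B) a = 0"
  proof (rule position_op_dense)
    fix \<chi>' \<phi> assume "position_op \<chi>' \<phi>"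
    then obtain b where "position_op (Q (- B) \<chi>') b" using dom_restrict[OF _ B'] by blast
    from off_diagonal[OF B p this] show "cinner \<chi>' (Q (- B) a) = 0" using B' by (simp add: Qsym)
  qed
  then show ?thesis using pvm_compl[OF Q B, of a] by simp
qed

text \<open>Split \<psi> along B and its complement. Both pieces stay in the domain and the operator
  maps each into its own spectral subspace, so the image splits accordingly.\<close>

lemma commute:
  assumes B: "B \<in> sets borel" and p: "position_op \<psi> \<phi>"
  shows "position_op (Q B \<psi>) (Q B \<phi>)"
proof -
  note B' = compl_borel[OF B]
  obtain a where a: "position_op (Q B \<psi>) a" using dom_restrict[OF p B] by blast
  obtain b where b: "position_op (Q (- B) \<psi>) b" using dom_restrict[OF p B'] by blast
  have "position_op \<psi> (a + b)"
    using position_op_add[OF a b] pvm_compl[OF Q B, of \<psi>] by simp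
  then have "\<phi> = a + b" using position_op_unique p by blast
  moreover have "Q B a = a" by (rule range_invariant[OF B a])
  moreover have "Q B b = 0"
    using range_invariant[OF B' b] Q_disjoint[OF B B', of b] by simp
  ultimately show ?thesis using a by (simp add: blinfun.add_right)
qed

text \<open>The sign \<sigma> says on which side of m the set J lies, so both sides share one
  argument. The distribution of \<psi> is carried by J, hence \<sigma> <\<psi>, (X - m) \<psi>> is
  at least \<rho> |\<psi>|^2, and Cauchy-Schwarz removes one factor |\<psi>|.\<close>

lemma lower_bound:
  assumes J: "J \<in> sets borel" and \<sigma>: "\<bar>\<sigma>\<bar> = 1" and low: "\<And>s. s \<in> J \<Longrightarrow> \<rho> \<le> \<sigma> * (s - m)"
    and p: "position_op \<psi> \<phi>" and in_J: "Q J \<psi> = \<psi>"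
  shows "\<rho> * norm \<psi> \<le> norm (\<phi> - of_real m *\<^sub>C \<psi>)"
proof (cases "norm \<psi> = 0")
  case False
  interpret finite_measure "spectral_dist Q \<psi>" by (rule finite_dist)
  have i: "integrable (spectral_dist Q \<psi>) (\<lambda>s. indicator J s * s)"
    using integrable_mult_indicator[OF _ integrable_ident[OF p], of J] J Q by simp
  have JM [measurable]: "J \<in> sets (spectral_dist Q \<psi>)" using J Q by simp
  have mJ: "measure (spectral_dist Q \<psi>) J = (norm \<psi>)\<^sup>2"
    using emeasure_spectral_dist[OF Q J, of \<psi>] by (simp add: measure_def in_J)
  have iJ: "integrable (spectral_dist Q \<psi>) (\<lambda>s. c * indicator J s)" for c :: real
    using JM by (intro integrable_mult_right integrable_real_indicator) (auto simp: emeasure_eq_measure)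
  have LJ: "(LINT s|spectral_dist Q \<psi>. c * indicator J s) = c * (norm \<psi>)\<^sup>2" for c :: real
    using JM by (simp add: mJ)
  have "\<rho> * (norm \<psi>)\<^sup>2 = (LINT s|spectral_dist Q \<psi>. \<rho> * indicator J s)" by (simp only: LJ)
  also have "\<dots> \<le> (LINT s|spectral_dist Q \<psi>. \<sigma> * (indicator J s * s - m * indicator J s))"
  proof (rule integral_mono[OF iJ])
    show "integrable (spectral_dist Q \<psi>) (\<lambda>s. \<sigma> * (indicator J s * s - m * indicator J s))"
      by (rule integrable_mult_right, rule Bochner_Integration.integrable_diff[OF i iJ])
    show "\<rho> * indicator J s \<le> \<sigma> * (indicator J s * s - m * indicator J s)" for s
      using low[of s] by (cases "s \<in> J") auto
  qed
  also have "\<dots> = \<sigma> * ((LINT s|spectral_dist Q \<psi>. indicator J s * s) - m * (norm \<psi>)\<^sup>2)"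
    using Bochner_Integration.integral_diff[OF i iJ[of m]] by (simp only: integral_mult_right_zero[where c = \<sigma>] LJ)
  also have "(LINT s|spectral_dist Q \<psi>. indicator J s * s) = Re (cinner \<psi> \<phi>)"
    using expectation_restrict[of J \<psi> \<phi>] J p by (simp add: in_J)
  also have "Re (cinner \<psi> \<phi>) - m * (norm \<psi>)\<^sup>2 = Re (cinner \<psi> (\<phi> - of_real m *\<^sub>C \<psi>))"
    by (simp add: cinner_diff_right cinner_scaleC_right cinner_self del: of_real_power)
  also have "\<sigma> * \<dots> \<le> \<bar>\<sigma>\<bar> * \<bar>Re (cinner \<psi> (\<phi> - of_real m *\<^sub>C \<psi>))\<bar>"
    by (metis abs_ge_self abs_mult)
  also have "\<dots> \<le> norm \<psi> * norm (\<phi> - of_real m *\<^sub>C \<psi>)"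
    unfolding \<sigma> using abs_Re_le_cmod cinner_cauchy_schwarz order_trans by (simp, blast)
  finally have "norm \<psi> * (\<rho> * norm \<psi>) \<le> norm \<psi> * norm (\<phi> - of_real m *\<^sub>C \<psi>)"
    by (simp add: power2_eq_square mult_ac)
  then show ?thesis by (rule mult_left_le_imp_le) (use False in simp)
qed simp

text \<open>For \<open>f\<close> supported in an interval of half-width \<open>r\<close> around \<open>m\<close>, the norms of \<open>(X - m)\<^sup>k f\<close> grow at most
  like \<open>r\<^sup>k\<close>, but on the range of \<open>Q J\<close> they grow at least like \<open>\<rho>\<^sup>k\<close>.\<close>

lemma interval_orthogonal:
  assumes J: "J \<in> sets borel" and \<sigma>: "\<bar>\<sigma>\<bar> = 1" and low: "\<And>s. s \<in> J \<Longrightarrow> \<rho> \<le> \<sigma> * (s - m)"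
    and r: "0 \<le> r" "r < \<rho>"
  shows "Q J (position_proj {m - r..m + r} \<psi>) = 0"
proof -
  obtain f where f: "sq_int f" "\<psi> = abs_L2 f" by (rule L2_cases)
  define b where "b k t = complex_of_real ((t - m) ^ k * indicator {m - r..m + r} t)" for k t
  have sq: "sq_int (\<lambda>t. b k t * f t)" and nrm: "norm (abs_L2 (\<lambda>t. b k t * f t)) \<le> r ^ k * norm \<psi>" for k
  proof -
    have bd: "cmod (b k t) \<le> r ^ k" for t
    proof (cases "t \<in> {m - r..m + r}")
      case True
      then have "\<bar>t - m\<bar> ^ k \<le> r ^ k" by (intro power_mono) auto
      then show ?thesis using True by (simp add: b_def norm_mult norm_power flip: of_real_diff)
    qed (use r in \<open>simp add: b_def\<close>)
    show sq: "sq_int (\<lambda>t. b k t * f t)"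
      by (rule sq_int_bounded_mult[OF f(1) _ bd]) (simp add: b_def[abs_def])
    have "(norm (abs_L2 (\<lambda>t. b k t * f t)))\<^sup>2 \<le> (LINT t|lborel. (r ^ k)\<^sup>2 * (cmod (f t))\<^sup>2)"
      unfolding norm_abs[OF sq]
    proof (rule integral_mono)
      show "(cmod (b k t * f t))\<^sup>2 \<le> (r ^ k)\<^sup>2 * (cmod (f t))\<^sup>2" for t
        unfolding norm_mult power_mult_distrib by (intro mult_right_mono power_mono bd) auto
    qed (use sq f in \<open>auto simp: sq_int_def\<close>)
    also have "\<dots> = (r ^ k * norm \<psi>)\<^sup>2" by (simp add: f norm_abs power_mult_distrib)
    finally show "norm (abs_L2 (\<lambda>t. b k t * f t)) \<le> r ^ k * norm \<psi>"
      by (rule power2_le_imp_le) (use r in simp)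
  qed
  define F where "F k = abs_L2 (\<lambda>t. b k t * f t)" for k
  have XF: "position_op (F k) (F (Suc k) + of_real m *\<^sub>C F k)" for k
  proof -
    have "F (Suc k) + of_real m *\<^sub>C F k = abs_L2 (\<lambda>t. of_real t * (b k t * f t))"
      using sq by (simp add: F_def scaleC_abs plus_abs sq_int_cmult) (simp add: b_def algebra_simps)
    moreover have "sq_int (\<lambda>t. of_real t * (b k t * f t))"
    proof -
      have "(\<lambda>t. of_real t * (b k t * f t)) = (\<lambda>t. b (Suc k) t * f t + of_real m * (b k t * f t))"
        by (simp add: b_def fun_eq_iff algebra_simps)
      then show ?thesis using sq by (simp add: sq_int_add sq_int_cmult)
    qed
    ultimately show ?thesis unfolding F_def using position_op_abs_iff[OF sq] by simp
  qed
  have cl: "Q J (c *\<^sub>C \<phi>) = c *\<^sub>C Q J \<phi>" for c \<phi>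
    using pvm_projector[OF Q J] by (simp add: projector_op_def clinear_op_def)
  have step: "\<rho> * norm (Q J (F k)) \<le> norm (Q J (F (Suc k)))" for k
  proof -
    have "position_op (Q J (F k)) (Q J (F (Suc k)) + of_real m *\<^sub>C Q J (F k))"
      using commute[OF J XF[of k]] by (simp add: blinfun.add_right cl)
    from lower_bound[OF J \<sigma> low this QQ[OF J]] show ?thesis by simp
  qed
  have "\<rho> ^ k * norm (Q J (F 0)) \<le> norm (Q J (F k))" for k
  proof (induction k)
    case (Suc k)
    have "\<rho> * (\<rho> ^ k * norm (Q J (F 0))) \<le> \<rho> * norm (Q J (F k))"
      using Suc r by (intro mult_left_mono) auto
    also have "\<dots> \<le> norm (Q J (F (Suc k)))" by (rule step)
    finally show ?case by (simp add: mult.assoc)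
  qed simp
  also have "norm (Q J (F k)) \<le> r ^ k * norm \<psi>" for k
  proof -
    have "(norm (Q J (F k)))\<^sup>2 \<le> (norm (F k))\<^sup>2"
      using projector_op_norm(2)[OF pvm_projector[OF Q J], of "F k"] by simp
    then have "norm (Q J (F k)) \<le> norm (F k)" by (rule power2_le_imp_le) simp
    also have "\<dots> \<le> r ^ k * norm \<psi>" unfolding F_def by (rule nrm)
    finally show ?thesis .
  qed
  finally have le: "\<rho> ^ k * norm (Q J (F 0)) \<le> r ^ k * norm \<psi>" for k .
  have "norm (Q J (F 0)) \<le> (r / \<rho>) ^ k * norm \<psi>" for k
    using le[of k] r by (simp add: power_divide field_simps)
  moreover have "(\<lambda>k. (r / \<rho>) ^ k * norm \<psi>) \<longlonglongrightarrow> 0 * norm \<psi>"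
    using r by (intro tendsto_mult LIMSEQ_power_zero tendsto_const) auto
  ultimately have "norm (Q J (F 0)) \<le> 0"
    by (intro LIMSEQ_le_const[of "\<lambda>k. (r / \<rho>) ^ k * norm \<psi>"]) auto
  moreover have "F 0 = position_proj {m - r..m + r} \<psi>"
    by (simp add: F_def b_def f position_proj_abs)
  ultimately show ?thesis by simp
qed

text \<open>The spectral parts beyond a' and below c' vanish by \<open>interval_orthogonal\<close>;
  the strict gaps supply \<rho> > r, measured from the midpoint of the inner interval.\<close>

lemma interval_contained:
  assumes "c' < c" "a < a'"
  shows "Q {c'<..<a'} (position_proj {c..a} \<psi>) = position_proj {c..a} \<psi>"
proof (cases "c \<le> a")
  case True
  define m where "m = (c + a) / 2"
  define r where "r = (a - c) / 2"
  have ca: "{c..a} = {m - r..m + r}" by (simp add: m_def r_def field_simps)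
  have r: "0 \<le> r" using True by (simp add: r_def)
  have a': "Q {a'..} (position_proj {c..a} \<psi>) = 0"
    unfolding ca by (rule interval_orthogonal[where \<sigma> = 1 and \<rho> = "a' - m", OF _ _ _ r])
      (use assms in \<open>auto simp: m_def r_def field_simps\<close>)
  have c': "Q {..c'} (position_proj {c..a} \<psi>) = 0"
    unfolding ca by (rule interval_orthogonal[where \<sigma> = "-1" and \<rho> = "m - c'", OF _ _ _ r])
      (use assms in \<open>auto simp: m_def r_def field_simps\<close>)
  define p where "p = position_proj {c..a} \<psi>"
  have "Q (- {..c'}) p = p" using pvm_compl[OF Q, of "{..c'}" p] c' by (simp add: p_def)
  moreover have "Q (- {a'..}) p = p" using pvm_compl[OF Q, of "{a'..}" p] a' by (simp add: p_def)
  moreover have "{c'<..<a'} = - {..c'} \<inter> - {a'..}" by auto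
  ultimately have "Q {c'<..<a'} p = p"
    using pvm_Int[OF Q, of "- {..c'}" "- {a'..}"] by (simp add: compl_borel)
  then show ?thesis by (simp add: p_def)
qed (simp add: position_proj_empty)

text \<open>\<open>Q {c..a}\<close> fixes functions supported in slightly smaller intervals and
  kills those supported in intervals at a positive distance. Passing to the limit covers the open
  interval and both outer rays, which is everything up to two points.\<close>

theorem interval_unique:
  assumes ca: "c < a"
  shows "Q {c..a} = position_proj {c..a}"
proof (rule blinfun_eqI)
  fix \<psi>
  define e where "e n = inverse (real (Suc n))" for n
  have e: "e n > 0" for n by (simp add: e_def)
  have e0: "eventually (\<lambda>n. e n < d) sequentially" if "d > 0" for d
    using order_tendstoD(2)[OF LIMSEQ_inverse_real_of_nat that] by (simp add: e_def)
  have n0: "eventually (\<lambda>n. d < real n) sequentially" for d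
    using filterlim_real_sequentially by (simp add: filterlim_at_top_dense)
  have limP: "(\<lambda>n. position_proj (B n) \<psi>) \<longlonglongrightarrow> position_proj C \<psi>"
    if "\<And>n. B n \<in> sets borel" "C \<in> sets borel"
      "\<And>t. eventually (\<lambda>n. t \<in> B n \<longleftrightarrow> t \<in> C) sequentially" for B C
  proof (rule position_proj_tendsto[OF that(1,2)])
    fix t
    show "(\<lambda>n. indicator (B n) t :: real) \<longlonglongrightarrow> indicator C t"
      using that(3)[of t] by (intro tendsto_eventually) (auto elim!: eventually_mono simp: indicator_def)
  qed
  note lim = bounded_linear.tendsto[OF blinfun.bounded_linear_right limP]
  have sub: "Q {c..a} p = p" if "Q {c<..<a} p = p" for p
  proof -
    have "{c<..<a} = {c..a} \<inter> {c<..<a}" by auto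
    then have "Q {c<..<a} = Q {c..a} o\<^sub>L Q {c<..<a}" using pvm_Int[OF Q, of "{c..a}" "{c<..<a}"] by simp
    then show ?thesis using that by (metis blinfun_apply_blinfun_compose)
  qed
  have mid: "Q {c..a} (position_proj {c<..<a} \<psi>) = position_proj {c<..<a} \<psi>"
  proof (rule LIMSEQ_unique)
    define B where "B n = {c + e n..a - e n}" for n
    have ev: "eventually (\<lambda>n. t \<in> B n \<longleftrightarrow> t \<in> {c<..<a}) sequentially" for t
    proof (cases "t \<in> {c<..<a}")
      case True
      have "eventually (\<lambda>n. e n < t - c) sequentially" "eventually (\<lambda>n. e n < a - t) sequentially"
        using True by (auto intro: e0)
      then show ?thesis by eventually_elim (use True in \<open>auto simp: B_def\<close>)
    next
      case False
      have "t \<notin> B n" for n using False e[of n] by (auto simp: B_def)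
      then show ?thesis using False by simp
    qed
    show "(\<lambda>n. Q {c..a} (position_proj (B n) \<psi>)) \<longlonglongrightarrow> Q {c..a} (position_proj {c<..<a} \<psi>)"
      by (rule lim[OF _ _ ev]) (auto simp: B_def)
    have "Q {c..a} (position_proj (B n) \<psi>) = position_proj (B n) \<psi>" for n
      unfolding B_def by (intro sub interval_contained) (use e[of n] in auto)
    moreover have "(\<lambda>n. position_proj (B n) \<psi>) \<longlonglongrightarrow> position_proj {c<..<a} \<psi>"
      by (rule limP[OF _ _ ev]) (auto simp: B_def)
    ultimately show "(\<lambda>n. Q {c..a} (position_proj (B n) \<psi>)) \<longlonglongrightarrow> position_proj {c<..<a} \<psi>" by simp
  qed
  have out: "Q {c..a} (position_proj {l..u} \<psi>) = 0" if "u < c \<or> a < l" for l u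
  proof -
    have "\<exists>l' u'. l' < l \<and> u < u' \<and> {c..a} \<inter> {l'<..<u'} = {}"
    proof (cases "u < c")
      case True
      then show ?thesis by (intro exI[of _ "l - 1"] exI[of _ c]) auto
    next
      case False
      then show ?thesis using that by (intro exI[of _ a] exI[of _ "u + 1"]) auto
    qed
    then obtain l' u' where lu: "l' < l" "u < u'" "{c..a} \<inter> {l'<..<u'} = {}" by blast
    show ?thesis
      using Q_disjoint[OF _ _ lu(3), of "position_proj {l..u} \<psi>"] interval_contained[OF lu(1,2)] by simp
  qed
  have left: "Q {c..a} (position_proj {..<c} \<psi>) = 0"
  proof (rule LIMSEQ_unique)
    have ev: "eventually (\<lambda>n. t \<in> {- real n..c - e n} \<longleftrightarrow> t \<in> {..<c}) sequentially" for t
    proof (cases "t < c")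
      case True
      have "eventually (\<lambda>n. e n < c - t) sequentially" using True by (auto intro: e0)
      then show ?thesis using n0[of "- t"] by eventually_elim (use True in auto)
    next
      case False
      then show ?thesis using e by (intro always_eventually allI) (smt (verit) atLeastAtMost_iff lessThan_iff)
    qed
    show "(\<lambda>n. Q {c..a} (position_proj {- real n..c - e n} \<psi>)) \<longlonglongrightarrow> Q {c..a} (position_proj {..<c} \<psi>)"
      by (rule lim[OF _ _ ev]) auto
    show "(\<lambda>n. Q {c..a} (position_proj {- real n..c - e n} \<psi>)) \<longlonglongrightarrow> 0"
      using e by (subst out) auto
  qed
  have right: "Q {c..a} (position_proj {a<..} \<psi>) = 0"
  proof (rule LIMSEQ_unique)
    have ev: "eventually (\<lambda>n. t \<in> {a + e n..real n} \<longleftrightarrow> t \<in> {a<..}) sequentially" for t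
    proof (cases "a < t")
      case True
      have "eventually (\<lambda>n. e n < t - a) sequentially" using True by (auto intro: e0)
      then show ?thesis using n0[of t] by eventually_elim (use True in auto)
    next
      case False
      then show ?thesis using e by (intro always_eventually allI) (smt (verit) atLeastAtMost_iff greaterThan_iff)
    qed
    show "(\<lambda>n. Q {c..a} (position_proj {a + e n..real n} \<psi>)) \<longlonglongrightarrow> Q {c..a} (position_proj {a<..} \<psi>)"
      by (rule lim[OF _ _ ev]) auto
    show "(\<lambda>n. Q {c..a} (position_proj {a + e n..real n} \<psi>)) \<longlonglongrightarrow> 0"
      using e by (subst out) auto
  qed
  \<comment> \<open>The strict gaps never reach the end points themselves; that these are Lebesgue
    null closes the argument.\<close>
  have boundary: "position_proj {c<..<a} \<psi> = position_proj {c..a} \<psi>"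
  proof -
    obtain f where f: "sq_int f" "\<psi> = abs_L2 f" by (rule L2_cases)
    have "AE t in lborel. t \<noteq> c" "AE t in lborel. t \<noteq> a" by (rule AE_lborel_singleton)+
    then have "AE t in lborel. complex_of_real (indicator {c<..<a} t) * f t = of_real (indicator {c..a} t) * f t"
      by eventually_elim (auto simp: indicator_def)
    then have "abs_L2 (\<lambda>t. of_real (indicator {c<..<a} t) * f t) = abs_L2 (\<lambda>t. of_real (indicator {c..a} t) * f t)"
      using f(1) by (intro abs_L2_eqI sq_int_indicator) auto
    then show ?thesis using f by (simp add: position_proj_abs)
  qed
  have "\<psi> = position_proj ({..<c} \<union> {c..a} \<union> {a<..}) \<psi>"
  proof -
    have "{..<c} \<union> {c..a} \<union> {a<..} = UNIV" by auto
    then show ?thesis by (simp add: position_proj_UNIV)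
  qed
  also have "\<dots> = position_proj {..<c} \<psi> + position_proj {c..a} \<psi> + position_proj {a<..} \<psi>"
    using ca by (subst position_proj_Un_disjoint, auto)+
  finally have "Q {c..a} \<psi> = Q {c..a} (position_proj {..<c} \<psi> + position_proj {c..a} \<psi> + position_proj {a<..} \<psi>)"
    by simp
  also have "\<dots> = position_proj {c..a} \<psi>"
    using mid by (simp add: blinfun.add_right left right boundary)
  finally show "Q {c..a} \<psi> = position_proj {c..a} \<psi>" .
qed

end

section \<open>The witness\<close>

lift_definition exp_number_op :: "real \<Rightarrow> (L2 \<Rightarrow>\<^sub>L L2)" is exp_number
  by (rule bounded_linear_exp_number)

text \<open>Stated for any operator and any angle, so that it also carries a spectral measure of the
  quadrature back to one of the position operator.\<close>

lemma spectral_measure_rotate: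
  assumes A: "spectral_measure_of A Q" and A': "\<And>\<psi> \<phi>. A' \<psi> \<phi> \<longleftrightarrow> A (exp_number \<theta> \<psi>) (exp_number \<theta> \<phi>)"
  shows "spectral_measure_of A' (\<lambda>B. exp_number_op (- \<theta>) o\<^sub>L Q B o\<^sub>L exp_number_op \<theta>)"
proof -
  define Q' where "Q' = (\<lambda>B. exp_number_op (- \<theta>) o\<^sub>L Q B o\<^sub>L exp_number_op \<theta>)"
  have Q'_apply: "Q' B \<psi> = exp_number (- \<theta>) (Q B (exp_number \<theta> \<psi>))" for B \<psi>
    by (simp add: Q'_def exp_number_op.rep_eq)
  have Q: "projection_valued_measure Q" using A by (simp add: spectral_measure_of_def)
  have dist: "spectral_dist Q' \<psi> = spectral_dist Q (exp_number \<theta> \<psi>)" for \<psi>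
    unfolding spectral_dist_def Q'_apply cinner_exp_number[of \<theta> \<psi>] ..
  have "projection_valued_measure Q'"
    unfolding projection_valued_measure_def
  proof (intro conjI ballI allI impI)
    fix B :: "real set" assume B: "B \<in> sets borel"
    note P = pvm_projector[OF Q B, unfolded projector_op_def]
    have idem: "Q B (Q B \<psi>) = Q B \<psi>" for \<psi> using P by (metis blinfun_apply_blinfun_compose)
    show "projector_op (Q' B)"
      unfolding projector_op_def
    proof (intro conjI allI)
      show "clinear_op (Q' B)" using P by (simp add: clinear_op_def Q'_apply exp_number_scaleC)
      show "Q' B o\<^sub>L Q' B = Q' B"
        by (rule blinfun_eqI) (simp add: Q'_apply exp_number_inverse' idem)
      show "cinner \<phi> (Q' B \<psi>) = cinner (Q' B \<phi>) \<psi>" for \<phi> \<psi>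
        using P by (simp add: Q'_apply cinner_exp_number cinner_exp_number[of \<theta> \<phi>, symmetric])
    qed
    fix C :: "real set" assume C: "C \<in> sets borel"
    show "Q' (B \<inter> C) = Q' B o\<^sub>L Q' C"
      by (rule blinfun_eqI) (simp add: Q'_apply exp_number_inverse' pvm_Int[OF Q B C])
  next
    show "Q' UNIV = id_blinfun"
      using Q by (intro blinfun_eqI) (simp add: Q'_apply projection_valued_measure_def exp_number_inverse)
  next
    fix B :: "nat \<Rightarrow> real set" and \<psi>
    assume "range B \<subseteq> sets borel" "disjoint_family B"
    from pvm_sums[OF Q this] show "(\<lambda>i. Q' (B i) \<psi>) sums Q' (\<Union>i. B i) \<psi>"
      unfolding Q'_apply by (rule bounded_linear.sums[OF bounded_linear_exp_number])
  qed
  moreover have "(\<exists>\<phi>. A' \<psi> \<phi>) \<longleftrightarrow> (\<exists>\<phi>. A (exp_number \<theta> \<psi>) \<phi>)" for \<psi>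
    unfolding A' by (metis exp_number_inverse')
  ultimately show ?thesis
    using A unfolding spectral_measure_of_def Q'_def[symmetric] dist A'
    by (metis cinner_exp_number exp_number_inverse)
qed

lemma quadrature_op_iff: "quadrature_op \<theta> \<psi> \<phi> \<longleftrightarrow> position_op (exp_number \<theta> \<psi>) (exp_number \<theta> \<phi>)"
  unfolding quadrature_op_def by (metis exp_number_inverse exp_number_inverse')

lemma position_op_iff_quadrature:
  "position_op \<psi> \<phi> \<longleftrightarrow> quadrature_op \<theta> (exp_number (- \<theta>) \<psi>) (exp_number (- \<theta>) \<phi>)"
  by (simp add: quadrature_op_iff exp_number_inverse')

text \<open>Rotating the position measure proves existence. A competing spectral measure is rotated
  back, where \<open>interval_unique\<close> determines its value on the window.\<close>

lemma witness_eq: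
  assumes "0 < \<eta>"
  shows "witness \<theta> x \<eta> = exp_number_op (- \<theta>) o\<^sub>L position_proj {x - \<eta>/2..x + \<eta>/2} o\<^sub>L exp_number_op \<theta>"
  unfolding witness_def spectral_projector_def
proof (rule the_equality)
  show "\<exists>Q. spectral_measure_of (quadrature_op \<theta>) Q \<and>
      exp_number_op (- \<theta>) o\<^sub>L position_proj {x - \<eta>/2..x + \<eta>/2} o\<^sub>L exp_number_op \<theta> = Q {x - \<eta>/2..x + \<eta>/2}"
    using spectral_measure_rotate[OF spectral_measure_position quadrature_op_iff] by blast
next
  fix P assume "\<exists>Q. spectral_measure_of (quadrature_op \<theta>) Q \<and> P = Q {x - \<eta>/2..x + \<eta>/2}"
  then obtain R where R: "spectral_measure_of (quadrature_op \<theta>) R" "P = R {x - \<eta>/2..x + \<eta>/2}" by blast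
  interpret position_spectral "\<lambda>B. exp_number_op (- (- \<theta>)) o\<^sub>L R B o\<^sub>L exp_number_op (- \<theta>)"
    by unfold_locales (rule spectral_measure_rotate[OF R(1) position_op_iff_quadrature])
  have eq: "exp_number_op \<theta> o\<^sub>L P o\<^sub>L exp_number_op (- \<theta>) = position_proj {x - \<eta>/2..x + \<eta>/2}"
    using interval_unique[of "x - \<eta>/2" "x + \<eta>/2"] assms R(2) by simp
  show "P = exp_number_op (- \<theta>) o\<^sub>L position_proj {x - \<eta>/2..x + \<eta>/2} o\<^sub>L exp_number_op \<theta>"
  proof (rule blinfun_eqI)
    fix \<psi>
    have "exp_number \<theta> (P \<psi>) = position_proj {x - \<eta>/2..x + \<eta>/2} (exp_number \<theta> \<psi>)"
      using arg_cong[OF eq, of "\<lambda>T. T (exp_number \<theta> \<psi>)"]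
      by (simp add: exp_number_op.rep_eq exp_number_inverse)
    then show "P \<psi> = (exp_number_op (- \<theta>) o\<^sub>L position_proj {x - \<eta>/2..x + \<eta>/2} o\<^sub>L exp_number_op \<theta>) \<psi>"
      by (simp add: exp_number_op.rep_eq) (metis exp_number_inverse)
  qed
qed

lemma witness_apply:
  "0 < \<eta> \<Longrightarrow> witness \<theta> x \<eta> \<psi> = exp_number (- \<theta>) (position_proj {x - \<eta>/2..x + \<eta>/2} (exp_number \<theta> \<psi>))"
  by (simp add: witness_eq exp_number_op.rep_eq)

lemma witness_projector:
  assumes "0 < \<eta>"
  shows "projector_op (witness \<theta> x \<eta>)"
proof -
  have "spectral_measure_of (quadrature_op \<theta>) (\<lambda>B. exp_number_op (- \<theta>) o\<^sub>L position_proj B o\<^sub>L exp_number_op \<theta>)"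
    by (rule spectral_measure_rotate[OF spectral_measure_position quadrature_op_iff])
  then show ?thesis
    unfolding witness_eq[OF assms] by (simp add: spectral_measure_of_def projection_valued_measure_def)
qed

section \<open>Zero-free stellar functions\<close>

text \<open>The unnormalised coherent vector, i.e. the evaluation functional of the stellar
  function. The conjugate compensates the antilinearity of the first slot of
  \<open>cinner\<close>.\<close>

definition coherent :: "complex \<Rightarrow> L2" where
  "coherent \<alpha> = (\<Sum>n. (cnj \<alpha> ^ n / complex_of_real (sqrt (fact n))) *\<^sub>C fock n)"

lemma coherent_coeff_sq:
  "(\<lambda>n. (cmod (cnj \<alpha> ^ n / complex_of_real (sqrt (fact n))))\<^sup>2) sums exp ((cmod \<alpha>)\<^sup>2)"
proof -
  have "(\<lambda>n. ((cmod \<alpha>)\<^sup>2) ^ n /\<^sub>R fact n) sums exp ((cmod \<alpha>)\<^sup>2)" by (rule exp_converges)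
  moreover have "((cmod \<alpha>)\<^sup>2) ^ n /\<^sub>R fact n = (cmod (cnj \<alpha> ^ n / complex_of_real (sqrt (fact n))))\<^sup>2" for n
  proof -
    have "cmod (cnj \<alpha> ^ n / complex_of_real (sqrt (fact n))) = cmod \<alpha> ^ n / sqrt (fact n)"
      by (simp add: norm_divide norm_power)
    then show ?thesis
      by (simp only: power_divide) (simp add: power_mult[symmetric] mult.commute divide_inverse)
  qed
  ultimately show ?thesis by (simp only:)
qed

lemma cinner_fock_coherent:
  "cinner (fock n) (coherent \<alpha>) = cnj \<alpha> ^ n / complex_of_real (sqrt (fact n))"
  unfolding coherent_def by (rule cinner_fock_suminf[OF sums_summable[OF coherent_coeff_sq]])

lemma norm_coherent: "norm (coherent \<alpha>) = exp ((cmod \<alpha>)\<^sup>2 / 2)"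
proof -
  have "(norm (coherent \<alpha>))\<^sup>2 = exp ((cmod \<alpha>)\<^sup>2)"
    using norm_fock_sums[of "coherent \<alpha>"] coherent_coeff_sq[of \<alpha>]
    unfolding cinner_fock_coherent by (rule sums_unique2)
  also have "\<dots> = (exp ((cmod \<alpha>)\<^sup>2 / 2))\<^sup>2" by (simp add: power2_eq_square mult_exp_exp)
  finally show ?thesis by simp
qed

lemma stellar_sums:
  "(\<lambda>n. cinner (fock n) \<psi> * \<alpha> ^ n / complex_of_real (sqrt (fact n))) sums cinner (coherent \<alpha>) \<psi>"
  using cinner_fock_sums[of "coherent \<alpha>" \<psi>] by (simp add: cinner_fock_coherent mult.commute)

lemma stellar_fun_eq: "stellar_fun \<psi> \<alpha> = cinner (coherent \<alpha>) \<psi>"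
  unfolding stellar_fun_def using stellar_sums by (rule sums_unique[symmetric])

lemma stellar_fun_bound: "cmod (stellar_fun \<psi> \<alpha>) \<le> exp ((cmod \<alpha>)\<^sup>2 / 2) * norm \<psi>"
  unfolding stellar_fun_eq norm_coherent[symmetric] by (rule cinner_cauchy_schwarz)

definition stellar_fps :: "L2 \<Rightarrow> complex fps" where
  "stellar_fps \<psi> = Abs_fps (\<lambda>n. cinner (fock n) \<psi> / complex_of_real (sqrt (fact n)))"

lemma stellar_fps_conv_radius: "fps_conv_radius (stellar_fps \<psi>) = \<infinity>"
  unfolding fps_conv_radius_def stellar_fps_def
  by (rule conv_radius_inftyI'') (use sums_summable[OF stellar_sums] in simp)

lemma eval_stellar_fps: "eval_fps (stellar_fps \<psi>) = stellar_fun \<psi>"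
  by (simp add: fun_eq_iff eval_fps_def stellar_fps_def stellar_fun_def)

lemma stellar_fun_has_fps: "stellar_fun \<psi> has_fps_expansion stellar_fps \<psi>"
  by (simp add: has_fps_expansion_def stellar_fps_conv_radius eval_stellar_fps)

lemma stellar_fun_holomorphic: "stellar_fun \<psi> holomorphic_on A"
  unfolding eval_stellar_fps[symmetric]
  by (rule holomorphic_on_eval_fps) (simp add: stellar_fps_conv_radius)

lemma stellar_fun_exp_number: "stellar_fun (exp_number \<theta> \<psi>) \<alpha> = stellar_fun \<psi> (cis \<theta> * \<alpha>)"
proof -
  have "cis (\<theta> * real n) = cis \<theta> ^ n" for n
    unfolding Complex.DeMoivre by (simp only: mult.commute)
  then have "cis (\<theta> * real n) * c * \<alpha> ^ n = c * (cis \<theta> * \<alpha>) ^ n" for n c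
    by (simp add: power_mult_distrib)
  then show ?thesis unfolding stellar_fun_def cinner_fock_exp_number by (simp only:)
qed

text \<open>Finiteness of the zero set excludes the zero function; any zero would then have positive
  order and contribute to the sum.\<close>

lemma stellar_rank_zero:
  assumes "stellar_rank \<psi> \<le> enat 0"
  shows "stellar_fun \<psi> z \<noteq> 0"
proof
  assume z: "stellar_fun \<psi> z = 0"
  define S where "S = {z. stellar_fun \<psi> z = 0}"
  have S: "finite S" and sum: "(\<Sum>z\<in>S. nat (zorder (stellar_fun \<psi>) z)) = 0"
    using assms unfolding stellar_rank_def S_def by (auto split: if_splits)
  have "S \<noteq> UNIV" using S infinite_UNIV_char_0[where 'a = complex] by auto
  then have "\<exists>w\<in>UNIV. stellar_fun \<psi> w \<noteq> 0" by (auto simp: S_def)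
  from zorder_exist_zero[OF stellar_fun_holomorphic open_UNIV connected_UNIV UNIV_I this, of z]
  have "zorder (stellar_fun \<psi>) z > 0" using z by simp
  moreover have "nat (zorder (stellar_fun \<psi>) z) = 0"
    using sum S z by (simp add: S_def)
  ultimately show False by simp
qed

text \<open>Cauchy-Schwarz alone gives only boundedness of this product. Here a finite Fock part
  contributes a polynomial times a Gaussian, and the remainder at most its small norm. The
  improvement is needed to rule out |c| = 1 for an exponential of a quadratic.\<close>

lemma stellar_fun_decay:
  assumes u: "cmod u = 1"
  shows "((\<lambda>r. cmod (stellar_fun \<psi> (of_real r * u)) * exp (- r\<^sup>2 / 2)) \<longlongrightarrow> 0) at_top"
proof (rule tendstoI)
  fix e :: real assume e: "e > 0"
  define s where "s N = (\<Sum>n<N. cinner (fock n) \<psi> *\<^sub>C fock n)" for N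
  have "s \<longlonglongrightarrow> \<psi>" using fock_sums[of \<psi>] by (simp add: s_def[abs_def] sums_def)
  then obtain N where N: "norm (s N - \<psi>) < e / 2"
    using e by (auto dest!: LIMSEQ_D[where r = "e / 2"])
  have n: "(cmod (of_real r * u))\<^sup>2 = r\<^sup>2" for r by (simp add: norm_mult u)
  define P where "P r = (\<Sum>n<N. (cmod (cinner (fock n) \<psi>) / sqrt (fact n)) * (poly (monom 1 n) r * exp (- r\<^sup>2 / 2)))" for r :: real
  have "(P \<longlongrightarrow> (\<Sum>n<N. (cmod (cinner (fock n) \<psi>) / sqrt (fact n)) * 0)) at_top"
    unfolding P_def[abs_def]
  proof (intro tendsto_sum tendsto_mult tendsto_const)
    fix n
    show "((\<lambda>r. poly (monom 1 n) r * exp (- r\<^sup>2 / 2)) \<longlongrightarrow> (0::real)) at_top"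
      using gauss_dom_tendsto_zero(1)[OF gauss_dom_mult[OF gauss_dom_poly[of "monom 1 n"] gauss_dom_exp_half]] by simp
  qed
  then have "eventually (\<lambda>r. P r < e / 2) at_top"
    using e by (intro order_tendstoD(2)[of P 0]) auto
  then show "eventually (\<lambda>r. dist (cmod (stellar_fun \<psi> (of_real r * u)) * exp (- r\<^sup>2 / 2)) 0 < e) at_top"
    using eventually_ge_at_top[of 0]
  proof eventually_elim
    case (elim r)
    have d1: "stellar_fun \<psi> (of_real r * u) = cinner (coherent (of_real r * u)) (s N) + cinner (coherent (of_real r * u)) (\<psi> - s N)"
      unfolding stellar_fun_eq by (simp add: cinner_add_right[symmetric])
    have d2: "cmod (cinner (coherent (of_real r * u)) (\<psi> - s N)) \<le> exp (r\<^sup>2 / 2) * norm (\<psi> - s N)"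
      using cinner_cauchy_schwarz[of "coherent (of_real r * u)" "\<psi> - s N"] by (simp only: norm_coherent n)
    have d3: "cmod (cinner (coherent (of_real r * u)) (s N)) \<le> (\<Sum>n<N. cmod (cinner (fock n) \<psi>) * (r ^ n / sqrt (fact n)))"
    proof -
      have "cmod (cinner (coherent \<alpha>) (fock n)) = cmod \<alpha> ^ n / sqrt (fact n)" for \<alpha> n
        by (subst cinner_commute) (simp add: cinner_fock_coherent norm_divide norm_power)
      then show ?thesis
        unfolding s_def cinner_sum_right cinner_scaleC_right
        by (intro sum_norm_le) (simp add: norm_mult u elim)
    qed
    have "cmod (stellar_fun \<psi> (of_real r * u))
        \<le> (\<Sum>n<N. cmod (cinner (fock n) \<psi>) * (r ^ n / sqrt (fact n))) + exp (r\<^sup>2 / 2) * norm (\<psi> - s N)"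
      unfolding d1 by (rule order_trans[OF norm_triangle_ineq add_mono[OF d3 d2]])
    then have "cmod (stellar_fun \<psi> (of_real r * u)) * exp (- r\<^sup>2 / 2)
        \<le> ((\<Sum>n<N. cmod (cinner (fock n) \<psi>) * (r ^ n / sqrt (fact n))) + exp (r\<^sup>2 / 2) * norm (\<psi> - s N)) * exp (- r\<^sup>2 / 2)"
      by (rule mult_right_mono) simp
    also have "\<dots> = P r + (exp (r\<^sup>2 / 2) * exp (- r\<^sup>2 / 2)) * norm (\<psi> - s N)"
      unfolding P_def distrib_right sum_distrib_right by (simp add: poly_monom mult_ac)
    also have "\<dots> = P r + norm (\<psi> - s N)" by (simp add: mult_exp_exp)
    also have "\<dots> < e" using elim N by (simp add: norm_minus_commute)
    finally show ?case by simp
  qed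
qed

text \<open>Borel--Caratheodory, by applying the Schwarz lemma to \<open>g / (2 M - g)\<close>.\<close>

lemma borel_caratheodory:
  assumes g: "g holomorphic_on UNIV" "g 0 = 0" and M: "0 < M" and R: "0 < R"
    and bound: "\<And>z. cmod z < R \<Longrightarrow> Re (g z) < M" and w: "cmod w \<le> R / 2"
  shows "cmod (g w) \<le> 2 * M"
proof -
  define h where "h z = g (of_real R * z) / (of_real (2 * M) - g (of_real R * z))" for z
  have in_R: "cmod (of_real R * z) < R" if "cmod z < 1" for z
    using that R by (simp add: norm_mult)
  have lt: "cmod (g z) < cmod (of_real (2 * M) - g z)" if "cmod z < R" for z
  proof -
    have "0 < 4 * M * (M - Re (g z))" using bound[OF that] M by simp
    then have "(cmod (g z))\<^sup>2 < (cmod (of_real (2 * M) - g z))\<^sup>2"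
      unfolding cmod_power2 by (simp add: power2_eq_square algebra_simps)
    then show ?thesis by (rule power_less_imp_less_base) simp
  qed
  have nz: "of_real (2 * M) - g z \<noteq> 0" if "cmod z < R" for z
    using lt[OF that] by auto
  have "h holomorphic_on ball 0 1"
    unfolding h_def
    by (intro holomorphic_intros holomorphic_on_compose_gen[OF _ g(1), unfolded comp_def])
      (use nz in_R in auto)
  moreover have "h 0 = 0" by (simp add: h_def g)
  moreover have "cmod (h z) < 1" if "cmod z < 1" for z
    using lt[OF in_R[OF that]] by (simp add: h_def norm_divide divide_less_eq_1)
  moreover have w1: "cmod (w / of_real R) \<le> 1 / 2" using w R by (simp add: norm_divide field_simps)
  ultimately have "cmod (h (w / of_real R)) \<le> cmod (w / of_real R)"
    by (intro Schwarz_Lemma(1)) auto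
  then have "cmod (h (w / of_real R)) \<le> 1 / 2" using w1 by linarith
  moreover have "h (w / of_real R) = g w / (of_real (2 * M) - g w)" using R by (simp add: h_def)
  ultimately have "cmod (g w) \<le> cmod (of_real (2 * M) - g w) / 2"
    using lt[of w] w R by (simp add: norm_divide divide_le_eq split: if_splits)
  also have "\<dots> \<le> (2 * M + cmod (g w)) / 2"
    using norm_triangle_ineq4[of "of_real (2 * M)" "g w"] M by (simp add: norm_mult)
  finally show ?thesis by simp
qed

lemma zero_free_stellar_exp_quadratic:
  assumes nz: "\<And>z. stellar_fun \<psi> z \<noteq> 0"
  obtains a b c where "\<And>z. stellar_fun \<psi> z = exp (a + b * z + c / 2 * z\<^sup>2)"
proof -
  have "\<psi> \<noteq> 0" using nz[of 0] by (auto simp: stellar_fun_eq)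
  then have npos: "0 < norm \<psi>" by simp
  obtain g where g: "g holomorphic_on UNIV" "\<And>z. stellar_fun \<psi> z = exp (g z)"
    using contractible_imp_holomorphic_log[OF stellar_fun_holomorphic contractible_UNIV] nz by (metis UNIV_I)
  define h where "h z = g z - g 0" for z
  \<comment> \<open>Collects the constants from the norm of \<psi> and from normalising g at 0; the
    extra 1 makes the bound strict and K positive.\<close>
  define K where "K = \<bar>ln (norm \<psi>)\<bar> + \<bar>Re (g 0)\<bar> + 1"
  have K: "K > 0" by (simp add: K_def)
  have h: "h holomorphic_on UNIV" "h 0 = 0" unfolding h_def using g by (auto intro!: holomorphic_intros)
  have re: "Re (h z) < K + (cmod z)\<^sup>2 / 2" for z
  proof -
    have "exp (Re (g z)) \<le> exp ((cmod z)\<^sup>2 / 2) * norm \<psi>"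
      using stellar_fun_bound[of \<psi> z] by (simp add: g)
    also have "\<dots> = exp ((cmod z)\<^sup>2 / 2 + ln (norm \<psi>))" using npos by (simp add: exp_add)
    finally have "Re (g z) \<le> (cmod z)\<^sup>2 / 2 + ln (norm \<psi>)" by simp
    then show ?thesis by (simp add: h_def K_def)
  qed
  \<comment> \<open>The disc of radius 2 |z| is the smallest for which z lies in the inner half;
    there the real part of h stays below K + 2 |z|^2, and |z| at least 1 absorbs K into the
    quadratic term.\<close>
  have quad: "cmod (h z) \<le> (2 * K + 4) * cmod z ^ 2" if z: "1 \<le> cmod z" for z
  proof -
    have "cmod (h z) \<le> 2 * (K + 2 * (cmod z)\<^sup>2)"
    proof (rule borel_caratheodory[OF h, where R = "2 * cmod z"])
      fix w assume "cmod w < 2 * cmod z"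
      then have "(cmod w)\<^sup>2 \<le> (2 * cmod z)\<^sup>2" by (intro power_mono) auto
      then show "Re (h w) < K + 2 * (cmod z)\<^sup>2" using re[of w] by (simp add: power_mult_distrib)
    qed (use z K in \<open>auto intro: add_pos_nonneg\<close>)
    moreover have "K * 1 \<le> K * (cmod z)\<^sup>2" using z K by (intro mult_left_mono) auto
    ultimately show ?thesis by (simp add: algebra_simps)
  qed
  have L: "h z = (\<Sum>k\<le>2. (deriv ^^ k) h 0 / fact k * z ^ k)" for z
    by (rule Liouville_polynomial[OF h(1) quad])
  have "(\<Sum>k\<le>(2::nat). f k) = f 0 + f (Suc 0) + f (Suc (Suc 0))" for f :: "nat \<Rightarrow> complex"
    by (simp add: numeral_2_eq_2)
  from L[unfolded this] have "h z = deriv h 0 * z + (deriv (deriv h) 0) / 2 * z\<^sup>2" for z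
    using h(2) by (simp add: power2_eq_square)
  then have "g z = g 0 + deriv h 0 * z + (deriv (deriv h) 0) / 2 * z\<^sup>2" for z
    using h_def[of z] by (simp only: diff_eq_eq) (simp add: add_ac)
  then show ?thesis using that[of "g 0" "deriv h 0" "deriv (deriv h) 0"] g(2) by metis
qed

text \<open>Along a direction u with c u^2 = |c| the modulus grows at least like exp (|c| r^2 / 2),
  against the decay if |c| is at least 1. Only u^2 is prescribed, so the sign of u can be chosen to
  make the linear term harmless.\<close>

lemma exp_quadratic_stellar_coeff_bound:
  assumes F: "\<And>z. stellar_fun \<psi> z = exp (a + b * z + c / 2 * z\<^sup>2)"
  shows "cmod c < 1"
proof (rule ccontr)
  assume "\<not> cmod c < 1"
  then have c: "1 \<le> cmod c" by simp
  have c0: "c \<noteq> 0" using c by (metis norm_zero not_one_le_zero)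
  define v where "v = csqrt (cnj c / of_real (cmod c))"
  have v2: "c * v\<^sup>2 = of_real (cmod c)"
  proof -
    have "v\<^sup>2 = cnj c / of_real (cmod c)" by (simp add: v_def)
    then have "c * v\<^sup>2 = of_real ((cmod c)\<^sup>2) / of_real (cmod c)"
      unfolding complex_norm_square by simp
    then show ?thesis using c0 by (simp add: power2_eq_square)
  qed
  have "cmod (v\<^sup>2) = 1" using c0 by (simp add: v_def norm_divide)
  then have v: "cmod v = 1" using norm_ge_zero[of v] by (simp add: norm_power power2_eq_1_iff)
  define u where "u = (if 0 \<le> Re (b * v) then v else - v)"
  have u: "cmod u = 1" "c * u\<^sup>2 = of_real (cmod c)" "0 \<le> Re (b * u)"
    using v v2 by (auto simp: u_def)
  have low: "exp (Re a) \<le> cmod (stellar_fun \<psi> (of_real r * u)) * exp (- r\<^sup>2 / 2)" if "0 \<le> r" for r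
  proof -
    have "a + b * (of_real r * u) + c / 2 * (of_real r * u)\<^sup>2 = a + of_real r * (b * u) + of_real (r\<^sup>2 / 2) * (c * u\<^sup>2)"
      by (simp add: power_mult_distrib algebra_simps)
    also have "Re \<dots> = Re a + r * Re (b * u) + (r\<^sup>2 / 2) * cmod c" unfolding u(2) by simp
    finally have "cmod (stellar_fun \<psi> (of_real r * u)) * exp (- r\<^sup>2 / 2)
        = exp (Re a + r * Re (b * u) + (r\<^sup>2 / 2) * cmod c - r\<^sup>2 / 2)"
      by (simp only: F norm_exp_eq_Re mult_exp_exp) (simp only: diff_conv_add_uminus minus_divide_left)
    moreover have "(r\<^sup>2 / 2) * 1 \<le> (r\<^sup>2 / 2) * cmod c" using c by (intro mult_left_mono) auto
    moreover have "0 \<le> r * Re (b * u)" using that u by simp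
    ultimately show ?thesis by simp
  qed
  have "eventually (\<lambda>r. exp (Re a) \<le> cmod (stellar_fun \<psi> (of_real r * u)) * exp (- r\<^sup>2 / 2)) at_top"
    using low by (intro eventually_at_top_linorderI[of 0])
  from tendsto_lowerbound[OF stellar_fun_decay[OF u(1)] this] show False by simp
qed

text \<open>Compares power series coefficients in F' = (b + c z) F. At n = 0 the truncated index n -
  1 does no harm, because its factor is sqrt 0.\<close>

lemma stellar_coeff_recurrence:
  assumes F: "\<And>z. stellar_fun \<psi> z = exp (a + b * z + c / 2 * z\<^sup>2)"
  shows "of_real (sqrt (real (Suc n))) * cinner (fock (Suc n)) \<psi> =
    b * cinner (fock n) \<psi> + c * of_real (sqrt (real n)) * cinner (fock (n - 1)) \<psi>"
proof -
  define S where "S = stellar_fps \<psi>"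
  have S: "stellar_fun \<psi> has_fps_expansion S" unfolding S_def by (rule stellar_fun_has_fps)
  have "deriv (stellar_fun \<psi>) = (\<lambda>z. (b + c * z) * stellar_fun \<psi> z)"
  proof
    fix z
    have "((\<lambda>z. exp (a + b * z + c / 2 * z\<^sup>2)) has_field_derivative (b + c * z) * exp (a + b * z + c / 2 * z\<^sup>2)) (at z)"
      by (auto intro!: derivative_eq_intros)
    then show "deriv (stellar_fun \<psi>) z = (b + c * z) * stellar_fun \<psi> z"
      by (simp add: F[abs_def] DERIV_imp_deriv)
  qed
  moreover have "deriv (stellar_fun \<psi>) has_fps_expansion fps_deriv S"
    by (rule has_fps_expansion_deriv[OF S])
  moreover have "(\<lambda>z. (b + c * z) * stellar_fun \<psi> z) has_fps_expansion (fps_const b + fps_const c * fps_X) * S"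
    by (intro fps_expansion_intros S)
  ultimately have eq: "fps_deriv S = (fps_const b + fps_const c * fps_X) * S"
    using fps_expansion_unique_complex by metis
  have "of_nat (Suc n) * fps_nth S (Suc n) = b * fps_nth S n + c * (if n = 0 then 0 else fps_nth S (n - 1))"
    using arg_cong[OF eq, of "\<lambda>S. fps_nth S n"] by (simp add: distrib_right mult.assoc)
  then have e: "of_nat (Suc n) * (cinner (fock (Suc n)) \<psi> / of_real (sqrt (fact (Suc n))))
    = b * (cinner (fock n) \<psi> / of_real (sqrt (fact n)))
      + c * (if n = 0 then 0 else cinner (fock (n - 1)) \<psi> / of_real (sqrt (fact (n - 1))))"
    by (simp add: S_def stellar_fps_def)
  have f1: "complex_of_real (sqrt (fact (Suc n))) = of_real (sqrt (real (Suc n))) * of_real (sqrt (fact n))"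
    by (simp add: real_sqrt_mult[symmetric] flip: of_real_mult)
  have f2: "of_nat (Suc n) = complex_of_real (sqrt (real (Suc n))) * of_real (sqrt (real (Suc n)))"
    by (simp flip: of_real_mult)
  have sn: "complex_of_real (sqrt (real (Suc n))) \<noteq> 0" "complex_of_real (sqrt (fact n)) \<noteq> 0" by auto
  have l: "of_nat (Suc n) * (x / of_real (sqrt (fact (Suc n)))) * of_real (sqrt (fact n)) = of_real (sqrt (real (Suc n))) * x"
    for x :: complex
    unfolding f1 f2 using sn by (simp add: field_simps del: of_nat_Suc)
  have r: "(if n = 0 then 0 else x / of_real (sqrt (fact (n - 1)))) * complex_of_real (sqrt (fact n)) = of_real (sqrt (real n)) * x"
    for x :: complex
  proof (cases n)
    case (Suc m)
    have "complex_of_real (sqrt (fact (Suc m))) = of_real (sqrt (real (Suc m))) * of_real (sqrt (fact m))"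
      by (simp add: real_sqrt_mult[symmetric] flip: of_real_mult)
    then show ?thesis using Suc by simp
  qed simp
  have "of_real (sqrt (real (Suc n))) * cinner (fock (Suc n)) \<psi>
     = (b * (cinner (fock n) \<psi> / of_real (sqrt (fact n)))
      + c * (if n = 0 then 0 else cinner (fock (n - 1)) \<psi> / of_real (sqrt (fact (n - 1))))) * of_real (sqrt (fact n))"
    unfolding e[symmetric] l ..
  also have "\<dots> = b * cinner (fock n) \<psi> + c * of_real (sqrt (real n)) * cinner (fock (n - 1)) \<psi>"
    unfolding distrib_right mult.assoc r using sn by simp
  finally show ?thesis .
qed

section \<open>Gaussian wave functions\<close>

definition gauss_fn :: "complex \<Rightarrow> complex \<Rightarrow> real \<Rightarrow> complex" where
  "gauss_fn A B t = exp (- (A / 2) * (of_real t)\<^sup>2 + B * of_real t)"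

lemma gauss_fn_continuous: "continuous_on S (gauss_fn A B)"
  unfolding gauss_fn_def by (intro continuous_intros)

lemma gauss_fn_measurable [measurable]: "gauss_fn A B \<in> borel_measurable borel"
  by (intro borel_measurable_continuous_onI gauss_fn_continuous)

lemma gauss_dom_gauss_fn: "gauss_dom (Re A / 2) (gauss_fn A B)"
proof (rule gauss_domI[where C = 1 and k = "\<bar>Re B\<bar>"])
  fix t
  have "Re B * t \<le> \<bar>Re B\<bar> * \<bar>t\<bar>" by (metis abs_ge_self abs_mult)
  moreover have "Re (- (A / 2) * (of_real t)\<^sup>2 + B * of_real t) = Re B * t - Re A / 2 * t\<^sup>2"
    by (simp add: power2_eq_square)
  ultimately show "norm (gauss_fn A B t) \<le> 1 * exp (\<bar>Re B\<bar> * \<bar>t\<bar> - Re A / 2 * t\<^sup>2)"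
    unfolding gauss_fn_def norm_exp_eq_Re by simp
qed

lemma sq_int_gauss_fn: "0 < Re A \<Longrightarrow> sq_int (gauss_fn A B)"
  by (rule gauss_dom_sq_int[OF gauss_dom_gauss_fn]) auto

lemma gauss_fn_derivative:
  "(gauss_fn A B has_vector_derivative (B - A * of_real t) * gauss_fn A B t) (at t)"
  unfolding gauss_fn_def
  by (rule has_vector_derivative_real_field) (auto intro!: derivative_eq_intros simp: algebra_simps)

definition gauss_moment :: "complex \<Rightarrow> complex \<Rightarrow> real poly \<Rightarrow> complex" where
  "gauss_moment A B p = (CLINT t|lborel. of_real (poly p t) * gauss_fn A B t)"

lemma gauss_dom_poly_gauss_fn: "gauss_dom (Re A / 2) (\<lambda>t. of_real (poly p t) * gauss_fn A B t)"
  using gauss_dom_mult[OF _ gauss_dom_gauss_fn, of 0 "\<lambda>t. of_real (poly p t)"] gauss_dom_poly[of p]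
  by (simp add: gauss_dom_of_real)

lemma integrable_poly_gauss_fn:
  "0 < Re A \<Longrightarrow> integrable lborel (\<lambda>t. of_real (poly p t) * gauss_fn A B t)"
  by (rule gauss_dom_integrable[OF gauss_dom_poly_gauss_fn])
    (auto intro!: borel_measurable_continuous_onI continuous_intros gauss_fn_continuous)

lemma gauss_moment_add:
  "0 < Re A \<Longrightarrow> gauss_moment A B (p + q) = gauss_moment A B p + gauss_moment A B q"
  using integrable_poly_gauss_fn[of A p B] integrable_poly_gauss_fn[of A q B]
  by (simp add: gauss_moment_def distrib_right)

lemma gauss_moment_smult: "gauss_moment A B (smult k p) = of_real k * gauss_moment A B p"
  by (simp add: gauss_moment_def mult.assoc)

lemma gauss_moment_parts:
  assumes A: "0 < Re A"
  shows "gauss_moment A B (pderiv p) = A * gauss_moment A B ([:0, 1:] * p) - B * gauss_moment A B p"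
proof -
  define f where "f t = of_real (poly (pderiv p) t) * gauss_fn A B t
    + (B * (of_real (poly p t) * gauss_fn A B t) - A * (of_real (poly ([:0, 1:] * p) t) * gauss_fn A B t))" for t
  have "(LINT t|lborel. f t) = 0"
  proof (rule integral_derivative_zero)
    show "gauss_dom (Re A / 2) (\<lambda>t. of_real (poly p t) * gauss_fn A B t)" by (rule gauss_dom_poly_gauss_fn)
    show "gauss_dom (Re A / 2) f"
      unfolding f_def[abs_def]
      by (intro gauss_dom_add gauss_dom_diff gauss_dom_cmult gauss_dom_poly_gauss_fn)
    show "continuous_on UNIV f"
      unfolding f_def[abs_def] by (intro continuous_intros gauss_fn_continuous)
    show "((\<lambda>t. of_real (poly p t) * gauss_fn A B t) has_vector_derivative f t) (at t)" for t
    proof -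
      have "(poly p has_vector_derivative poly (pderiv p) t) (at t)"
        using poly_DERIV[of p t] by (simp add: has_real_derivative_iff_has_vector_derivative)
      from has_vector_derivative_mult[OF bounded_linear.has_vector_derivative[OF bounded_linear_of_real this] gauss_fn_derivative]
      show ?thesis by (rule has_vector_derivative_eq_rhs) (simp add: f_def algebra_simps)
    qed
  qed (use A in simp)
  moreover have "(LINT t|lborel. f t) = gauss_moment A B (pderiv p)
     + (B * gauss_moment A B p - A * gauss_moment A B ([:0, 1:] * p))"
    unfolding f_def gauss_moment_def
    using integrable_poly_gauss_fn[OF A]
    by (simp only: Bochner_Integration.integral_add Bochner_Integration.integral_diff
        Bochner_Integration.integrable_diff integrable_mult_right integral_mult_right_zero)
  ultimately show ?thesis by (simp add: algebra_simps eq_neg_iff_add_eq_0 add_eq_0_iff)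
qed

lemma cinner_fock_gauss_fn:
  "0 < Re A \<Longrightarrow> cinner (fock n) (abs_L2 (gauss_fn A B)) = gauss_moment (1 + A) B (fock_poly n)"
  unfolding gauss_moment_def
  by (subst cinner_fock_abs[OF sq_int_gauss_fn])
    (auto intro!: Bochner_Integration.integral_cong
      simp: fock_fn_def gauss_fn_def mult_exp_exp exp_of_real[symmetric] mult.assoc algebra_simps add_divide_distrib)

text \<open>The Hermite recurrence and integration by parts are two relations containing the moment
  of t q; eliminating it gives the claim. The vacuum factor shifts A to 1 + A, and c is the Cayley
  transform that matches Re A > 0 with |c| < 1.\<close>

lemma gauss_fn_coeff_recurrence:
  assumes A: "0 < Re A" and c: "c = (1 - A) / (1 + A)" and b: "b = (1 + c) * B / of_real (sqrt 2)"
  defines "\<phi> \<equiv> abs_L2 (gauss_fn A B)"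
  shows "of_real (sqrt (real (Suc n))) * cinner (fock (Suc n)) \<phi> =
    b * cinner (fock n) \<phi> + c * of_real (sqrt (real n)) * cinner (fock (n - 1)) \<phi>"
proof -
  define L where "L = gauss_moment (1 + A) B"
  have A1: "0 < Re (1 + A)" using A by simp
  have nz: "1 + A \<noteq> 0" using A1 by (metis less_irrefl zero_complex.sel(1))
  have ip: "cinner (fock k) \<phi> = L (fock_poly k)" for k
    unfolding \<phi>_def L_def by (rule cinner_fock_gauss_fn[OF A])
  define q where "q = fock_poly n"
  define s where "s = complex_of_real (sqrt 2)"
  define r where "r k = complex_of_real (sqrt (real k))" for k
  have s: "s * s = 2" "s \<noteq> 0" by (simp_all add: s_def flip: of_real_mult)
  have "smult (sqrt 2 * sqrt (real n + 1)) (fock_poly (Suc n)) + pderiv q = smult 2 ([:0, 1:] * q)"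
  proof -
    have "sqrt 2 * sqrt (real n + 1) > 0" by simp
    then show ?thesis by (simp add: q_def)
  qed
  then have "L (smult (sqrt 2 * sqrt (real n + 1)) (fock_poly (Suc n)) + pderiv q) = L (smult 2 ([:0, 1:] * q))"
    by (rule arg_cong)
  then have e1: "s * r (Suc n) * L (fock_poly (Suc n)) + L (pderiv q) = 2 * L ([:0, 1:] * q)"
    unfolding L_def gauss_moment_add[OF A1] gauss_moment_smult by (simp add: s_def r_def add.commute)
  have e2: "L (pderiv q) = (1 + A) * L ([:0, 1:] * q) - B * L q"
    unfolding L_def by (rule gauss_moment_parts[OF A1])
  have e3: "L (pderiv q) = s * r n * L (fock_poly (n - 1))"
  proof (cases n)
    case 0
    have "gauss_moment (1 + A) B 0 = 0" by (simp add: gauss_moment_def)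
    then show ?thesis by (simp add: q_def 0 r_def L_def)
  next
    case (Suc m)
    then show ?thesis
      by (simp only: q_def pderiv_fock_poly L_def gauss_moment_smult s_def r_def real_sqrt_mult of_real_mult
          diff_Suc_1 of_nat_Suc) (simp only: add.commute)
  qed
  have sb: "s * b = (1 + c) * B" using s by (simp add: b s_def[symmetric])
  have c1: "1 + c = 2 / (1 + A)" using nz by (simp add: c field_simps)
  have "L ([:0, 1:] * q) = (L (pderiv q) + B * L q) / (1 + A)" using e2 nz by (simp add: field_simps)
  then have "s * r (Suc n) * L (fock_poly (Suc n)) = 2 * ((L (pderiv q) + B * L q) / (1 + A)) - L (pderiv q)"
    using e1 by (simp add: eq_diff_eq)
  also have "\<dots> = (1 + c) * (L (pderiv q) + B * L q) - L (pderiv q)" unfolding c1 by simp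
  also have "\<dots> = c * L (pderiv q) + (1 + c) * B * L q" by (simp add: algebra_simps)
  also have "\<dots> = s * (c * r n * L (fock_poly (n - 1)) + b * L q)"
    unfolding e3 sb[symmetric] by (simp add: algebra_simps)
  finally have "s * (r (Suc n) * L (fock_poly (Suc n))) = s * (c * r n * L (fock_poly (n - 1)) + b * L q)"
    by (simp add: mult.assoc)
  then have "r (Suc n) * L (fock_poly (Suc n)) = c * r n * L (fock_poly (n - 1)) + b * L q"
    using s by simp
  then show ?thesis unfolding ip by (simp add: q_def r_def add.commute)
qed

text \<open>A and B are found by inverting the Cayley transform. The recurrence determines all
  coefficients from the zeroth, so the two sequences are proportional; cross-multiplying by the
  zeroth coefficients k and l avoids dividing by k.\<close>

lemma zero_free_stellar_gaussian:
  assumes nz: "\<And>z. stellar_fun \<psi> z \<noteq> 0"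
  obtains A B k l where "0 < Re A" "l \<noteq> 0" "k *\<^sub>C \<psi> = l *\<^sub>C abs_L2 (gauss_fn A B)"
proof -
  obtain a b c where F: "\<And>z. stellar_fun \<psi> z = exp (a + b * z + c / 2 * z\<^sup>2)"
    using zero_free_stellar_exp_quadratic[OF nz] by blast
  have c: "cmod c < 1" by (rule exp_quadratic_stellar_coeff_bound[OF F])
  have c1: "1 + c \<noteq> 0"
  proof
    assume "1 + c = 0"
    then have "c = -1" by (simp add: eq_neg_iff_add_eq_0 add.commute)
    then show False using c by simp
  qed
  define A where "A = (1 - c) / (1 + c)"
  define B where "B = of_real (sqrt 2) * b / (1 + c)"
  have "A = ((1 - c) * cnj (1 + c)) / of_real ((cmod (1 + c))\<^sup>2)"
    unfolding complex_norm_square A_def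
    by (rule nonzero_mult_divide_mult_cancel_right[symmetric]) (simp only: complex_cnj_zero_iff c1 not_False_eq_True)
  then have "Re A = Re ((1 - c) * cnj (1 + c)) / (cmod (1 + c))\<^sup>2"
    by (simp only: Re_divide_of_real)
  also have "Re ((1 - c) * cnj (1 + c)) = 1 - (cmod c)\<^sup>2"
    unfolding cmod_power2 by (simp add: power2_eq_square algebra_simps)
  finally have "Re A = (1 - (cmod c)\<^sup>2) / (cmod (1 + c))\<^sup>2" .
  then have A: "0 < Re A" using c c1 by (simp add: power_less_one_iff abs_square_less_1)
  have A1: "1 + A = 2 / (1 + c)" using c1 by (simp add: A_def field_simps)
  have A2: "1 - A = 2 * c / (1 + c)" using c1 by (simp add: A_def field_simps)
  have cA: "c = (1 - A) / (1 + A)"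
    unfolding A1 A2 using c1 by simp
  have bB: "b = (1 + c) * B / of_real (sqrt 2)"
    using c1 by (simp add: B_def)
  define \<phi> where "\<phi> = abs_L2 (gauss_fn A B)"
  note rec\<psi> = stellar_coeff_recurrence[OF F]
  note rec\<phi> = gauss_fn_coeff_recurrence[OF A cA bB, folded \<phi>_def]
  define k where "k = cinner (fock 0) \<phi>"
  define l where "l = cinner (fock 0) \<psi>"
  \<comment> \<open>Strong induction, as the recurrence reaches back two indices; for n = 1 the
    truncated index is 0, which the hypothesis also covers.\<close>
  have eq: "k * cinner (fock n) \<psi> = l * cinner (fock n) \<phi>" for n
  proof (induction n rule: less_induct)
    case (less n)
    show ?case
    proof (cases n)
      case 0
      then show ?thesis by (simp add: k_def l_def)
    next
      case (Suc m)
      have "of_real (sqrt (real n)) * (k * cinner (fock n) \<psi>)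
          = k * (b * cinner (fock m) \<psi> + c * of_real (sqrt (real m)) * cinner (fock (m - 1)) \<psi>)"
        unfolding rec\<psi>[symmetric] Suc by (simp add: mult_ac)
      also have "\<dots> = b * (k * cinner (fock m) \<psi>) + c * of_real (sqrt (real m)) * (k * cinner (fock (m - 1)) \<psi>)"
        by (simp add: algebra_simps)
      also have "\<dots> = b * (l * cinner (fock m) \<phi>) + c * of_real (sqrt (real m)) * (l * cinner (fock (m - 1)) \<phi>)"
        using less[of m] less[of "m - 1"] Suc by simp
      also have "\<dots> = l * (b * cinner (fock m) \<phi> + c * of_real (sqrt (real m)) * cinner (fock (m - 1)) \<phi>)"
        by (simp add: algebra_simps)
      also have "\<dots> = of_real (sqrt (real n)) * (l * cinner (fock n) \<phi>)"
        unfolding rec\<phi>[symmetric] Suc by (simp add: mult_ac)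
      finally show ?thesis using Suc by simp
    qed
  qed
  have "k *\<^sub>C \<psi> = l *\<^sub>C \<phi>"
    by (rule fock_ext) (simp add: cinner_scaleC_right eq)
  moreover have "l \<noteq> 0"
  proof -
    have "stellar_fun \<psi> 0 = (\<Sum>n. if n = 0 then l else 0)"
      unfolding stellar_fun_def l_def by (intro suminf_cong) auto
    also have "\<dots> = l" using sums_unique[OF sums_single[of 0 "\<lambda>n. l"]] by simp
    finally show ?thesis using nz by metis
  qed
  ultimately show ?thesis using that[OF A] unfolding \<phi>_def by blast
qed

lemma zero_free_position_proj_nonzero:
  assumes nz: "\<And>z. stellar_fun \<psi> z \<noteq> 0" and lu: "l < u"
  shows "position_proj {l..u} \<psi> \<noteq> 0"
proof
  assume P: "position_proj {l..u} \<psi> = 0"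
  obtain A B k m where A: "0 < Re A" and m: "m \<noteq> 0" and eq: "k *\<^sub>C \<psi> = m *\<^sub>C abs_L2 (gauss_fn A B)"
    by (rule zero_free_stellar_gaussian[OF nz])
  note g = sq_int_gauss_fn[OF A, of B]
  have cl: "clinear_op (position_proj {l..u})" by (rule position_proj_clinear) simp
  have "m *\<^sub>C position_proj {l..u} (abs_L2 (gauss_fn A B)) = position_proj {l..u} (k *\<^sub>C \<psi>)"
    by (simp add: eq clinear_opD[OF cl])
  also have "\<dots> = 0" by (simp add: clinear_opD[OF cl] P)
  finally have "norm (m *\<^sub>C position_proj {l..u} (abs_L2 (gauss_fn A B))) = 0" by simp
  then have "position_proj {l..u} (abs_L2 (gauss_fn A B)) = 0" using m by (simp add: norm_scaleC)
  then have "abs_L2 (\<lambda>t. of_real (indicator {l..u} t) * gauss_fn A B t) = abs_L2 (\<lambda>t. 0)"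
    using g by (simp add: position_proj_abs zero_L2_def)
  then have "AE t in lborel. of_real (indicator {l..u} t) * gauss_fn A B t = 0"
    using abs_L2_eq_iff[OF sq_int_indicator[OF _ g] sq_int_zero] by simp
  then have "AE t in lborel. t \<notin> {l..u}"
    by eventually_elim (auto simp: gauss_fn_def indicator_def split: if_splits)
  then have "emeasure lborel {l..u} = 0"
    by (subst (asm) AE_iff_measurable[of "{l..u}"]) auto
  then show False using lu by simp
qed

section \<open>Compactness of energy-bounded sets\<close>

definition fock_trunc :: "nat \<Rightarrow> L2 \<Rightarrow> L2" where
  "fock_trunc K \<psi> = (\<Sum>n<K. cinner (fock n) \<psi> *\<^sub>C fock n)"

lemma cinner_fock_trunc: "cinner (fock m) (fock_trunc K \<psi>) = (if m < K then cinner (fock m) \<psi> else 0)"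
  by (simp add: fock_trunc_def cinner_sum_right cinner_scaleC_right if_distrib[of "(*) z" for z] cong: if_cong)

text \<open>Markov's inequality for the photon number: on the components with n at least K, the
  weight n is at least K.\<close>

lemma energy_tail:
  assumes "energy \<psi> \<le> ennreal E" "0 \<le> E"
  shows "real K * (norm (\<psi> - fock_trunc K \<psi>))\<^sup>2 \<le> E"
proof -
  have "ennreal (real K * (norm (\<psi> - fock_trunc K \<psi>))\<^sup>2)
      = ennreal (real K) * (\<Sum>n. ennreal ((cmod (cinner (fock n) (\<psi> - fock_trunc K \<psi>)))\<^sup>2))"
    unfolding suminf_norm_fock by (rule ennreal_mult) auto
  also have "\<dots> = (\<Sum>n. ennreal (real K) * ennreal ((cmod (cinner (fock n) (\<psi> - fock_trunc K \<psi>)))\<^sup>2))"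
    by (rule ennreal_suminf_cmult[symmetric])
  also have "\<dots> \<le> energy \<psi>"
    unfolding energy_def
  proof (intro suminf_le)
    fix n
    show "ennreal (real K) * ennreal ((cmod (cinner (fock n) (\<psi> - fock_trunc K \<psi>)))\<^sup>2)
        \<le> ennreal (real n * (cmod (cinner (fock n) \<psi>))\<^sup>2)"
      by (cases "n < K") (auto simp: cinner_diff_right cinner_fock_trunc ennreal_mult[symmetric] intro!: ennreal_leI mult_right_mono)
  qed auto
  also have "\<dots> \<le> ennreal E" by (rule assms)
  finally show ?thesis using assms(2) by simp
qed

text \<open>A diagonal subsequence makes all Fock coefficients converge, and the uniformly small
  tails upgrade this to convergence in norm.\<close>

lemma energy_bounded_convergent_subseq:
  fixes \<psi> :: "nat \<Rightarrow> L2"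
  assumes n1: "\<And>k. norm (\<psi> k) = 1" and en: "\<And>k. energy (\<psi> k) \<le> ennreal E" and E: "0 \<le> E"
  obtains r \<phi> where "strict_mono r" "(\<lambda>k. \<psi> (r k)) \<longlonglongrightarrow> \<phi>"
proof -
  have "\<exists>r. strict_mono r \<and> (\<forall>n. \<exists>l. (\<lambda>k. cinner (fock n) (\<psi> (r k))) \<longlonglongrightarrow> l)"
  proof (rule function_convergent_subsequence[of "UNIV :: nat set" "\<lambda>k n. cinner (fock n) (\<psi> k)" 1])
    show "norm (cinner (fock n) (\<psi> k)) \<le> 1" for k n
      using cinner_cauchy_schwarz[of "fock n" "\<psi> k"] by (simp add: n1)
  qed auto
  then obtain r where r: "strict_mono r" and lim: "\<forall>n. \<exists>l. (\<lambda>k. cinner (fock n) (\<psi> (r k))) \<longlonglongrightarrow> l"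
    by blast
  have "Cauchy (\<lambda>k. \<psi> (r k))"
    unfolding Cauchy_def
  proof (intro allI impI)
    fix e :: real assume e: "0 < e"
    \<comment> \<open>Chosen so that E / K < (e / 4)^2; two tails and one difference of truncations,
      each below e / 4, then stay below e.\<close>
    obtain K :: nat where K: "E * 16 / e\<^sup>2 < real K" using reals_Archimedean2 by blast
    have Kpos: "0 < real K" using K E e by (meson divide_nonneg_pos le_less_trans mult_nonneg_nonneg zero_le_numeral zero_less_power)
    have tail: "norm (\<psi> k - fock_trunc K (\<psi> k)) < e / 4" for k
    proof -
      have "real K * (norm (\<psi> k - fock_trunc K (\<psi> k)))\<^sup>2 \<le> E" by (rule energy_tail[OF en E])
      also have "E < real K * (e / 4)\<^sup>2" using K e by (simp add: field_simps power2_eq_square)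
      finally have "(norm (\<psi> k - fock_trunc K (\<psi> k)))\<^sup>2 < (e / 4)\<^sup>2" using Kpos by simp
      then show ?thesis by (rule power_less_imp_less_base) (use e in simp)
    qed
    from lim obtain l where l: "\<And>n. (\<lambda>k. cinner (fock n) (\<psi> (r k))) \<longlonglongrightarrow> l n" by metis
    have "(\<lambda>k. fock_trunc K (\<psi> (r k))) \<longlonglongrightarrow> (\<Sum>n<K. l n *\<^sub>C fock n)"
      unfolding fock_trunc_def by (intro tendsto_intros l)
    then have "Cauchy (\<lambda>k. fock_trunc K (\<psi> (r k)))" by (rule LIMSEQ_imp_Cauchy)
    then obtain M where M: "\<And>i j. i \<ge> M \<Longrightarrow> j \<ge> M \<Longrightarrow> dist (fock_trunc K (\<psi> (r i))) (fock_trunc K (\<psi> (r j))) < e / 4"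
      using e unfolding Cauchy_def by (metis zero_less_divide_iff zero_less_numeral)
    have "dist (\<psi> (r i)) (\<psi> (r j)) < e" if "i \<ge> M" "j \<ge> M" for i j
    proof -
      have "dist (\<psi> (r i)) (\<psi> (r j)) \<le> dist (\<psi> (r i)) (fock_trunc K (\<psi> (r i)))
          + dist (fock_trunc K (\<psi> (r i))) (fock_trunc K (\<psi> (r j))) + dist (\<psi> (r j)) (fock_trunc K (\<psi> (r j)))"
        by (metis add.assoc add_left_mono dist_commute dist_triangle dist_triangle_le)
      then show ?thesis
        using M[OF that] tail[of "r i"] tail[of "r j"] e by (simp add: dist_norm[of "\<psi> (r i)" "fock_trunc K (\<psi> (r i))"]
            dist_norm[of "\<psi> (r j)" "fock_trunc K (\<psi> (r j))"])
    qed
    then show "\<exists>M. \<forall>m\<ge>M. \<forall>n\<ge>M. dist (\<psi> (r m)) (\<psi> (r n)) < e" by blast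
  qed
  then obtain \<phi> where "(\<lambda>k. \<psi> (r k)) \<longlonglongrightarrow> \<phi>" using Cauchy_convergent convergent_def by blast
  then show ?thesis using that r by blast
qed

section \<open>Zero-freeness in the limit\<close>

lemma stellar_fun_zero_imp: "(\<And>z. stellar_fun \<psi> z = 0) \<Longrightarrow> \<psi> = 0"
proof (rule fock_total)
  fix n
  assume "\<And>z. stellar_fun \<psi> z = 0"
  then have "stellar_fun \<psi> = (\<lambda>z. 0)" by auto
  then have "(\<lambda>z. 0) has_fps_expansion stellar_fps \<psi>" using stellar_fun_has_fps[of \<psi>] by simp
  moreover have "(\<lambda>z::complex. 0) has_fps_expansion 0" using has_fps_expansion_const[of 0] by simp
  ultimately have "stellar_fps \<psi> = 0" by (rule fps_expansion_unique_complex)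
  then have "fps_nth (stellar_fps \<psi>) n = 0" by simp
  then show "cinner (fock n) \<psi> = 0" by (simp add: stellar_fps_def)
qed

text \<open>The norms of coherent vectors are bounded on compact sets, so norm convergence gives
  locally uniform convergence, as Hurwitz requires. His theorem excludes constant limits; a constant
  limit is nonzero because the stellar function determines its vector.\<close>

lemma zero_free_limit:
  assumes lim: "\<psi> \<longlonglongrightarrow> \<phi>" and "\<phi> \<noteq> 0" and nz: "\<And>k z. stellar_fun (\<psi> k) z \<noteq> 0"
  shows "stellar_fun \<phi> z \<noteq> 0"
proof (cases "stellar_fun \<phi> constant_on UNIV")
  case True
  then obtain c where c: "\<And>z. stellar_fun \<phi> z = c" by (auto simp: constant_on_def)
  then show ?thesis using stellar_fun_zero_imp[of \<phi>] assms(2) by metis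
next
  case False
  show ?thesis
  proof (rule Hurwitz_no_zeros[of UNIV "\<lambda>k. stellar_fun (\<psi> k)" "stellar_fun \<phi>" z])
    fix K :: "complex set" assume K: "compact K"
    obtain R where R: "\<And>z. z \<in> K \<Longrightarrow> cmod z \<le> R"
      using compact_imp_bounded[OF K] by (auto simp: bounded_iff)
    show "uniform_limit K (\<lambda>k. stellar_fun (\<psi> k)) (stellar_fun \<phi>) sequentially"
    proof (rule uniform_limitI)
      fix e :: real assume e: "0 < e"
      then have e': "0 < e / exp (R\<^sup>2 / 2)" by simp
      have "eventually (\<lambda>k. dist (\<psi> k) \<phi> < e / exp (R\<^sup>2 / 2)) sequentially"
        using lim e' by (rule tendstoD)
      then show "eventually (\<lambda>k. \<forall>z\<in>K. dist (stellar_fun (\<psi> k) z) (stellar_fun \<phi> z) < e) sequentially"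
      proof eventually_elim
        case (elim k)
        show ?case
        proof
          fix z assume z: "z \<in> K"
          have "dist (stellar_fun (\<psi> k) z) (stellar_fun \<phi> z) = cmod (cinner (coherent z) (\<psi> k - \<phi>))"
            by (simp add: stellar_fun_eq dist_norm cinner_diff_right)
          also have "\<dots> \<le> exp ((cmod z)\<^sup>2 / 2) * norm (\<psi> k - \<phi>)"
            unfolding norm_coherent[symmetric] by (rule cinner_cauchy_schwarz)
          also have "\<dots> \<le> exp (R\<^sup>2 / 2) * norm (\<psi> k - \<phi>)"
            using R[OF z] by (intro mult_right_mono) (auto intro!: power_mono)
          also have "\<dots> < e" using elim by (simp add: dist_norm field_simps)
          finally show "dist (stellar_fun (\<psi> k) z) (stellar_fun \<phi> z) < e" .
        qed
      qed
    qed
  qed (use False nz in \<open>auto intro: stellar_fun_holomorphic\<close>)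
qed

text \<open>A bound on finitely many Fock components is what survives the limit to the closed convex hull,
  since it only needs convergence in operator norm.\<close>

lemma uniform_witness_bound:
  assumes \<eta>: "0 < \<eta>" and E: "0 \<le> E"
  shows "\<exists>N. \<exists>c>0. \<forall>\<psi>. norm \<psi> = 1 \<longrightarrow> energy \<psi> \<le> ennreal E \<longrightarrow> stellar_rank \<psi> \<le> enat 0 \<longrightarrow>
       c \<le> (\<Sum>n<N. (cmod (cinner (fock n) (witness \<theta> x \<eta> \<psi>)))\<^sup>2)" (is ?thesis)
proof (rule ccontr)
  define W where "W = witness \<theta> x \<eta>"
  define h where "h N \<psi> = (\<Sum>n<N. (cmod (cinner (fock n) (W \<psi>)))\<^sup>2)" for N \<psi>
  \<comment> \<open>The k-th counterexample uses k for the number of components and for the bound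
    alike, so every fixed number of components is eventually covered by bounds that tend to
    0.\<close>
  define e where "e k = inverse (real (Suc k))" for k
  assume neg: "\<not> ?thesis"
  have "\<exists>\<psi>. norm \<psi> = 1 \<and> energy \<psi> \<le> ennreal E \<and> stellar_rank \<psi> \<le> enat 0 \<and> h k \<psi> < e k" for k
  proof -
    have "0 < e k" by (simp add: e_def)
    then show ?thesis using neg unfolding h_def W_def by (meson not_le)
  qed
  then obtain \<psi> where \<psi>: "\<And>k. norm (\<psi> k) = 1" "\<And>k. energy (\<psi> k) \<le> ennreal E"
    "\<And>k. stellar_rank (\<psi> k) \<le> enat 0" "\<And>k. h k (\<psi> k) < e k"
    by metis
  obtain r \<phi> where r: "strict_mono r" and lim: "(\<lambda>k. \<psi> (r k)) \<longlonglongrightarrow> \<phi>"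
    by (rule energy_bounded_convergent_subseq[OF \<psi>(1,2) E])
  have "(\<lambda>k. norm (\<psi> (r k))) \<longlonglongrightarrow> norm \<phi>" by (intro tendsto_norm lim)
  then have "norm \<phi> = 1" by (simp add: \<psi>(1) LIMSEQ_const_iff)
  then have "\<phi> \<noteq> 0" by auto
  have nz: "stellar_fun \<phi> z \<noteq> 0" for z
    by (rule zero_free_limit[OF lim \<open>\<phi> \<noteq> 0\<close>]) (rule stellar_rank_zero[OF \<psi>(3)])
  have "h M \<phi> \<le> 0" for M
  proof (rule LIMSEQ_le)
    show "(\<lambda>k. h M (\<psi> (r k))) \<longlonglongrightarrow> h M \<phi>"
      unfolding h_def by (intro tendsto_intros lim)
    show "e \<longlonglongrightarrow> 0" unfolding e_def by (rule LIMSEQ_inverse_real_of_nat)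
    have "h M (\<psi> (r k)) \<le> e k" if "k \<ge> M" for k
    proof -
      have rk: "k \<le> r k" by (rule strict_mono_imp_increasing[OF r])
      have "h M (\<psi> (r k)) \<le> h (r k) (\<psi> (r k))"
        unfolding h_def using that rk by (intro sum_mono2) auto
      also have "\<dots> \<le> e (r k)" using \<psi>(4)[of "r k"] by simp
      also have "\<dots> \<le> e k" using rk by (simp add: e_def)
      finally show ?thesis .
    qed
    then show "\<exists>N. \<forall>k\<ge>N. h M (\<psi> (r k)) \<le> e k" by blast
  qed
  then have hz: "h M \<phi> = 0" for M
    by (intro antisym) (auto simp: h_def sum_nonneg)
  have "W \<phi> = 0"
  proof (rule fock_total)
    fix n show "cinner (fock n) (W \<phi>) = 0"
      using hz[of "Suc n"] by (simp add: h_def add_nonneg_eq_0_iff sum_nonneg)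
  qed
  then have "exp_number (- \<theta>) (position_proj {x - \<eta>/2..x + \<eta>/2} (exp_number \<theta> \<phi>)) = 0"
    by (simp add: W_def witness_apply[OF \<eta>])
  then have "norm (position_proj {x - \<eta>/2..x + \<eta>/2} (exp_number \<theta> \<phi>)) = 0"
    by (metis norm_exp_number norm_zero)
  then have "position_proj {x - \<eta>/2..x + \<eta>/2} (exp_number \<theta> \<phi>) = 0" by simp
  moreover have "position_proj {x - \<eta>/2..x + \<eta>/2} (exp_number \<theta> \<phi>) \<noteq> 0"
    by (rule zero_free_position_proj_nonzero) (use nz \<eta> in \<open>auto simp: stellar_fun_exp_number\<close>)
  ultimately show False by simp
qed

section \<open>Passing to the closed convex hull\<close>

lemma ketbra_apply: "ketbra \<psi> \<phi> = cinner \<psi> \<phi> *\<^sub>C \<psi>"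
proof -
  have "bounded_linear (\<lambda>\<phi>. cinner \<psi> \<phi> *\<^sub>C \<psi>)"
    by (rule bounded_linear_compose[OF bounded_bilinear.bounded_linear_left[OF bounded_bilinear_scaleC]
          bounded_bilinear.bounded_linear_right[OF bounded_bilinear_cinner]])
  then show ?thesis unfolding ketbra_def by (simp add: bounded_linear_Blinfun_apply)
qed

lemma cinner_ketbra: "cinner \<phi> (ketbra \<psi> \<phi>) = complex_of_real ((cmod (cinner \<phi> \<psi>))\<^sup>2)"
  unfolding complex_norm_square ketbra_apply cinner_scaleC_right
  by (subst cinner_commute[of \<psi>]) simp

lemma ketbra_positive: "positive_op (ketbra \<psi>)"
  unfolding positive_op_def clinear_op_def cinner_ketbra
  by (simp add: ketbra_apply cinner_scaleC_right scaleC_scaleC del: of_real_power)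

lemma clinear_op_diff: "clinear_op S \<Longrightarrow> clinear_op T \<Longrightarrow> clinear_op (S - T)"
  by (simp add: clinear_op_def blinfun.diff_left scaleC_diff_right)

lemma convex_positive_bounded_below:
  "convex {T. positive_op T \<and> c \<le> (\<Sum>n<N. inner (v n) (T (v n)))}"
proof (rule convexI)
  fix S T :: "L2 \<Rightarrow>\<^sub>L L2" and p q :: real
  assume S: "S \<in> {T. positive_op T \<and> c \<le> (\<Sum>n<N. inner (v n) (T (v n)))}"
    and T: "T \<in> {T. positive_op T \<and> c \<le> (\<Sum>n<N. inner (v n) (T (v n)))}"
    and pq: "0 \<le> p" "0 \<le> q" "p + q = 1"
  have "positive_op (p *\<^sub>R S + q *\<^sub>R T)"
    using S T pq
    by (auto simp: positive_op_def clinear_op_def blinfun.add_left blinfun.scaleR_left scaleC_add_right scaleR_L2_def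
        scaleC_scaleC cinner_add_right cinner_scaleC_right mult.commute)
  moreover have "(\<Sum>n<N. inner (v n) ((p *\<^sub>R S + q *\<^sub>R T) (v n)))
      = p * (\<Sum>n<N. inner (v n) (S (v n))) + q * (\<Sum>n<N. inner (v n) (T (v n)))"
    by (simp add: blinfun.add_left blinfun.scaleR_left inner_add_right sum.distrib sum_distrib_left)
  moreover have "p * c + q * c \<le> p * (\<Sum>n<N. inner (v n) (S (v n))) + q * (\<Sum>n<N. inner (v n) (T (v n)))"
    using S T pq by (intro add_mono mult_left_mono) auto
  moreover have "p * c + q * c = c" using pq by (simp add: distrib_right[symmetric])
  ultimately show "p *\<^sub>R S + q *\<^sub>R T \<in> {T. positive_op T \<and> c \<le> (\<Sum>n<N. inner (v n) (T (v n)))}" by simp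
qed

text \<open>The constraints define a convex set, which contains the convex hull. Trace-norm
  approximation implies strong convergence, and symmetry, positivity and a bound on a finite sum are
  all closed under it.\<close>

lemma cch_positive_bounded_below:
  assumes S: "\<And>T. T \<in> S \<Longrightarrow> positive_op T \<and> c \<le> (\<Sum>n<N. inner (v n) (T (v n)))"
    and T: "T \<in> cch S"
  shows "positive_op T" "c \<le> (\<Sum>n<N. inner (v n) (T (v n)))"
proof -
  have cl: "clinear_op T" using T by (simp add: cch_def trace_class_def)
  have "convex hull S \<subseteq> {T. positive_op T \<and> c \<le> (\<Sum>n<N. inner (v n) (T (v n)))}"
    using S by (intro hull_minimal convex_positive_bounded_below) auto
  moreover have "\<exists>C\<in>convex hull S. trace_norm (T - C) < ennreal (inverse (real (Suc k)))" for k
    using T by (simp add: cch_def)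
  ultimately have "\<exists>C. positive_op C \<and> c \<le> (\<Sum>n<N. inner (v n) (C (v n)))
      \<and> trace_norm (T - C) < ennreal (inverse (real (Suc k)))" for k by blast
  then obtain C where C: "\<And>k. positive_op (C k)" "\<And>k. c \<le> (\<Sum>n<N. inner (v n) (C k (v n)))"
    "\<And>k. trace_norm (T - C k) < ennreal (inverse (real (Suc k)))" by metis
  have lim: "(\<lambda>k. C k \<phi>) \<longlonglongrightarrow> T \<phi>" for \<phi>
  proof -
    have le: "norm (C k \<phi> - T \<phi>) \<le> inverse (real (Suc k)) * norm \<phi>" for k
      using trace_norm_bound[OF clinear_op_diff[OF cl] C(3)[of k], of \<phi>] C(1)[of k]
      by (simp add: positive_op_def blinfun.diff_left norm_minus_commute)
    have "(\<lambda>k. inverse (real (Suc k)) * norm \<phi>) \<longlonglongrightarrow> 0 * norm \<phi>"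
      by (intro tendsto_mult tendsto_const LIMSEQ_inverse_real_of_nat)
    then have "(\<lambda>k. inverse (real (Suc k)) * norm \<phi>) \<longlonglongrightarrow> 0" by simp
    then have "(\<lambda>k. C k \<phi> - T \<phi>) \<longlonglongrightarrow> 0"
      by (rule Lim_null_comparison[OF always_eventually, rotated]) (use le in blast)
    then show ?thesis by (rule LIM_zero_cancel)
  qed
  have ps: "pos_sa (C k)" for k using C(1) by (simp add: positive_op_iff)
  have "pos_sa T"
    unfolding pos_sa_def
  proof (intro conjI allI)
    fix \<phi> \<psi>
    show "inner \<phi> (T \<psi>) = inner (T \<phi>) \<psi>"
    proof (rule LIMSEQ_unique)
      show "(\<lambda>k. inner \<phi> (C k \<psi>)) \<longlonglongrightarrow> inner \<phi> (T \<psi>)" by (intro tendsto_inner tendsto_const lim)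
      show "(\<lambda>k. inner \<phi> (C k \<psi>)) \<longlonglongrightarrow> inner (T \<phi>) \<psi>"
        unfolding pos_sa_sym[OF ps] by (intro tendsto_inner tendsto_const lim)
    qed
  next
    fix \<phi>
    show "0 \<le> inner \<phi> (T \<phi>)"
      by (rule LIMSEQ_le_const[OF tendsto_inner[OF tendsto_const lim]]) (use pos_sa_nonneg[OF ps] in blast)
  qed
  then show "positive_op T" using cl by (simp add: positive_op_iff)
  show "c \<le> (\<Sum>n<N. inner (v n) (T (v n)))"
  proof (rule LIMSEQ_le_const)
    show "(\<lambda>k. \<Sum>n<N. inner (v n) (C k (v n))) \<longlonglongrightarrow> (\<Sum>n<N. inner (v n) (T (v n)))"
      by (intro tendsto_sum tendsto_inner tendsto_const lim)
  qed (use C(2) in blast)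
qed

text \<open>A lower bound passes to the real infimum only over a nonempty set. The vacuum has energy
  0 and stellar function constantly 1.\<close>

lemma ketbra_vacuum_in_stellar_set:
  assumes "0 \<le> E"
  shows "ketbra (fock 0) \<in> stellar_set 0 E"
proof -
  have "ennreal (real n * (cmod (cinner (fock n) (fock 0)))\<^sup>2) = 0" for n
    by (cases n) auto
  then have "energy (fock 0) = 0"
    by (simp only: energy_def suminf_zero)
  moreover have "stellar_rank (fock 0) \<le> enat 0"
  proof -
    have "stellar_fun (fock 0) z = 1" for z
    proof -
      have "stellar_fun (fock 0) z = (\<Sum>n. if n = 0 then 1 else 0)"
        unfolding stellar_fun_def by (intro suminf_cong) auto
      also have "\<dots> = 1" using sums_unique[OF sums_single[of 0 "\<lambda>n. 1 :: complex"]] by simp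
      finally show ?thesis .
    qed
    then show ?thesis by (simp add: stellar_rank_def)
  qed
  ultimately have "ketbra (fock 0) \<in> convex hull {ketbra \<psi> | \<psi>. norm \<psi> = 1 \<and> energy \<psi> \<le> ennreal E \<and> stellar_rank \<psi> \<le> enat 0}"
    by (intro hull_inc) auto
  moreover have "trace_class (ketbra (fock 0))"
  proof -
    have "trace_norm (ketbra (fock 0)) = (\<Sum>n. ennreal ((cmod (cinner (fock n) (fock 0)))\<^sup>2))"
      unfolding trace_norm_def abs_op_positive[OF ketbra_positive] cinner_ketbra by simp
    also have "\<dots> = 1" unfolding suminf_norm_fock by simp
    finally show ?thesis using ketbra_positive[of "fock 0"] by (simp add: trace_class_def positive_op_def)
  qed
  moreover have "trace_norm (ketbra (fock 0) - ketbra (fock 0)) = 0"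
  proof -
    have "positive_op 0" by (simp add: positive_op_def clinear_op_def)
    from abs_op_positive[OF this] show ?thesis by (simp add: trace_norm_def)
  qed
  ultimately show ?thesis
    unfolding stellar_set_def cch_def by (auto intro!: bexI[of _ "ketbra (fock 0)"])
qed

theorem theorem4:
  fixes x \<theta> E :: real
  assumes "0 \<le> \<theta>" and "\<theta> < 2 * pi" and "0 \<le> E"
  shows "\<exists>\<delta>>0. \<forall>\<eta>. 0 < \<eta> \<and> \<eta> \<le> \<delta> \<longrightarrow> 0 < threshold E \<theta> x \<eta>"
proof (intro exI[of _ 1] conjI allI impI)
  \<comment> \<open>Any positive \<delta> will do: each fixed positive width produces its own
    constant c.\<close>
  fix \<eta> :: real assume "0 < \<eta> \<and> \<eta> \<le> 1"
  then have \<eta>: "0 < \<eta>" by simp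
  define W where "W = witness \<theta> x \<eta>"
  have W: "projector_op W" unfolding W_def by (rule witness_projector[OF \<eta>])
  obtain N c where c: "0 < c" and bound:
    "\<forall>\<psi>. norm \<psi> = 1 \<longrightarrow> energy \<psi> \<le> ennreal E \<longrightarrow> stellar_rank \<psi> \<le> enat 0 \<longrightarrow>
       c \<le> (\<Sum>n<N. (cmod (cinner (fock n) (W \<psi>)))\<^sup>2)"
    using uniform_witness_bound[OF \<eta> \<open>0 \<le> E\<close>, of \<theta> x] unfolding W_def by blast
  have "c \<le> Re (op_trace (\<sigma> o\<^sub>L W))" if \<sigma>: "\<sigma> \<in> stellar_set 0 E" for \<sigma>
  proof -
    have pure: "positive_op T \<and> c \<le> (\<Sum>n<N. inner (W (fock n)) (T (W (fock n))))"
      if T: "T \<in> {ketbra \<psi> | \<psi>. norm \<psi> = 1 \<and> energy \<psi> \<le> ennreal E \<and> stellar_rank \<psi> \<le> enat 0}" for T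
    proof -
      obtain \<psi> where \<psi>: "T = ketbra \<psi>" "norm \<psi> = 1" "energy \<psi> \<le> ennreal E" "stellar_rank \<psi> \<le> enat 0"
        using T by blast
      \<comment> \<open>Moving W onto the basis vector turns the squared coefficient of W \<psi>
        into a matrix element of the projector on \<psi>, which is linear in the state.\<close>
      have "cinner (fock n) (W \<psi>) = cinner (W (fock n)) \<psi>" for n
        using W by (simp add: projector_op_def)
      then have "inner (W (fock n)) (T (W (fock n))) = (cmod (cinner (fock n) (W \<psi>)))\<^sup>2" for n
        by (simp add: inner_L2_def \<psi>(1) cinner_ketbra)
      then show ?thesis using bound \<psi>(2-4) ketbra_positive by (simp add: \<psi>(1))
    qed
    note \<sigma>' = \<sigma>[unfolded stellar_set_def]
    have pos: "positive_op \<sigma>" and low: "c \<le> (\<Sum>n<N. inner (W (fock n)) (\<sigma> (W (fock n))))"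
      using cch_positive_bounded_below[OF pure \<sigma>'] by auto
    have "trace_norm \<sigma> < \<infinity>" using \<sigma>' by (simp add: cch_def trace_class_def)
    note sums = op_trace_projector_sums[OF pos this W]
    have "0 \<le> inner \<phi> (\<sigma> \<phi>)" for \<phi>
      using pos pos_sa_nonneg[of \<sigma> \<phi>] unfolding positive_op_iff by blast
    \<comment> \<open>The rewritten trace has nonnegative terms, so its first N terms already bound
      it from below.\<close>
    then have "(\<Sum>n<N. inner (W (fock n)) (\<sigma> (W (fock n)))) \<le> Re (op_trace (\<sigma> o\<^sub>L W))"
      unfolding sums_unique[OF sums] by (intro sum_le_suminf sums_summable[OF sums]) auto
    then show ?thesis using low by simp
  qed
  then have "c \<le> threshold E \<theta> x \<eta>"
    unfolding threshold_def W_def[symmetric]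
    using ketbra_vacuum_in_stellar_set[OF \<open>0 \<le> E\<close>] by (intro cINF_greatest) auto
  then show "0 < threshold E \<theta> x \<eta>" using c by simp
qed simp

end
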